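(* Suppose that $\Delta u=\Delta v=0$ in $\mathbb{R}^n$, that $u$ is a harmonic polynomial, and that $Z(u)=Z(v)$. Then there is a constant $c\in\mathbb{R}\setminus\{0\}$ such that $v=c\cdot u$.
   Context: $u,v$ are real-valued functions on $\mathbb{R}^n$, and $Z(w)=\{x\in\mathbb{R}^n: w(x)=0\}$ denotes the zero set. *)

theory Defs
  imports "HOL-Analysis.Analysis"
begin

definition partial_deriv :: "'a::euclidean_space \<Rightarrow> ('a \<Rightarrow> real) \<Rightarrow> 'a \<Rightarrow> real"
  where "partial_deriv b f x = deriv (\<lambda>t. f (x + t *\<^sub>R b)) 0"

definition C1_function :: "('a::euclidean_space \<Rightarrow> real) \<Rightarrow> bool"
  where "C1_function f \<longleftrightarrow>
    (\<forall>b\<in>Basis. (\<forall>x. (\<lambda>t::real. f (x + t *\<^sub>R b)) differentiable (at 0)) \<and>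
      continuous_on UNIV (partial_deriv b f))"

definition C2_function :: "('a::euclidean_space \<Rightarrow> real) \<Rightarrow> bool"
  where "C2_function f \<longleftrightarrow> C1_function f \<and> (\<forall>b\<in>Basis. C1_function (partial_deriv b f))"

definition laplacian :: "('a::euclidean_space \<Rightarrow> real) \<Rightarrow> 'a \<Rightarrow> real"
  where "laplacian f x = (\<Sum>b\<in>Basis. partial_deriv b (partial_deriv b f) x)"

(* The derivative operator deriv is total, so the regularity has to be required
   separately from the equation. *)
definition harmonic :: "('a::euclidean_space \<Rightarrow> real) \<Rightarrow> bool"
  where "harmonic f \<longleftrightarrow> C2_function f \<and> (\<forall>x. laplacian f x = 0)"

definition zero_set :: "('a \<Rightarrow> real) \<Rightarrow> 'a set"
  where "zero_set w = {x. w x = 0}"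

end

theory Submission
  imports Defs "HOL-Computational_Algebra.Fundamental_Theorem_Algebra"
begin

text \<open>First, \<open>u v\<close> has constant sign, say \<open>u v \<ge> 0\<close>: otherwise the set where the sign changes would
  separate space, but it consists of singular zeros of \<open>u\<close> and has codimension two.

  Decomposing \<open>u\<close> into homogeneous harmonic parts \<open>u\<^sub>j\<close>, the integral of \<open>u\<^sub>j(x) v(R x)\<close> against a
  fixed radial weight is exactly a multiple of \<open>R\<^sup>j\<close>. Since \<open>u v \<ge> 0\<close>, this bounds the integral of
  \<open>\<bar>u v\<bar>\<close> over balls, and, \<open>u\<close> being small only on a small set, it bounds \<open>v\<close> by a constant times
  \<open>(1 + \<bar>x\<bar>)\<^sup>d\<close> with \<open>d = deg u\<close>. By Liouville's theorem \<open>v\<close> is a polynomial of degree at most \<open>d\<close>.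

  Finally the quotient \<open>f = v / u > 0\<close> satisfies the degenerate elliptic equation
  \<open>div (u\<^sup>2 \<nabla>f) = 0\<close>, in which \<open>u\<^sup>2 \<nabla>f = u \<nabla>v - v \<nabla>u\<close> vanishes on the zero set. Testing it with
  bounded functions of \<open>f\<close> and cut-offs shows that the leading parts of \<open>u\<close> and \<open>v\<close> have equal
  degree and are proportional, \<open>v\<^sub>d = c u\<^sub>d\<close>; a nonzero remainder \<open>v - c u\<close> of lower degree is then
  excluded by the same identity, rescaled at infinity.\<close>

subsection \<open>Calculus with compactly supported functions\<close>

text \<open>All integrals are volume integrals against the weights \<open>bump a k\<close>, that is
  (a - |x|^2)^k cut off at zero. Their gradients are radial, so a single identity of Green type,
  read with Euler's relation for homogeneous functions, yields the scaling law in R, the mean value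
  property and the comparison of degrees. As \<open>v\<close> has no growth bound at the start, the
  sign argument gets by with the density of u \<noteq> 0 and a local minimum principle for
  \<open>v\<close>. The quotient v / u has no a priori bound near the common zeros. When u v \<ge>
  0, the sum s = u + v satisfies |u|, |v| \<le> |s|, so v / s is a bounded increasing function of v
  / u, and test functions built from v / s replace those built from v / u. At infinity a remainder
  of lower degree, rescaled with its own degree, has no uniform bound by s; only a one-sided bound
  on the energy integrand survives.\<close>

lemma integrable_compact_support:
  fixes f :: "'a::euclidean_space \<Rightarrow> 'b::{banach, second_countable_topology}"
  assumes "continuous_on UNIV f" and "\<And>x. norm x > r \<Longrightarrow> f x = 0"
  shows "integrable lborel f"
proof -
  have "integrable lborel (\<lambda>x. indicator (cball 0 r) x *\<^sub>R f x)"
    using assms(1) by (intro borel_integrable_compact) (auto intro: continuous_on_subset)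
  moreover have "(\<lambda>x. indicator (cball 0 r) x *\<^sub>R f x) = f"
    using assms(2) by (force simp: indicator_def)
  ultimately show ?thesis by simp
qed

lemma integral_cbox_compact_support:
  fixes f :: "'a::euclidean_space \<Rightarrow> real"
  assumes "continuous_on UNIV f" and "\<And>x. x \<notin> cbox a b \<Longrightarrow> f x = 0"
  shows "integral (cbox a b) f = (\<integral>x. f x \<partial>lborel)"
proof -
  have *: "set_integrable lborel (cbox a b) f"
    unfolding set_integrable_def
    using assms(1) by (intro borel_integrable_compact) (auto intro: continuous_on_subset)
  have "(\<lambda>x. indicator (cbox a b) x *\<^sub>R f x) = f"
    using assms(2) by (force simp: indicator_def)
  then show ?thesis
    using set_borel_integral_eq_integral(2)[OF *] by (simp add: set_lebesgue_integral_def)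
qed

text \<open>The support is controlled only for \<open>t\<close> within 1 of \<open>t0\<close>,
  because in the translation argument it moves with \<open>t\<close>. The Leibniz rule is applied on
  the interval \<open>U\<close> over one fixed box containing all these supports.\<close>

lemma DERIV_integral_compact_support:
  fixes f :: "real \<Rightarrow> 'a::euclidean_space \<Rightarrow> real"
  assumes f': "\<And>t y. ((\<lambda>t. f t y) has_real_derivative f' t y) (at t)"
    and cont_f: "\<And>t. continuous_on UNIV (f t)"
    and cont_f': "continuous_on UNIV (\<lambda>(t, y). f' t y)"
    and supp: "\<And>t y. \<bar>t - t0\<bar> \<le> 1 \<Longrightarrow> norm y > r \<Longrightarrow> f t y = 0"
  shows "((\<lambda>t. \<integral>y. f t y \<partial>lborel) has_real_derivative (\<integral>y. f' t0 y \<partial>lborel)) (at t0)"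
proof -
  obtain a :: 'a where a: "cball 0 r \<subseteq> cbox (-a) a"
    using bounded_subset_cbox_symmetric[OF bounded_cball] by metis
  have out: "norm y > r" if "y \<notin> cbox (-a) a" for y
    using that a by (force simp: subset_iff)
  define U where "U = ball t0 (1::real)"
  have supp': "f' t0 y = 0" if "norm y > r" for y
  proof (rule DERIV_unique)
    show "((\<lambda>t. f t y) has_real_derivative f' t0 y) (at t0)" by (rule f')
    show "((\<lambda>t. f t y) has_real_derivative 0) (at t0)"
    proof (rule has_field_derivative_transform_within_open[where S=U])
      show "((\<lambda>t. 0) has_real_derivative 0) (at t0)" by simp
    qed (use supp that in \<open>auto simp: U_def dist_real_def abs_minus_commute\<close>)
  qed
  have "((\<lambda>t. integral (cbox (-a) a) (f t)) has_field_derivative integral (cbox (-a) a) (f' t0)) (at t0 within U)"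
  proof (rule leibniz_rule_field_derivative)
    show "(f t) integrable_on cbox (-a) a" for t
      by (intro integrable_continuous continuous_on_subset[OF cont_f]) auto
    show "continuous_on (U \<times> cbox (- a) a) (\<lambda>(t, y). f' t y)"
      by (rule continuous_on_subset[OF cont_f']) auto
  qed (use f' in \<open>auto simp: U_def intro: has_field_derivative_at_within\<close>)
  then have "((\<lambda>t. integral (cbox (-a) a) (f t)) has_field_derivative integral (cbox (-a) a) (f' t0)) (at t0)"
    using at_within_open[of t0 U] by (simp add: U_def)
  moreover have "integral (cbox (-a) a) (f' t0) = (\<integral>y. f' t0 y \<partial>lborel)"
  proof (rule integral_cbox_compact_support)
    show "continuous_on UNIV (f' t0)"
      using continuous_on_compose2[OF cont_f', of UNIV "\<lambda>y. (t0, y)"]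
      by (simp add: continuous_on_Pair)
  qed (use supp' out in auto)
  ultimately have "((\<lambda>t. integral (cbox (-a) a) (f t)) has_field_derivative (\<integral>y. f' t0 y \<partial>lborel)) (at t0)"
    by simp
  then show ?thesis
  proof (rule has_field_derivative_transform_within_open[where S=U])
    fix t assume "t \<in> U"
    then show "integral (cbox (-a) a) (f t) = (\<integral>y. f t y \<partial>lborel)"
      using supp out by (intro integral_cbox_compact_support cont_f) (auto simp: U_def dist_real_def)
  qed (auto simp: U_def)
qed

lemma lborel_integral_translation:
  fixes f :: "'a::euclidean_space \<Rightarrow> real"
  assumes [measurable]: "f \<in> borel_measurable borel"
  shows "(\<integral>x. f (a + x) \<partial>lborel) = (\<integral>x. f x \<partial>lborel)"
proof -
  have "(lborel :: 'a measure) = distr lborel borel (\<lambda>x. a + x)"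
    using lborel_affine[of 1 a] by (simp add: density_1)
  then have "(\<integral>x. f x \<partial>lborel) = (\<integral>x. f x \<partial>distr lborel borel (\<lambda>x. a + x))"
    by simp
  also have "\<dots> = (\<integral>x. f (a + x) \<partial>lborel)"
    by (subst integral_distr) auto
  finally show ?thesis by simp
qed

text \<open>\<open>partial_deriv\<close> is total and says nothing about existence; this relation
  also asserts existence everywhere. The direction \<open>b\<close> need not be a basis vector:
  taking a point itself as the direction gives derivatives along rays.\<close>

definition has_partial :: "('a::euclidean_space \<Rightarrow> real) \<Rightarrow> 'a \<Rightarrow> ('a \<Rightarrow> real) \<Rightarrow> bool"
  where "has_partial f b g \<longleftrightarrow> (\<forall>x. ((\<lambda>t. f (x + t *\<^sub>R b)) has_real_derivative g x) (at 0))"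

lemma has_partialD:
  assumes "has_partial f b g"
  shows "((\<lambda>t. f (x + t *\<^sub>R b)) has_real_derivative g (x + t *\<^sub>R b)) (at t)"
proof -
  have "((\<lambda>s. f ((x + t *\<^sub>R b) + s *\<^sub>R b)) has_real_derivative g (x + t *\<^sub>R b)) (at 0)"
    using assms by (auto simp: has_partial_def)
  then have "((\<lambda>s. f (x + (s + t) *\<^sub>R b)) has_real_derivative g (x + t *\<^sub>R b)) (at 0)"
    by (simp add: algebra_simps)
  then show ?thesis
    using DERIV_shift[of "\<lambda>s. f (x + s *\<^sub>R b)" "g (x + t *\<^sub>R b)" 0 t] by simp
qed

lemma has_partial_imp_eq: "has_partial f b g \<Longrightarrow> partial_deriv b f = g"
  unfolding has_partial_def partial_deriv_def by (auto intro: DERIV_imp_deriv)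

lemma has_partial_unique: "has_partial f b g \<Longrightarrow> has_partial f b h \<Longrightarrow> g = h"
  using has_partial_imp_eq by metis

lemma has_partial_lin:
  assumes "has_partial f b f'" "has_partial g b g'"
  shows "has_partial (\<lambda>x. \<alpha> * f x + \<beta> * g x) b (\<lambda>x. \<alpha> * f' x + \<beta> * g' x)"
  using assms unfolding has_partial_def by (auto intro!: derivative_eq_intros)

lemma has_partial_mult:
  assumes "has_partial f b f'" "has_partial g b g'"
  shows "has_partial (\<lambda>x. f x * g x) b (\<lambda>x. f x * g' x + g x * f' x)"
  unfolding has_partial_def
proof
  fix x
  show "((\<lambda>t. f (x + t *\<^sub>R b) * g (x + t *\<^sub>R b)) has_real_derivative f x * g' x + g x * f' x) (at 0)"
    using DERIV_mult[of "\<lambda>t. f (x + t *\<^sub>R b)" "f' x" 0 UNIV "\<lambda>t. g (x + t *\<^sub>R b)" "g' x"] assms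
    by (simp add: has_partial_def algebra_simps)
qed

lemma has_partial_affine:
  assumes "has_partial f b g"
  shows "has_partial (\<lambda>x. f (a + r *\<^sub>R x)) b (\<lambda>x. r * g (a + r *\<^sub>R x))"
  unfolding has_partial_def
proof
  fix x
  have "((\<lambda>t. f ((a + r *\<^sub>R x) + t *\<^sub>R b)) has_real_derivative g (a + r *\<^sub>R x)) (at (r * 0))"
    using assms by (simp add: has_partial_def)
  moreover have "((\<lambda>t. r * t) has_real_derivative r) (at 0)"
    by (auto intro!: derivative_eq_intros)
  ultimately have "(((\<lambda>t. f ((a + r *\<^sub>R x) + t *\<^sub>R b)) \<circ> (\<lambda>t. r * t)) has_real_derivative g (a + r *\<^sub>R x) * r) (at 0)"
    by (rule DERIV_chain)
  then show "((\<lambda>t. f (a + r *\<^sub>R (x + t *\<^sub>R b))) has_real_derivative r * g (a + r *\<^sub>R x)) (at 0)"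
    by (simp add: o_def algebra_simps)
qed

lemma has_partial_GDERIV:
  assumes "\<And>x. GDERIV f x :> f' x"
  shows "has_partial f b (\<lambda>x. f' x \<bullet> b)"
  unfolding has_partial_def
proof
  fix x
  have "((\<lambda>t::real. x + t *\<^sub>R b) has_derivative (\<lambda>t. t *\<^sub>R b)) (at 0)"
    by (auto intro!: derivative_eq_intros)
  moreover have "(f has_derivative (\<lambda>h. h \<bullet> f' x)) (at (x + 0 *\<^sub>R b))"
    using assms[of x] by (simp add: gderiv_def)
  ultimately have "((\<lambda>t::real. f (x + t *\<^sub>R b)) has_derivative (\<lambda>t. (t *\<^sub>R b) \<bullet> f' x)) (at 0)"
    by (rule has_derivative_compose)
  then show "((\<lambda>t. f (x + t *\<^sub>R b)) has_real_derivative f' x \<bullet> b) (at 0)"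
    by (simp add: has_field_derivative_def mult.commute inner_commute mult_commute_abs)
qed

text \<open>The integral of g(x + t b) does not depend on \<open>t\<close>, by translation
  invariance; differentiating it at t = 0 under the integral sign gives the claim. Combined with the
  product rule this is integration by parts.\<close>

lemma integral_has_partial_eq_0:
  fixes g :: "'a::euclidean_space \<Rightarrow> real"
  assumes g': "has_partial g b g'" and "continuous_on UNIV g" and cont: "continuous_on UNIV g'"
    and supp: "\<And>x. norm x > r \<Longrightarrow> g x = 0"
  shows "(\<integral>x. g' x \<partial>lborel) = 0"
proof -
  have "((\<lambda>t. \<integral>x. g (x + t *\<^sub>R b) \<partial>lborel) has_real_derivative (\<integral>x. g' (x + 0 *\<^sub>R b) \<partial>lborel)) (at 0)"
  proof (rule DERIV_integral_compact_support[where r="r + norm b"])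
    show "((\<lambda>t. g (y + t *\<^sub>R b)) has_real_derivative g' (y + t *\<^sub>R b)) (at t)" for t y
      by (rule has_partialD[OF g'])
    show "continuous_on UNIV (\<lambda>y. g (y + t *\<^sub>R b))" for t
      by (intro continuous_on_compose2[OF assms(2)] continuous_intros) auto
    show "continuous_on UNIV (\<lambda>(t::real, y). g' (y + t *\<^sub>R b))"
      unfolding split_beta by (intro continuous_on_compose2[OF cont] continuous_intros) auto
    fix t :: real and y :: 'a assume "\<bar>t - 0\<bar> \<le> 1" and y: "norm y > r + norm b"
    then have "\<bar>t\<bar> * norm b \<le> norm b" by (simp add: mult_left_le_one_le)
    moreover have "norm y \<le> norm (y + t *\<^sub>R b) + norm (t *\<^sub>R b)"
      by (metis add_diff_cancel_right' norm_triangle_ineq4)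
    ultimately have "norm (y + t *\<^sub>R b) > r" using y by simp
    then show "g (y + t *\<^sub>R b) = 0" by (rule supp)
  qed
  moreover have "(\<integral>x. g (x + t *\<^sub>R b) \<partial>lborel) = (\<integral>x. g x \<partial>lborel)" for t
    using lborel_integral_translation[of g "t *\<^sub>R b"] assms(2)
    by (simp add: add.commute borel_measurable_continuous_onI)
  ultimately show ?thesis
    by (auto dest: DERIV_unique[OF _ DERIV_const])
qed

section \<open>Gradients and total differentiability of C1 functions\<close>

definition grad :: "('a::euclidean_space \<Rightarrow> real) \<Rightarrow> 'a \<Rightarrow> 'a"
  where "grad f x = (\<Sum>b\<in>Basis. partial_deriv b f x *\<^sub>R b)"

lemma grad_inner_Basis: "b \<in> Basis \<Longrightarrow> grad f x \<bullet> b = partial_deriv b f x"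
  by (simp add: grad_def inner_sum_left inner_Basis if_distrib cong: if_cong)

lemma C1_function_has_partial:
  assumes "C1_function f" "b \<in> Basis"
  shows "has_partial f b (partial_deriv b f)" "continuous_on UNIV (partial_deriv b f)"
  using assms unfolding C1_function_def has_partial_def partial_deriv_def
  by (auto simp: DERIV_deriv_iff_real_differentiable)

lemma C1_functionI:
  assumes "\<And>b. b \<in> Basis \<Longrightarrow> has_partial f b (g b)" "\<And>b. b \<in> Basis \<Longrightarrow> continuous_on UNIV (g b)"
  shows "C1_function f"
  unfolding C1_function_def
proof (intro ballI conjI allI)
  fix b x assume "b \<in> (Basis :: 'a set)"
  then show "(\<lambda>t. f (x + t *\<^sub>R b)) differentiable at 0"
    using assms(1) unfolding has_partial_def by (auto simp: real_differentiable_def)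
next
  fix b assume "b \<in> (Basis :: 'a set)"
  then show "continuous_on UNIV (partial_deriv b f)"
    using assms has_partial_imp_eq by metis
qed

text \<open>\<open>C1_function\<close> speaks of partial derivatives only. Changing one coordinate
  at a time, with a mean value estimate for each, gives total differentiability.\<close>

lemma C1_function_GDERIV:
  fixes f :: "'a::euclidean_space \<Rightarrow> real"
  assumes "C1_function f"
  shows "GDERIV f x :> grad f x"
proof -
  \<comment> \<open>The bound is uniform in the base point \<open>y\<close> near \<open>x\<close>,
    with the partial derivatives frozen at \<open>x\<close>: the induction applies it at y + c b,
    after the coordinate along \<open>b\<close> has been moved.\<close>
  have step: "\<exists>\<delta>>0. \<forall>y h. norm (y - x) < \<delta> \<longrightarrow> norm h < \<delta> \<longrightarrow>
      \<bar>f (y + (\<Sum>b\<in>S. (h \<bullet> b) *\<^sub>R b)) - f y - (\<Sum>b\<in>S. (h \<bullet> b) * partial_deriv b f x)\<bar> \<le> card S * \<epsilon> * norm h"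
    if "finite S" "S \<subseteq> Basis" "\<epsilon> > 0" for S and \<epsilon> :: real
    using that
  proof (induction S)
    case empty
    then show ?case by (auto intro!: exI[of _ 1])
  next
    case (insert b S)
    then obtain \<delta> where \<delta>: "\<delta> > 0" and IH: "\<And>y h. norm (y - x) < \<delta> \<Longrightarrow> norm h < \<delta> \<Longrightarrow>
      \<bar>f (y + (\<Sum>b\<in>S. (h \<bullet> b) *\<^sub>R b)) - f y - (\<Sum>b\<in>S. (h \<bullet> b) * partial_deriv b f x)\<bar> \<le> card S * \<epsilon> * norm h"
      by auto
    have b: "b \<in> Basis" using insert by auto
    note pd = C1_function_has_partial[OF assms b]
    obtain \<delta>' where \<delta>': "\<delta>' > 0" and
      close: "\<And>z. dist z x < \<delta>' \<Longrightarrow> dist (partial_deriv b f z) (partial_deriv b f x) < \<epsilon>"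
      using pd(2) \<open>\<epsilon> > 0\<close> unfolding continuous_on_iff by (metis UNIV_I)
    define \<eta> where "\<eta> = min \<delta> \<delta>' / 2"
    have \<eta>: "\<eta> > 0" "\<eta> * 2 \<le> \<delta>" "\<eta> * 2 \<le> \<delta>'" using \<delta> \<delta>' by (auto simp: \<eta>_def)
    show ?case
    proof (intro exI conjI allI impI)
      show "\<eta> > 0" by fact
      fix y h :: 'a assume y: "norm (y - x) < \<eta>" and h: "norm h < \<eta>"
      define c where "c = h \<bullet> b"
      have c: "\<bar>c\<bar> \<le> norm h" unfolding c_def using b by (metis Basis_le_norm)
      have near: "norm (y + t *\<^sub>R b - x) < 2 * \<eta>" if "\<bar>t\<bar> \<le> \<bar>c\<bar>" for t
      proof -
        have "norm (y + t *\<^sub>R b - x) \<le> norm (y - x) + norm (t *\<^sub>R b)"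
          using norm_triangle_ineq[of "y - x" "t *\<^sub>R b"] by (simp add: algebra_simps)
        also have "\<dots> < 2 * \<eta>" using y h c that b by simp
        finally show ?thesis .
      qed
      have mv: "norm (f (y + c *\<^sub>R b) - f y - c * partial_deriv b f x) \<le> \<epsilon> * norm h"
      proof -
        have "norm ((f (y + c *\<^sub>R b) - c * partial_deriv b f x) - (f (y + 0 *\<^sub>R b) - 0 * partial_deriv b f x))
            \<le> \<epsilon> * norm (c - 0)"
        proof (rule differentiable_bound[where S="closed_segment 0 c" and f="\<lambda>t. f (y + t *\<^sub>R b) - t * partial_deriv b f x"
              and f'="\<lambda>t s. s * (partial_deriv b f (y + t *\<^sub>R b) - partial_deriv b f x)"])
          fix t assume "t \<in> closed_segment 0 c"
          then have t: "\<bar>t\<bar> \<le> \<bar>c\<bar>" by (auto simp: closed_segment_eq_real_ivl split: if_splits)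
          have "((\<lambda>t. f (y + t *\<^sub>R b) - t * partial_deriv b f x) has_real_derivative
              (partial_deriv b f (y + t *\<^sub>R b) - partial_deriv b f x)) (at t)"
            by (auto intro!: derivative_eq_intros has_partialD[OF pd(1)])
          then show "((\<lambda>t. f (y + t *\<^sub>R b) - t * partial_deriv b f x) has_derivative
              (\<lambda>s. s * (partial_deriv b f (y + t *\<^sub>R b) - partial_deriv b f x))) (at t within closed_segment 0 c)"
            by (simp add: has_field_derivative_def mult_commute_abs has_derivative_at_withinI mult.commute)
          have "\<bar>partial_deriv b f (y + t *\<^sub>R b) - partial_deriv b f x\<bar> \<le> \<epsilon>"
            using close[of "y + t *\<^sub>R b"] near[OF t] \<eta> by (auto simp: dist_norm)
          then show "onorm (\<lambda>s. s * (partial_deriv b f (y + t *\<^sub>R b) - partial_deriv b f x)) \<le> \<epsilon>"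
            by (intro onorm_le) (simp add: abs_mult mult.commute[of \<epsilon>] mult_left_mono)
        qed auto
        also have "\<dots> \<le> \<epsilon> * norm h" using c \<open>\<epsilon> > 0\<close> by simp
        finally show ?thesis by simp
      qed
      have "norm (y + c *\<^sub>R b - x) < \<delta>" "norm h < \<delta>"
        using near[of c] \<eta> h by auto
      from IH[OF this]
      have "\<bar>f (y + c *\<^sub>R b + (\<Sum>b\<in>S. (h \<bullet> b) *\<^sub>R b)) - f (y + c *\<^sub>R b) - (\<Sum>b\<in>S. (h \<bullet> b) * partial_deriv b f x)\<bar>
          \<le> card S * \<epsilon> * norm h" .
      with mv have "\<bar>f (y + c *\<^sub>R b + (\<Sum>b\<in>S. (h \<bullet> b) *\<^sub>R b)) - f y - (c * partial_deriv b f x + (\<Sum>b\<in>S. (h \<bullet> b) * partial_deriv b f x))\<bar>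
          \<le> card S * \<epsilon> * norm h + \<epsilon> * norm h"
        unfolding real_norm_def by linarith
      then show "\<bar>f (y + (\<Sum>b\<in>insert b S. (h \<bullet> b) *\<^sub>R b)) - f y - (\<Sum>b\<in>insert b S. (h \<bullet> b) * partial_deriv b f x)\<bar>
          \<le> card (insert b S) * \<epsilon> * norm h"
        using insert by (simp add: c_def algebra_simps)
    qed
  qed
  show ?thesis
    unfolding gderiv_def has_derivative_at_alt
  proof (intro conjI allI impI)
    show "bounded_linear (\<lambda>h. h \<bullet> grad f x)" by (rule bounded_linear_inner_left)
    fix e :: real assume "e > 0"
    define \<epsilon> where "\<epsilon> = e / DIM('a)"
    have "\<epsilon> > 0" using \<open>e > 0\<close> by (simp add: \<epsilon>_def)
    from step[OF finite_Basis order_refl this] obtain \<delta> where "\<delta> > 0" and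
      d: "\<And>y h. norm (y - x) < \<delta> \<Longrightarrow> norm h < \<delta> \<Longrightarrow>
      \<bar>f (y + (\<Sum>b\<in>Basis. (h \<bullet> b) *\<^sub>R b)) - f y - (\<Sum>b\<in>Basis. (h \<bullet> b) * partial_deriv b f x)\<bar> \<le> DIM('a) * \<epsilon> * norm h"
      by blast
    show "\<exists>d>0. \<forall>y. norm (y - x) < d \<longrightarrow> norm (f y - f x - (y - x) \<bullet> grad f x) \<le> e * norm (y - x)"
    proof (intro exI conjI allI impI)
      show "\<delta> > 0" by fact
      fix y assume "norm (y - x) < \<delta>"
      moreover have "(y - x) \<bullet> grad f x = (\<Sum>b\<in>Basis. ((y - x) \<bullet> b) * partial_deriv b f x)"
        by (simp add: grad_def inner_sum_right mult.commute)
      ultimately show "norm (f y - f x - (y - x) \<bullet> grad f x) \<le> e * norm (y - x)"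
        using d[of x "y - x"] \<open>\<delta> > 0\<close> by (simp add: \<epsilon>_def euclidean_representation)
    qed
  qed
qed

lemma C1_function_continuous: "C1_function f \<Longrightarrow> continuous_on UNIV f"
  by (meson C1_function_GDERIV gderiv_def has_derivative_continuous continuous_at_imp_continuous_on)

lemma C1_function_continuous_grad: "C1_function f \<Longrightarrow> continuous_on UNIV (grad f)"
  unfolding grad_def by (intro continuous_intros C1_function_has_partial(2)) auto

lemma GDERIV_unique: "GDERIV f x :> a \<Longrightarrow> GDERIV f x :> b \<Longrightarrow> a = b"
  unfolding gderiv_def using has_derivative_unique
  by (metis (no_types) inner_commute vector_eq_rdot)

section \<open>Truncated powers and radial weights\<close>

lemma DERIV_pos_part_power:
  "((\<lambda>s::real. max 0 s ^ Suc (Suc k)) has_real_derivative real (k + 2) * max 0 s ^ Suc k) (at s)"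
proof -
  consider "s > 0" | "s < 0" | "s = 0" by linarith
  then show ?thesis
  proof cases
    case 1
    have "((\<lambda>s. s ^ Suc (Suc k)) has_real_derivative real (k + 2) * s ^ Suc k) (at s)"
      by (rule DERIV_cong[OF DERIV_pow]) simp
    then have "((\<lambda>s. max 0 s ^ Suc (Suc k)) has_real_derivative real (k + 2) * s ^ Suc k) (at s)"
      by (rule has_field_derivative_transform_within_open[where S="{0<..}"]) (use 1 in auto)
    then show ?thesis using 1 by simp
  next
    case 2
    have "((\<lambda>s. 0) has_real_derivative 0) (at s)" by simp
    then have "((\<lambda>s. max 0 s ^ Suc (Suc k)) has_real_derivative 0) (at s)"
      by (rule has_field_derivative_transform_within_open[where S="{..<0}"]) (use 2 in auto)
    then show ?thesis using 2 by simp
  next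
    case 3
    have "(\<lambda>h. (max 0 (0 + h) ^ Suc (Suc k) - max 0 0 ^ Suc (Suc k)) / h) \<midarrow>0\<rightarrow> (0::real)"
    proof (rule Lim_null_comparison)
      show "\<forall>\<^sub>F h in at 0. norm ((max 0 (0 + h) ^ Suc (Suc k) - max 0 0 ^ Suc (Suc k)) / h) \<le> \<bar>h\<bar> ^ Suc k"
      proof (intro always_eventually allI)
        fix h :: real
        show "norm ((max 0 (0 + h) ^ Suc (Suc k) - max 0 0 ^ Suc (Suc k)) / h) \<le> \<bar>h\<bar> ^ Suc k"
          by (cases "h > 0") (auto simp: max_def intro!: mult_nonpos_nonneg)
      qed
      show "(\<lambda>h::real. \<bar>h\<bar> ^ Suc k) \<midarrow>0\<rightarrow> 0"
        by (rule tendsto_eq_intros refl | simp)+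
    qed
    then show ?thesis using 3 by (simp add: DERIV_def)
  qed
qed

text \<open>Radial weight supported in the ball of radius sqrt a. For k \<ge> 2 it is C1, and its
  gradient is a multiple of \<open>bump a (k - 1) x\<close> times the vector \<open>x\<close>. With
  a = 1 it lives on the unit ball; a = 8 gives a weight bounded below on the ball of radius
  2.\<close>

definition bump :: "real \<Rightarrow> nat \<Rightarrow> 'a::real_inner \<Rightarrow> real"
  where "bump a k x = max 0 (a - x \<bullet> x) ^ k"

lemma bump_nonneg: "bump a k x \<ge> 0"
  by (simp add: bump_def)

lemma continuous_bump: "continuous_on S (bump a k)"
  unfolding bump_def by (intro continuous_intros)

lemma bump_eq_0: "norm x > r \<Longrightarrow> r \<ge> 0 \<Longrightarrow> a \<le> r\<^sup>2 \<Longrightarrow> k > 0 \<Longrightarrow> bump a k x = 0"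
  unfolding bump_def dot_square_norm
  by (smt (verit) power_mono power2_eq_square max_absorb1 zero_power power_strict_mono pos2)

lemma GDERIV_bump:
  "GDERIV (bump a (Suc (Suc k))) x :> (- (2 * real (k + 2) * bump a (Suc k) x)) *\<^sub>R x"
proof -
  have "GDERIV (\<lambda>x. a - x \<bullet> x) x :> - (2 *\<^sub>R x)"
    unfolding gderiv_def
    by (rule derivative_eq_intros refl | simp add: inner_commute)+
  from GDERIV_DERIV_compose[OF this DERIV_pos_part_power]
  show ?thesis unfolding bump_def by (rule GDERIV_subst) (simp add: algebra_simps)
qed

subsection \<open>Harmonic functions and Green's identity\<close>

lemma harmonicI:
  fixes f :: "'a::euclidean_space \<Rightarrow> real"
  assumes "\<And>b. b \<in> Basis \<Longrightarrow> has_partial f b (f1 b)" "\<And>b. b \<in> Basis \<Longrightarrow> continuous_on UNIV (f1 b)"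
    and "\<And>b c. b \<in> Basis \<Longrightarrow> c \<in> Basis \<Longrightarrow> has_partial (f1 b) c (f2 b c)"
    and "\<And>b c. b \<in> Basis \<Longrightarrow> c \<in> Basis \<Longrightarrow> continuous_on UNIV (f2 b c)"
    and "\<And>x. (\<Sum>b\<in>Basis. f2 b b x) = 0"
  shows "harmonic f"
proof -
  have 1: "partial_deriv b f = f1 b" if "b \<in> Basis" for b
    using has_partial_imp_eq assms(1) that by blast
  have 2: "partial_deriv c (f1 b) = f2 b c" if "b \<in> Basis" "c \<in> Basis" for b c
    using has_partial_imp_eq assms(3) that by blast
  show ?thesis
    unfolding harmonic_def C2_function_def laplacian_def
    using assms by (auto intro!: C1_functionI simp: 1 2)
qed

lemma harmonicD:
  fixes f :: "'a::euclidean_space \<Rightarrow> real"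
  assumes "harmonic f"
  shows "C1_function f" "b \<in> Basis \<Longrightarrow> C1_function (partial_deriv b f)"
    and "(\<Sum>b\<in>Basis. partial_deriv b (partial_deriv b f) x) = 0"
  using assms unfolding harmonic_def C2_function_def laplacian_def by auto

lemmas harmonic_GDERIV = C1_function_GDERIV[OF harmonicD(1)]
lemmas harmonic_continuous = C1_function_continuous[OF harmonicD(1)]
lemmas harmonic_continuous_grad = C1_function_continuous_grad[OF harmonicD(1)]
lemmas harmonic_has_partial = C1_function_has_partial(1)[OF harmonicD(1)]
lemmas harmonic_has_partial2 = C1_function_has_partial(1)[OF harmonicD(2)]
lemmas harmonic_continuous_partial = C1_function_has_partial(2)[OF harmonicD(1)]
lemmas harmonic_continuous_partial2 = C1_function_has_partial(2)[OF harmonicD(2)]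

lemma harmonic_const: "harmonic (\<lambda>x::'a::euclidean_space. c)"
  by (rule harmonicI[where ?f1.0="\<lambda>b x. 0" and ?f2.0="\<lambda>b c x. 0"]) (auto simp: has_partial_def)

lemma harmonic_lin:
  fixes f g :: "'a::euclidean_space \<Rightarrow> real"
  assumes "harmonic f" "harmonic g"
  shows "harmonic (\<lambda>x. \<alpha> * f x + \<beta> * g x)"
proof (rule harmonicI[where ?f2.0="\<lambda>b c x. \<alpha> * partial_deriv c (partial_deriv b f) x + \<beta> * partial_deriv c (partial_deriv b g) x"])
  show "(\<Sum>b\<in>Basis. \<alpha> * partial_deriv b (partial_deriv b f) x + \<beta> * partial_deriv b (partial_deriv b g) x) = 0" for x
    using harmonicD(3)[OF assms(1), of x] harmonicD(3)[OF assms(2), of x]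
    by (simp add: sum.distrib flip: sum_distrib_left)
next
  fix b c assume "b \<in> (Basis :: 'a set)" and "c \<in> (Basis :: 'a set)"
  then show "has_partial (\<lambda>x. \<alpha> * partial_deriv b f x + \<beta> * partial_deriv b g x) c
      (\<lambda>x. \<alpha> * partial_deriv c (partial_deriv b f) x + \<beta> * partial_deriv c (partial_deriv b g) x)"
    by (intro has_partial_lin harmonic_has_partial2 assms)
qed (use assms in \<open>auto intro!: has_partial_lin continuous_intros
  intro: harmonic_has_partial harmonic_continuous_partial harmonic_continuous_partial2\<close>)

lemma harmonic_cmult: "harmonic f \<Longrightarrow> harmonic (\<lambda>x. \<alpha> * f x)"
  using harmonic_lin[of f f \<alpha> 0] by simp

lemma harmonic_sum:
  assumes "\<And>i. i \<in> I \<Longrightarrow> harmonic (f i)"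
  shows "harmonic (\<lambda>x. \<Sum>i\<in>I. \<alpha> i * f i x)"
  using assms
proof (induction I rule: infinite_finite_induct)
  case (insert i I)
  then show ?case using harmonic_lin[of "f i" "\<lambda>x. \<Sum>i\<in>I. \<alpha> i * f i x" "\<alpha> i" 1] by simp
qed (auto intro: harmonic_const)

lemma harmonic_affine:
  fixes f :: "'a::euclidean_space \<Rightarrow> real"
  assumes "harmonic f"
  shows "harmonic (\<lambda>x. f (a + r *\<^sub>R x))"
proof (rule harmonicI)
  fix b c assume b: "b \<in> (Basis :: 'a set)" and c: "c \<in> (Basis :: 'a set)"
  show "has_partial (\<lambda>x. r * partial_deriv b f (a + r *\<^sub>R x)) c
      (\<lambda>x. r * (r * partial_deriv c (partial_deriv b f) (a + r *\<^sub>R x)))"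
    using has_partial_lin[OF has_partial_affine[OF harmonic_has_partial2[OF assms b c], of a r]
        has_partial_affine[OF harmonic_has_partial2[OF assms b c], of a r], of r 0]
    by simp
  show "continuous_on UNIV (\<lambda>x. r * (r * partial_deriv c (partial_deriv b f) (a + r *\<^sub>R x)))"
    by (intro continuous_intros continuous_on_compose2[OF harmonic_continuous_partial2[OF assms b c]]) auto
next
  show "(\<Sum>b\<in>Basis. r * (r * partial_deriv b (partial_deriv b f) (a + r *\<^sub>R x))) = 0" for x
    using harmonicD(3)[OF assms, of "a + r *\<^sub>R x"] by (simp flip: sum_distrib_left)
next
  fix b assume b: "b \<in> (Basis :: 'a set)"
  show "has_partial (\<lambda>x. f (a + r *\<^sub>R x)) b (\<lambda>x. r * partial_deriv b f (a + r *\<^sub>R x))"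
    by (intro has_partial_affine harmonic_has_partial assms b)
  show "continuous_on UNIV (\<lambda>x. r * partial_deriv b f (a + r *\<^sub>R x))"
    by (intro continuous_intros continuous_on_compose2[OF harmonic_continuous_partial[OF assms b]]) auto
qed

lemma grad_affine:
  assumes "C1_function f"
  shows "grad (\<lambda>x. f (a + r *\<^sub>R x)) x = r *\<^sub>R grad f (a + r *\<^sub>R x)"
  unfolding grad_def scaleR_sum_right
  using has_partial_imp_eq[OF has_partial_affine[OF C1_function_has_partial(1)[OF assms]], of _ a r]
  by (intro sum.cong) (auto simp: fun_eq_iff)

lemma harmonic_scale: "harmonic f \<Longrightarrow> harmonic (\<lambda>x. f (r *\<^sub>R x))"
  using harmonic_affine[of f 0 r] by simp

lemma grad_scale: "C1_function f \<Longrightarrow> grad (\<lambda>x. f (r *\<^sub>R x)) x = r *\<^sub>R grad f (r *\<^sub>R x)"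
  using grad_affine[of f 0 r] by simp

lemma grad_eqI: "GDERIV f x :> D \<Longrightarrow> C1_function f \<Longrightarrow> grad f x = D"
  using GDERIV_unique C1_function_GDERIV by blast

lemma GDERIV_compact_support:
  assumes "GDERIV f x :> D" "\<And>x. norm x > r \<Longrightarrow> f x = 0" "norm x > r"
  shows "D = 0"
proof -
  have "(f has_derivative (\<lambda>h. 0)) (at x)"
  proof (rule has_derivative_transform_within_open)
    show "((\<lambda>x. 0) has_derivative (\<lambda>h. 0)) (at x)" by simp
    show "open {x. r < norm x}" by (intro open_Collect_less continuous_intros)
  qed (use assms in auto)
  then have "GDERIV f x :> 0" by (simp add: gderiv_def)
  with assms(1) show ?thesis by (rule GDERIV_unique)
qed

text \<open>The field f grad g - g grad f has divergence f Lap g - g Lap f = 0. Multiplied by the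
  cutoff \<open>\<psi>\<close> it has compact support, so the integral of its divergence vanishes,
  and only the terms with \<open>\<psi>'\<close> remain.\<close>

lemma harmonic_Green:
  fixes f g :: "'a::euclidean_space \<Rightarrow> real"
  assumes f: "harmonic f" and g: "harmonic g"
    and \<psi>: "\<And>x. GDERIV \<psi> x :> \<psi>' x" and cont: "continuous_on UNIV \<psi>'"
    and supp: "\<And>x. norm x > r \<Longrightarrow> \<psi> x = 0"
  shows "(\<integral>x. (f x *\<^sub>R grad g x - g x *\<^sub>R grad f x) \<bullet> \<psi>' x \<partial>lborel) = 0"
proof -
  have cont_\<psi>: "continuous_on UNIV \<psi>"
    using \<psi> unfolding gderiv_def
    by (meson has_derivative_continuous continuous_at_imp_continuous_on)
  note supp' = GDERIV_compact_support[OF \<psi> supp]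
  define X where "X b x = f x * partial_deriv b g x - g x * partial_deriv b f x" for b x
  define X' where "X' b x = f x * partial_deriv b (partial_deriv b g) x - g x * partial_deriv b (partial_deriv b f) x" for b x
  have *: "integrable lborel (\<lambda>x. \<psi> x * X' b x + X b x * (\<psi>' x \<bullet> b)) \<and>
    (\<integral>x. \<psi> x * X' b x + X b x * (\<psi>' x \<bullet> b) \<partial>lborel) = 0" if b: "b \<in> Basis" for b
  proof
    have pf: "has_partial f b (partial_deriv b f)" "has_partial (partial_deriv b f) b (partial_deriv b (partial_deriv b f))"
      using f b by (auto intro: harmonic_has_partial harmonic_has_partial2)
    have pg: "has_partial g b (partial_deriv b g)" "has_partial (partial_deriv b g) b (partial_deriv b (partial_deriv b g))"
      using g b by (auto intro: harmonic_has_partial harmonic_has_partial2)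
    have X: "has_partial (X b) b (X' b)"
      using has_partial_lin[OF has_partial_mult[OF pf(1) pg(2)] has_partial_mult[OF pg(1) pf(2)], of 1 "-1"]
      by (simp add: X_def[abs_def] X'_def[abs_def] algebra_simps)
    have cX: "continuous_on UNIV (X b)"
      unfolding X_def using f g b
      by (intro continuous_intros harmonic_continuous harmonic_continuous_partial)
    have "continuous_on UNIV (X' b)"
      unfolding X'_def using f g b
      by (intro continuous_intros harmonic_continuous harmonic_continuous_partial2)
    then have c: "continuous_on UNIV (\<lambda>x. \<psi> x * X' b x + X b x * (\<psi>' x \<bullet> b))"
      by (intro continuous_intros cX cont cont_\<psi>)
    show "integrable lborel (\<lambda>x. \<psi> x * X' b x + X b x * (\<psi>' x \<bullet> b))"
      using supp supp' by (intro integrable_compact_support[OF c, where r=r]) auto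
    show "(\<integral>x. \<psi> x * X' b x + X b x * (\<psi>' x \<bullet> b) \<partial>lborel) = 0"
    proof (rule integral_has_partial_eq_0[OF _ _ c])
      show "has_partial (\<lambda>x. \<psi> x * X b x) b (\<lambda>x. \<psi> x * X' b x + X b x * (\<psi>' x \<bullet> b))"
        by (intro has_partial_mult has_partial_GDERIV \<psi> X)
      show "continuous_on UNIV (\<lambda>x. \<psi> x * X b x)"
        by (intro continuous_intros cX cont_\<psi>)
    qed (use supp in auto)
  qed
  have eq: "(f x *\<^sub>R grad g x - g x *\<^sub>R grad f x) \<bullet> \<psi>' x = (\<Sum>b\<in>Basis. \<psi> x * X' b x + X b x * (\<psi>' x \<bullet> b))" for x
  proof -
    have "(\<Sum>b\<in>Basis. X' b x) = 0"
      using harmonicD(3)[OF f, of x] harmonicD(3)[OF g, of x]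
      by (simp add: X'_def sum_subtractf flip: sum_distrib_left)
    then have "(\<Sum>b\<in>Basis. \<psi> x * X' b x + X b x * (\<psi>' x \<bullet> b)) = (\<Sum>b\<in>Basis. X b x * (\<psi>' x \<bullet> b))"
      by (simp add: sum.distrib flip: sum_distrib_left)
    also have "\<dots> = (\<Sum>b\<in>Basis. ((f x *\<^sub>R grad g x - g x *\<^sub>R grad f x) \<bullet> b) * (\<psi>' x \<bullet> b))"
      by (intro sum.cong) (auto simp: X_def inner_diff_left grad_inner_Basis)
    also have "\<dots> = (f x *\<^sub>R grad g x - g x *\<^sub>R grad f x) \<bullet> \<psi>' x"
      by (rule euclidean_inner[symmetric])
    finally show ?thesis by simp
  qed
  show ?thesis
    unfolding eq using * by (subst Bochner_Integration.integral_sum) auto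
qed

text \<open>\<open>t\<close> runs over all reals. With 0 ^ 0 = 1, degree 0 means constant, and for j
  > 0 the function vanishes at the origin.\<close>

definition homogeneous :: "nat \<Rightarrow> ('a::real_vector \<Rightarrow> real) \<Rightarrow> bool"
  where "homogeneous j f \<longleftrightarrow> (\<forall>t x. f (t *\<^sub>R x) = t ^ j * f x)"

lemma homogeneous_Euler:
  assumes "homogeneous j f" "GDERIV f x :> D"
  shows "x \<bullet> D = j * f x"
proof -
  have "((\<lambda>t::real. t *\<^sub>R x) has_derivative (\<lambda>t. t *\<^sub>R x)) (at 1)"
    by (auto intro!: derivative_eq_intros)
  moreover have "(f has_derivative (\<lambda>h. h \<bullet> D)) (at (1 *\<^sub>R x))"
    using assms by (simp add: gderiv_def)
  ultimately have "((\<lambda>t::real. f (t *\<^sub>R x)) has_derivative (\<lambda>t. (t *\<^sub>R x) \<bullet> D)) (at 1)"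
    by (rule has_derivative_compose)
  then have "((\<lambda>t::real. f (t *\<^sub>R x)) has_real_derivative (x \<bullet> D)) (at 1)"
    by (simp add: has_field_derivative_def mult.commute mult_commute_abs)
  moreover have "((\<lambda>t::real. f (t *\<^sub>R x)) has_real_derivative j * f x) (at 1)"
  proof -
    have "((\<lambda>t::real. t ^ j * f x) has_real_derivative (j * 1 ^ (j - 1) * f x)) (at 1)"
      by (auto intro!: derivative_eq_intros)
    then show ?thesis using assms(1) by (simp add: homogeneous_def)
  qed
  ultimately show ?thesis by (rule DERIV_unique)
qed

section \<open>Radial pairing, its scaling law and the mean value property\<close>

definition pairing :: "('a::euclidean_space \<Rightarrow> real) \<Rightarrow> ('a \<Rightarrow> real) \<Rightarrow> real \<Rightarrow> real \<Rightarrow> real"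
  where "pairing p v a R = (\<integral>y. p y * v (R *\<^sub>R y) * bump a 2 y \<partial>lborel)"

lemma bump_support: "k > 0 \<Longrightarrow> norm y > max 1 a \<Longrightarrow> bump a k y = 0"
  by (rule bump_eq_0[of "max 1 a"]) (auto simp: max_def power2_eq_square)

text \<open>Green's identity for \<open>p\<close> and the dilate v(R y), tested with
  \<open>bump a 3\<close>, whose gradient is -6 \<open>bump a 2 y\<close> times \<open>y\<close>.
  Pairing the two gradients with \<open>y\<close> gives the derivative in \<open>R\<close> from
  \<open>v\<close> and, by Euler's relation, the factor \<open>j\<close> from \<open>p\<close>.
  Keeping the factor \<open>R\<close> on the left leaves R = 0 admissible.\<close>

lemma DERIV_pairing:
  fixes p v :: "'a::euclidean_space \<Rightarrow> real"
  assumes v: "harmonic v" and p: "harmonic p" "homogeneous j p"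
  shows "\<exists>D. (pairing p v a has_real_derivative D) (at R) \<and> R * D = j * pairing p v a R"
proof -
  define D where "D = (\<integral>y. p y * (y \<bullet> grad v (R *\<^sub>R y)) * bump a 2 y \<partial>lborel)"
  have "((\<lambda>t. \<integral>y. p y * v (t *\<^sub>R y) * bump a 2 y \<partial>lborel) has_real_derivative D) (at R)"
    unfolding D_def
  proof (rule DERIV_integral_compact_support[where r="max 1 a"])
    show "((\<lambda>t. p y * v (t *\<^sub>R y) * bump a 2 y) has_real_derivative p y * (y \<bullet> grad v (t *\<^sub>R y)) * bump a 2 y) (at t)" for t y
    proof -
      have "((\<lambda>t. v (0 + t *\<^sub>R y)) has_real_derivative grad v (0 + t *\<^sub>R y) \<bullet> y) (at t)"
        by (rule has_partialD[OF has_partial_GDERIV[OF harmonic_GDERIV[OF v]]])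
      then show ?thesis by (auto intro!: derivative_eq_intros simp: inner_commute)
    qed
    show "continuous_on UNIV (\<lambda>y. p y * v (t *\<^sub>R y) * bump a 2 y)" for t
      by (intro continuous_intros continuous_bump harmonic_continuous[OF p(1)]
          continuous_on_compose2[OF harmonic_continuous[OF v]]) auto
    show "continuous_on UNIV (\<lambda>(t, y). p y * (y \<bullet> grad v (t *\<^sub>R y)) * bump a 2 y)"
      unfolding split_beta
      by (intro continuous_intros continuous_on_compose2[OF continuous_bump]
          continuous_on_compose2[OF harmonic_continuous[OF p(1)]]
          continuous_on_compose2[OF harmonic_continuous_grad[OF v]]) auto
  qed (auto simp: bump_support)
  moreover have "R * D = j * pairing p v a R"
  proof -
    define w where "w y = v (R *\<^sub>R y)" for y
    have w: "harmonic w" unfolding w_def by (rule harmonic_scale[OF v])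
    have "0 = (\<integral>y. (p y *\<^sub>R grad w y - w y *\<^sub>R grad p y) \<bullet> ((- (2 * real (1 + 2) * bump a (Suc 1) y)) *\<^sub>R y) \<partial>lborel)"
      by (rule harmonic_Green[OF p(1) w GDERIV_bump, symmetric, where r="max 1 a"])
        (intro continuous_intros continuous_bump, simp add: bump_support)
    also have "\<dots> = (\<integral>y. -6 * (R * (p y * (y \<bullet> grad v (R *\<^sub>R y)) * bump a 2 y) - j * (p y * v (R *\<^sub>R y) * bump a 2 y)) \<partial>lborel)"
    proof (rule Bochner_Integration.integral_cong)
      fix y
      have "grad w y = R *\<^sub>R grad v (R *\<^sub>R y)"
        unfolding w_def by (rule grad_scale[OF harmonicD(1)[OF v]])
      moreover have "y \<bullet> grad p y = j * p y"
        by (rule homogeneous_Euler[OF p(2) harmonic_GDERIV[OF p(1)]])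
      ultimately show "(p y *\<^sub>R grad w y - w y *\<^sub>R grad p y) \<bullet> ((- (2 * real (1 + 2) * bump a (Suc 1) y)) *\<^sub>R y)
        = -6 * (R * (p y * (y \<bullet> grad v (R *\<^sub>R y)) * bump a 2 y) - j * (p y * v (R *\<^sub>R y) * bump a 2 y))"
        by (simp add: inner_diff_left inner_commute[of _ y] w_def numeral_2_eq_2 algebra_simps)
    qed simp
    also have "\<dots> = -6 * (R * D - j * pairing p v a R)"
    proof -
      have "integrable lborel (\<lambda>y. p y * (y \<bullet> grad v (R *\<^sub>R y)) * bump a 2 y)"
        by (rule integrable_compact_support[where r="max 1 a"],
          intro continuous_intros continuous_bump harmonic_continuous[OF p(1)]
          continuous_on_compose2[OF harmonic_continuous_grad[OF v]])
          (auto simp: bump_support)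
      moreover have "integrable lborel (\<lambda>y. p y * v (R *\<^sub>R y) * bump a 2 y)"
        by (rule integrable_compact_support[where r="max 1 a"],
          intro continuous_intros continuous_bump harmonic_continuous[OF p(1)]
          continuous_on_compose2[OF harmonic_continuous[OF v]])
          (auto simp: bump_support)
      ultimately show ?thesis
        by (simp add: D_def pairing_def)
    qed
    finally show ?thesis by simp
  qed
  ultimately show ?thesis
    by (auto simp: pairing_def[abs_def])
qed

text \<open>The relation R D = j P says that P / R^j has derivative zero for R > 0.\<close>

lemma pairing_scale:
  assumes v: "harmonic v" and p: "harmonic p" "homogeneous j p" and "R > 0"
  shows "pairing p v a R = R ^ j * pairing p v a 1"
proof -
  have "\<exists>c. \<forall>R\<in>{0<..}. pairing p v a R / R ^ j = c"
  proof (rule has_field_derivative_zero_constant)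
    fix R :: real assume "R \<in> {0<..}"
    obtain D where D: "(pairing p v a has_real_derivative D) (at R)" "R * D = j * pairing p v a R"
      using DERIV_pairing[OF v p] by blast
    have "((\<lambda>R. pairing p v a R / R ^ j) has_real_derivative 0) (at R)"
    proof -
      have "D * R ^ j = pairing p v a R * (j * R ^ (j - 1))"
      \<comment> \<open>\<open>j - 1\<close> is truncated subtraction, hence the separate case j =
        0.\<close>
      proof (cases j)
        case 0
        then show ?thesis using D(2) \<open>R \<in> {0<..}\<close> by auto
      next
        case (Suc i)
        then have "D * R ^ j = (R * D) * R ^ i" by simp
        then show ?thesis using D(2) Suc by (simp add: mult_ac)
      qed
      then show ?thesis
        using \<open>R \<in> {0<..}\<close> D(1) by (auto intro!: derivative_eq_intros)
    qed
    then show "((\<lambda>R. pairing p v a R / R ^ j) has_real_derivative 0) (at R within {0<..})"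
      by (rule has_field_derivative_at_within)
  qed auto
  then obtain c where c: "\<And>R. R > 0 \<Longrightarrow> pairing p v a R / R ^ j = c" by auto
  from c[of 1] c[OF \<open>R > 0\<close>] \<open>R > 0\<close> show ?thesis by (simp add: field_simps)
qed

text \<open>Normalising constant of the mean value property; the type argument carries the
  dimension.\<close>

definition bump_mass :: "'a::euclidean_space itself \<Rightarrow> real"
  where "bump_mass _ = integral\<^sup>L lborel (bump 1 2 :: 'a \<Rightarrow> real)"

lemma integrable_bump: "k > 0 \<Longrightarrow> integrable lborel (bump a k :: 'a::euclidean_space \<Rightarrow> real)"
  by (rule integrable_compact_support[where r="max 1 a"]) (auto simp: continuous_bump bump_support)

text \<open>Continuity is asked only on \<open>U\<close>, because the energy integrands to which
  this is applied need not be continuous on a zero set.\<close>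

lemma integral_eq_0_imp_eq_0_open:
  fixes f :: "'a::euclidean_space \<Rightarrow> real"
  assumes "integrable lborel f" "\<And>x. f x \<ge> 0" "(\<integral>x. f x \<partial>lborel) \<le> 0"
    and "open U" "continuous_on U f" "x \<in> U"
  shows "f x = 0"
proof (rule ccontr)
  assume "f x \<noteq> 0"
  define V where "V = U \<inter> f -` (- {0})"
  have "open V"
    unfolding V_def by (rule continuous_open_preimage[OF assms(5,4)]) auto
  have "(\<integral>x. f x \<partial>lborel) = 0"
    using assms(2,3) by (simp add: antisym Bochner_Integration.integral_nonneg)
  then have "AE x in lborel. f x = 0"
    using assms(1,2) by (subst (asm) integral_nonneg_eq_0_iff_AE) auto
  then have "AE x in lborel. x \<notin> V"
    by (rule AE_mp) (auto simp: V_def)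
  then have "V \<in> null_sets lborel"
    using \<open>open V\<close> by (subst AE_iff_null_sets) auto
  then have "negligible V"
    by (simp add: negligible_iff_null_sets null_sets_completionI)
  moreover have "x \<in> V" using \<open>f x \<noteq> 0\<close> assms by (simp add: V_def)
  ultimately show False
    using open_not_negligible[OF \<open>open V\<close>] by blast
qed

lemma bump_pos: "norm y < 1 \<Longrightarrow> bump 1 k y > 0"
proof -
  assume "norm y < 1"
  then have "(norm y)\<^sup>2 < 1" by (simp add: abs_square_less_1)
  then show ?thesis by (simp add: bump_def dot_square_norm)
qed

lemma bump_mass_pos: "bump_mass TYPE('a::euclidean_space) > 0"
proof (rule ccontr)
  assume "\<not> bump_mass TYPE('a) > 0"
  then have "bump 1 2 (0::'a) = 0"
    by (intro integral_eq_0_imp_eq_0_open[OF integrable_bump _ _ open_UNIV continuous_bump])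
      (auto simp: bump_mass_def bump_nonneg)
  then show False using bump_pos[of "0::'a" 2] by simp
qed

text \<open>The case p = 1, j = 0 of the differential relation: the weighted mean over the ball of
  radius \<open>R\<close> about \<open>x\<close> has derivative zero in \<open>R\<close>. Its values
  at R = 1 and R = 0 are compared.\<close>

lemma harmonic_mean_value:
  fixes v :: "'a::euclidean_space \<Rightarrow> real"
  assumes "harmonic v"
  shows "(\<integral>y. v (x + y) * bump 1 2 y \<partial>lborel) = bump_mass TYPE('a) * v x"
proof -
  define w where "w y = v (x + 1 *\<^sub>R y)" for y
  have w: "harmonic w" unfolding w_def by (rule harmonic_affine[OF assms])
  have "homogeneous 0 (\<lambda>x::'a. 1::real)" by (simp add: homogeneous_def)
  note D = DERIV_pairing[OF w harmonic_const this, of 1]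
  have "pairing (\<lambda>x. 1) w 1 1 = pairing (\<lambda>x. 1) w 1 0"
  proof (rule DERIV_isconst2[where a=0 and b=1])
    show "continuous_on {0..1} (pairing (\<lambda>x. 1) w 1)"
      using D by (meson DERIV_isCont continuous_at_imp_continuous_on)
    show "DERIV (pairing (\<lambda>x. 1) w 1) R :> 0" if "0 < R" "R < 1" for R
      using D[of R] that by auto
  qed auto
  then show ?thesis
    by (simp add: pairing_def w_def bump_mass_def mult.commute)
qed

subsection \<open>Regularity and growth\<close>

lemma has_partial_convolution:
  fixes f g :: "'a::euclidean_space \<Rightarrow> real"
  assumes fg: "has_partial f b g" and f: "continuous_on UNIV f" and g: "continuous_on UNIV g"
    and k: "continuous_on UNIV k" "\<And>y. norm y > r \<Longrightarrow> k y = 0"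
  shows "has_partial (\<lambda>x. \<integral>y. f (x + y) * k y \<partial>lborel) b (\<lambda>x. \<integral>y. g (x + y) * k y \<partial>lborel)"
  unfolding has_partial_def
proof
  fix x
  have "((\<lambda>t. \<integral>y. f (x + t *\<^sub>R b + y) * k y \<partial>lborel) has_real_derivative (\<integral>y. g (x + 0 *\<^sub>R b + y) * k y \<partial>lborel)) (at 0)"
  proof (rule DERIV_integral_compact_support[where r=r])
    show "((\<lambda>t. f (x + t *\<^sub>R b + y) * k y) has_real_derivative g (x + t *\<^sub>R b + y) * k y) (at t)" for t y
      using has_partialD[OF fg, of "x + y" t]
      by (auto intro!: derivative_eq_intros simp: algebra_simps)
    show "continuous_on UNIV (\<lambda>y. f (x + t *\<^sub>R b + y) * k y)" for t
      by (intro continuous_intros k continuous_on_compose2[OF f]) auto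
    show "continuous_on UNIV (\<lambda>(t, y). g (x + t *\<^sub>R b + y) * k y)"
      unfolding split_beta
      by (intro continuous_intros continuous_on_compose2[OF k(1)] continuous_on_compose2[OF g]) auto
  qed (use k in auto)
  then show "((\<lambda>t. \<integral>y. f (x + t *\<^sub>R b + y) * k y \<partial>lborel) has_real_derivative (\<integral>y. g (x + y) * k y \<partial>lborel)) (at 0)"
    by simp
qed

lemma continuous_convolution:
  fixes f :: "'a::euclidean_space \<Rightarrow> real"
  assumes f: "continuous_on UNIV f" and k: "continuous_on UNIV k" "\<And>y. norm y > r \<Longrightarrow> k y = 0"
  shows "continuous_on UNIV (\<lambda>x. \<integral>y. f (x + y) * k y \<partial>lborel)"
proof -
  obtain a :: 'a where a: "cball 0 r \<subseteq> cbox (-a) a"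
    using bounded_subset_cbox_symmetric[OF bounded_cball] by metis
  have eq: "integral (cbox (-a) a) (\<lambda>y. f (x + y) * k y) = (\<integral>y. f (x + y) * k y \<partial>lborel)" for x
  proof (rule integral_cbox_compact_support)
    show "continuous_on UNIV (\<lambda>y. f (x + y) * k y)"
      by (intro continuous_intros k continuous_on_compose2[OF f]) auto
    show "f (x + y) * k y = 0" if "y \<notin> cbox (-a) a" for y
      using that a k(2) by (force simp: subset_iff)
  qed
  have "continuous_on UNIV (\<lambda>x. integral (cbox (-a) a) (\<lambda>y. f (x + y) * k y))"
    by (rule integral_continuous_on_param, unfold split_beta)
      (intro continuous_intros continuous_on_compose2[OF k(1)] continuous_on_compose2[OF f]; auto)
  then show ?thesis by (simp add: eq)
qed

lemma harmonic_convolution: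
  fixes f :: "'a::euclidean_space \<Rightarrow> real"
  assumes f: "harmonic f" and k: "continuous_on UNIV k" "\<And>y. norm y > r \<Longrightarrow> k y = 0"
  shows "harmonic (\<lambda>x. \<integral>y. f (x + y) * k y \<partial>lborel)"
proof (rule harmonicI)
  fix b c assume b: "b \<in> (Basis :: 'a set)" and c: "c \<in> (Basis :: 'a set)"
  note conts = harmonic_continuous[OF f] harmonic_continuous_partial[OF f b] harmonic_continuous_partial2[OF f b c]
  show "has_partial (\<lambda>x. \<integral>y. f (x + y) * k y \<partial>lborel) b (\<lambda>x. \<integral>y. partial_deriv b f (x + y) * k y \<partial>lborel)"
    by (rule has_partial_convolution[OF harmonic_has_partial[OF f b] conts(1,2) k])
  show "has_partial (\<lambda>x. \<integral>y. partial_deriv b f (x + y) * k y \<partial>lborel) c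
    (\<lambda>x. \<integral>y. partial_deriv c (partial_deriv b f) (x + y) * k y \<partial>lborel)"
    by (rule has_partial_convolution[OF harmonic_has_partial2[OF f b c] conts(2,3) k])
  show "continuous_on UNIV (\<lambda>x. \<integral>y. partial_deriv b f (x + y) * k y \<partial>lborel)"
    by (rule continuous_convolution[OF conts(2) k])
  show "continuous_on UNIV (\<lambda>x. \<integral>y. partial_deriv c (partial_deriv b f) (x + y) * k y \<partial>lborel)"
    by (rule continuous_convolution[OF conts(3) k])
next
  fix x
  have "integrable lborel (\<lambda>y. partial_deriv b (partial_deriv b f) (x + y) * k y)" if "b \<in> Basis" for b
    using k(2)
    by (intro integrable_compact_support[where r=r] continuous_intros k(1)
      continuous_on_compose2[OF harmonic_continuous_partial2[OF f that that]]) auto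
  then have "(\<Sum>b\<in>Basis. \<integral>y. partial_deriv b (partial_deriv b f) (x + y) * k y \<partial>lborel)
      = (\<integral>y. (\<Sum>b\<in>Basis. partial_deriv b (partial_deriv b f) (x + y) * k y) \<partial>lborel)"
    by (subst Bochner_Integration.integral_sum) auto
  also have "\<dots> = 0"
    using harmonicD(3)[OF f] by (simp flip: sum_distrib_right)
  finally show "(\<Sum>b\<in>Basis. \<integral>y. partial_deriv b (partial_deriv b f) (x + y) * k y \<partial>lborel) = 0" .
qed

text \<open>Minus the derivative of \<open>bump 1 2\<close> along \<open>b\<close>, divided by the
  total mass.\<close>

definition kern :: "'a::euclidean_space \<Rightarrow> 'a \<Rightarrow> real"
  where "kern b y = 4 * bump 1 1 y * (y \<bullet> b) / bump_mass TYPE('a)"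

lemma continuous_kern: "continuous_on UNIV (kern (b :: 'a::euclidean_space))"
  unfolding kern_def by (intro continuous_intros continuous_bump) (use bump_mass_pos[where 'a='a] in auto)

lemma kern_support: "norm y > 1 \<Longrightarrow> kern b y = 0"
  by (simp add: kern_def bump_support)

text \<open>Differentiate the mean value formula and move the derivative from \<open>v\<close> onto
  the weight. A first derivative of \<open>v\<close> thus depends on the values of \<open>v\<close>
  alone, through a continuous kernel of compact support.\<close>

lemma partial_deriv_eq_convolution:
  fixes v :: "'a::euclidean_space \<Rightarrow> real"
  assumes v: "harmonic v" and b: "b \<in> Basis"
  shows "partial_deriv b v x = (\<integral>y. v (x + y) * kern b y \<partial>lborel)"
proof -
  let ?m = "bump_mass TYPE('a)"
  have v': "has_partial v b (partial_deriv b v)" "continuous_on UNIV v" "continuous_on UNIV (partial_deriv b v)"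
    using v b by (auto intro: harmonic_has_partial harmonic_continuous harmonic_continuous_partial)
  have "has_partial (\<lambda>x. \<integral>y. v (x + y) * bump 1 2 y \<partial>lborel) b (\<lambda>x. \<integral>y. partial_deriv b v (x + y) * bump 1 2 y \<partial>lborel)"
    by (rule has_partial_convolution[OF v' continuous_bump, where r=1]) (simp add: bump_support)
  moreover have "has_partial (\<lambda>x. ?m * v x) b (\<lambda>x. ?m * partial_deriv b v x)"
    using has_partial_lin[OF v'(1) v'(1), of ?m 0] by simp
  ultimately have "(\<lambda>x. ?m * partial_deriv b v x) = (\<lambda>x. \<integral>y. partial_deriv b v (x + y) * bump 1 2 y \<partial>lborel)"
    unfolding harmonic_mean_value[OF v] by (rule has_partial_unique[rotated])
  then have 1: "?m * partial_deriv b v x = (\<integral>y. partial_deriv b v (x + y) * bump 1 2 y \<partial>lborel)"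
    by (rule fun_cong)
  have c1: "continuous_on UNIV (\<lambda>y. v (x + y) * (- 4 * bump 1 1 y * (y \<bullet> b)))"
    by (intro continuous_intros continuous_bump continuous_on_compose2[OF v'(2)]) auto
  have c2: "continuous_on UNIV (\<lambda>y. bump 1 2 y * partial_deriv b v (x + y))"
    by (intro continuous_intros continuous_bump continuous_on_compose2[OF v'(3)]) auto
  have "(\<integral>y. v (x + y) * (- 4 * bump 1 1 y * (y \<bullet> b)) + bump 1 2 y * partial_deriv b v (x + y) \<partial>lborel) = 0"
  proof (rule integral_has_partial_eq_0[where r=1])
    have "has_partial (bump 1 2 :: 'a \<Rightarrow> real) b (\<lambda>y. - 4 * bump 1 1 y * (y \<bullet> b))"
      using has_partial_GDERIV[OF GDERIV_bump, of 1 0 b] by (simp add: numeral_2_eq_2)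
    moreover have "has_partial (\<lambda>y. v (x + y)) b (\<lambda>y. partial_deriv b v (x + y))"
      using has_partial_affine[OF v'(1), of x 1] by simp
    ultimately show "has_partial (\<lambda>y. v (x + y) * bump 1 2 y) b
      (\<lambda>y. v (x + y) * (- 4 * bump 1 1 y * (y \<bullet> b)) + bump 1 2 y * partial_deriv b v (x + y))"
      by (rule has_partial_mult[rotated])
    show "continuous_on UNIV (\<lambda>y. v (x + y) * bump 1 2 y)"
      by (intro continuous_intros continuous_bump continuous_on_compose2[OF v'(2)]) auto
    show "continuous_on UNIV (\<lambda>y. v (x + y) * (- 4 * bump 1 1 y * (y \<bullet> b)) + bump 1 2 y * partial_deriv b v (x + y))"
      by (intro continuous_on_add c1 c2)
  qed (simp add: bump_support)
  moreover have "integrable lborel (\<lambda>y. v (x + y) * (- 4 * bump 1 1 y * (y \<bullet> b)))"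
    by (rule integrable_compact_support[OF c1, where r=1]) (simp add: bump_support)
  moreover have "integrable lborel (\<lambda>y. bump 1 2 y * partial_deriv b v (x + y))"
    by (rule integrable_compact_support[OF c2, where r=1]) (simp add: bump_support)
  ultimately have "(\<integral>y. bump 1 2 y * partial_deriv b v (x + y) \<partial>lborel)
      = - (\<integral>y. v (x + y) * (- 4 * bump 1 1 y * (y \<bullet> b)) \<partial>lborel)"
    by simp
  also have "\<dots> = (\<integral>y. ?m * (v (x + y) * kern b y) \<partial>lborel)"
    unfolding kern_def using bump_mass_pos[where 'a='a]
    by (subst Bochner_Integration.integral_minus[symmetric]) (auto intro!: Bochner_Integration.integral_cong)
  finally have "?m * partial_deriv b v x = ?m * (\<integral>y. v (x + y) * kern b y \<partial>lborel)"
    using 1 by (simp add: mult.commute)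
  then show ?thesis using bump_mass_pos[where 'a='a] by simp
qed

text \<open>Harmonicity demands only C2, so this is a gain of regularity: convolution with a fixed
  kernel preserves harmonicity, and the derivative is such a convolution.\<close>

lemma harmonic_partial_deriv:
  fixes v :: "'a::euclidean_space \<Rightarrow> real"
  assumes "harmonic v" "b \<in> Basis"
  shows "harmonic (partial_deriv b v)"
proof -
  have "partial_deriv b v = (\<lambda>x. \<integral>y. v (x + y) * kern b y \<partial>lborel)"
    by (rule ext) (rule partial_deriv_eq_convolution[OF assms])
  then show ?thesis
    using harmonic_convolution[OF assms(1) continuous_kern[of b] kern_support[of _ b]] by simp
qed

text \<open>Differentiate the convolution formula for the derivative along \<open>j\<close> in
  direction \<open>i\<close>, and read the result as the same formula applied to the derivative
  along \<open>i\<close>.\<close>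

lemma partial_deriv_commute:
  fixes v :: "'a::euclidean_space \<Rightarrow> real"
  assumes v: "harmonic v" and i: "i \<in> Basis" and j: "j \<in> Basis"
  shows "partial_deriv i (partial_deriv j v) = partial_deriv j (partial_deriv i v)"
proof -
  have eq: "partial_deriv j v = (\<lambda>x. \<integral>y. v (x + y) * kern j y \<partial>lborel)"
    by (rule ext) (rule partial_deriv_eq_convolution[OF v j])
  have "has_partial (partial_deriv j v) i (\<lambda>x. \<integral>y. partial_deriv i v (x + y) * kern j y \<partial>lborel)"
    unfolding eq by (rule has_partial_convolution[OF harmonic_has_partial[OF v i] harmonic_continuous[OF v]
        harmonic_continuous_partial[OF v i] continuous_kern kern_support])
  then have "partial_deriv i (partial_deriv j v) = (\<lambda>x. \<integral>y. partial_deriv i v (x + y) * kern j y \<partial>lborel)"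
    by (rule has_partial_imp_eq)
  also have "\<dots> = partial_deriv j (partial_deriv i v)"
    by (rule ext) (rule partial_deriv_eq_convolution[OF harmonic_partial_deriv[OF v i] j, symmetric])
  finally show ?thesis .
qed

text \<open>Rescale the ball of radius \<open>r\<close> about \<open>x\<close> to the unit ball and
  use the convolution formula. \<open>C\<close> is the L1 norm of the kernel, hence the same for all
  \<open>v\<close>, \<open>x\<close>, \<open>r\<close> and \<open>M\<close>.\<close>

lemma gradient_estimate:
  fixes b :: "'a::euclidean_space"
  assumes b: "b \<in> Basis"
  shows "\<exists>C\<ge>0. \<forall>v x r M. harmonic v \<longrightarrow> r > 0 \<longrightarrow> (\<forall>y. norm y \<le> r \<longrightarrow> \<bar>v (x + y)\<bar> \<le> M) \<longrightarrow> r * \<bar>partial_deriv b v x\<bar> \<le> C * M"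
proof (intro exI conjI allI impI)
  let ?C = "\<integral>y. \<bar>kern b y\<bar> \<partial>lborel"
  have ik: "integrable lborel (kern b)"
    by (rule integrable_compact_support[OF continuous_kern kern_support])
  show "?C \<ge> 0" by simp
  fix v :: "'a \<Rightarrow> real" and x and r M :: real
  assume v: "harmonic v" and "r > 0" and M: "\<forall>y. norm y \<le> r \<longrightarrow> \<bar>v (x + y)\<bar> \<le> M"
  define w where "w y = v (x + r *\<^sub>R y)" for y
  have w: "harmonic w" unfolding w_def by (rule harmonic_affine[OF v])
  have eq: "r * partial_deriv b v x = partial_deriv b w 0"
    using has_partial_imp_eq[OF has_partial_affine[OF harmonic_has_partial[OF v b]], of x r]
    by (simp add: w_def[abs_def] fun_eq_iff)
  have "r * \<bar>partial_deriv b v x\<bar> = \<bar>r * partial_deriv b v x\<bar>"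
    using \<open>r > 0\<close> by (simp add: abs_mult)
  also have "\<dots> = \<bar>\<integral>y. w y * kern b y \<partial>lborel\<bar>"
    unfolding eq partial_deriv_eq_convolution[OF w b] by simp
  also have "\<dots> \<le> (\<integral>y. M * \<bar>kern b y\<bar> \<partial>lborel)"
  proof (rule order_trans[OF integral_abs_bound integral_mono])
    show "integrable lborel (\<lambda>y. \<bar>w y * kern b y\<bar>)"
      by (rule integrable_compact_support[where r=1])
        (intro continuous_intros harmonic_continuous w continuous_kern, simp add: kern_support)
    show "integrable lborel (\<lambda>y. M * \<bar>kern b y\<bar>)" using ik by simp
    fix y
    show "\<bar>w y * kern b y\<bar> \<le> M * \<bar>kern b y\<bar>"
    proof (cases "norm y > 1")
      case False
      then have "\<bar>w y\<bar> \<le> M" using M \<open>r > 0\<close> by (simp add: w_def)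
      then show ?thesis by (simp add: abs_mult mult_right_mono)
    qed (simp add: kern_support)
  qed
  finally show "r * \<bar>partial_deriv b v x\<bar> \<le> ?C * M" by (simp add: mult.commute)
qed

section \<open>Polynomial growth and Liouville's theorem\<close>

definition growth :: "nat \<Rightarrow> ('a::real_normed_vector \<Rightarrow> real) \<Rightarrow> bool"
  where "growth d v \<longleftrightarrow> (\<exists>C. \<forall>x. \<bar>v x\<bar> \<le> C * (1 + norm x) ^ d)"

text \<open>The gradient estimate on the ball of radius 1 + |x| about \<open>x\<close>, on which the
  growth weight at most doubles, gains one power.\<close>

lemma growth_partial_deriv:
  fixes v :: "'a::euclidean_space \<Rightarrow> real"
  assumes v: "harmonic v" and b: "b \<in> Basis" and g: "growth (Suc d) v"
  shows "growth d (partial_deriv b v)"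
proof -
  obtain C where C: "\<And>x. \<bar>v x\<bar> \<le> C * (1 + norm x) ^ Suc d"
    using g unfolding growth_def by blast
  have "C \<ge> 0" using C[of 0] by simp
  obtain C' where C': "\<forall>(v :: 'a \<Rightarrow> real) x r M. harmonic v \<longrightarrow> r > 0 \<longrightarrow> (\<forall>y. norm y \<le> r \<longrightarrow> \<bar>v (x + y)\<bar> \<le> M) \<longrightarrow> r * \<bar>partial_deriv b v x\<bar> \<le> C' * M"
    using gradient_estimate[OF b] by blast
  have "\<bar>partial_deriv b v x\<bar> \<le> (C' * C * 2 ^ Suc d) * (1 + norm x) ^ d" for x
  proof -
    define r where "r = 1 + norm x"
    have r: "r > 0" by (simp add: r_def add_pos_nonneg)
    have "r * \<bar>partial_deriv b v x\<bar> \<le> C' * (C * (2 * r) ^ Suc d)"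
    proof (rule C'[rule_format, OF v r])
      fix y :: 'a assume "norm y \<le> r"
      then have "norm (x + y) \<le> norm x + r" using norm_triangle_ineq[of x y] by linarith
      then have "1 + norm (x + y) \<le> 2 * r" by (simp add: r_def)
      then have "C * (1 + norm (x + y)) ^ Suc d \<le> C * (2 * r) ^ Suc d"
        by (intro mult_left_mono power_mono) (auto simp: \<open>C \<ge> 0\<close>)
      then show "\<bar>v (x + y)\<bar> \<le> C * (2 * r) ^ Suc d" using C order_trans by blast
    qed
    also have "\<dots> = r * ((C' * C * 2 ^ Suc d) * r ^ d)" by (simp add: power_mult_distrib)
    finally show ?thesis using r by (simp add: r_def)
  qed
  then show ?thesis unfolding growth_def by blast
qed

lemma partial_derivs_0_imp_const:
  assumes "C1_function f" "\<And>b x. b \<in> Basis \<Longrightarrow> partial_deriv b f x = 0"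
  shows "f x = f y"
proof -
  have "GDERIV f x :> 0" for x
    using C1_function_GDERIV[OF assms(1), of x] assms(2) by (simp add: grad_def)
  then have "(f has_derivative (\<lambda>h. 0)) (at x within UNIV)" for x
    by (simp add: gderiv_def)
  from has_derivative_zero_constant[OF convex_UNIV this] show ?thesis by auto
qed

lemma harmonic_bounded_const:
  fixes v :: "'a::euclidean_space \<Rightarrow> real"
  assumes v: "harmonic v" and g: "growth 0 v"
  shows "v x = v y"
proof (rule partial_derivs_0_imp_const[OF harmonicD(1)[OF v]])
  fix b x assume b: "b \<in> (Basis :: 'a set)"
  obtain C where C: "\<And>x. \<bar>v x\<bar> \<le> C"
    using g unfolding growth_def by auto
  obtain C' where C': "\<forall>(v :: 'a \<Rightarrow> real) x r M. harmonic v \<longrightarrow> r > 0 \<longrightarrow> (\<forall>y. norm y \<le> r \<longrightarrow> \<bar>v (x + y)\<bar> \<le> M) \<longrightarrow> r * \<bar>partial_deriv b v x\<bar> \<le> C' * M"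
    using gradient_estimate[OF b] by blast
  have le: "r * \<bar>partial_deriv b v x\<bar> \<le> C' * C" if "r > 0" for r
    by (rule C'[rule_format, OF v that]) (rule C)
  show "partial_deriv b v x = 0"
  proof (rule ccontr)
    assume "partial_deriv b v x \<noteq> 0"
    \<comment> \<open>The radius is chosen so that the estimate would read |C' C| + 1 \<le> C'
      C.\<close>
    then have "(\<bar>C' * C\<bar> + 1) / \<bar>partial_deriv b v x\<bar> * \<bar>partial_deriv b v x\<bar> \<le> C' * C"
      by (intro le) auto
    with \<open>partial_deriv b v x \<noteq> 0\<close> show False by simp
  qed
qed

section \<open>Unique continuation and homogeneous components under polynomial growth\<close>

definition iter_partial :: "'a::euclidean_space list \<Rightarrow> ('a \<Rightarrow> real) \<Rightarrow> 'a \<Rightarrow> real"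
  where "iter_partial bs f = foldr partial_deriv bs f"

lemma harmonic_iter_partial:
  "harmonic f \<Longrightarrow> set bs \<subseteq> Basis \<Longrightarrow> harmonic (iter_partial bs f)"
  by (induction bs) (auto simp: iter_partial_def intro: harmonic_partial_deriv)

text \<open>Induction on the growth degree: every partial derivative inherits the hypothesis with
  one degree less, and degree 0 is Liouville's theorem. Growth thus takes the place of a Taylor
  expansion.\<close>

lemma harmonic_unique_continuation_point:
  assumes "harmonic f" "growth d f" "\<And>bs. set bs \<subseteq> Basis \<Longrightarrow> iter_partial bs f x = 0"
  shows "f y = 0"
  using assms
proof (induction d arbitrary: f y)
  case 0
  have "f y = f x" by (rule harmonic_bounded_const[OF "0.prems"(1,2)])
  then show ?case
    using "0.prems"(3)[of "[]"] by (simp add: iter_partial_def)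
next
  case (Suc d)
  have "partial_deriv b f z = 0" if b: "b \<in> Basis" for b z
  proof (rule Suc.IH[OF harmonic_partial_deriv[OF Suc.prems(1) b] growth_partial_deriv[OF Suc.prems(1) b Suc.prems(2)]])
    show "iter_partial bs (partial_deriv b f) x = 0" if "set bs \<subseteq> Basis" for bs
      using Suc.prems(3)[of "bs @ [b]"] that b by (simp add: iter_partial_def)
  qed
  then have "f y = f x"
    by (rule partial_derivs_0_imp_const[OF harmonicD(1)[OF Suc.prems(1)]])
  then show ?case using Suc.prems(3)[of "[]"] by (simp add: iter_partial_def)
qed

lemma partial_deriv_0_open:
  assumes "open U" "x \<in> U" "\<And>y. y \<in> U \<Longrightarrow> f y = 0"
  shows "partial_deriv b f x = 0"
proof -
  define V where "V = (\<lambda>t::real. x + t *\<^sub>R b) -` U"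
  have "open V" unfolding V_def
    by (rule open_vimage[OF assms(1)]) (intro continuous_intros)
  have "((\<lambda>t. 0) has_real_derivative 0) (at 0)" by simp
  then have "((\<lambda>t. f (x + t *\<^sub>R b)) has_real_derivative 0) (at 0)"
    by (rule has_field_derivative_transform_within_open[OF _ \<open>open V\<close>])
      (use assms in \<open>auto simp: V_def\<close>)
  then show ?thesis unfolding partial_deriv_def by (rule DERIV_imp_deriv)
qed

lemma harmonic_unique_continuation:
  assumes "harmonic f" "growth d f" "open U" "U \<noteq> {}" "\<And>x. x \<in> U \<Longrightarrow> f x = 0"
  shows "f y = 0"
proof -
  have *: "\<forall>x\<in>U. iter_partial bs f x = 0" for bs
  proof (induction bs)
    case (Cons b bs)
    then show ?case
      using partial_deriv_0_open[OF assms(3), of _ "iter_partial bs f"] by (simp add: iter_partial_def)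
  qed (simp add: iter_partial_def assms(5))
  obtain x where "x \<in> U" using assms by auto
  with * show ?thesis
    using harmonic_unique_continuation_point[OF assms(1,2)] by blast
qed

text \<open>The \<open>a j\<close> are arbitrary functions; only the dilated sums F(t) are known to
  be harmonic. If n is the top degree, F(2t) - 2^n F(t) no longer contains the top term, and the
  others are multiplied by the nonzero numbers 2^j - 2^n.\<close>

lemma harmonic_homogeneous_components:
  fixes a :: "nat \<Rightarrow> 'a::euclidean_space \<Rightarrow> real"
  assumes "\<And>t. t > 0 \<Longrightarrow> harmonic (\<lambda>x. \<Sum>j\<le>d. t ^ j * a j x)" "j \<le> d"
  shows "harmonic (a j)"
  using assms
proof (induction d arbitrary: a j)
  case 0
  then show ?case using "0.prems"(1)[of 1] by simp
next
  case (Suc d)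
  have low: "harmonic (a i)" if "i \<le> d" for i
  proof -
    have "harmonic (\<lambda>x. (2 ^ i - 2 ^ Suc d) * a i x)"
    proof (rule Suc.IH[OF _ that, where a="\<lambda>i x. (2 ^ i - 2 ^ Suc d) * a i x"])
      fix t :: real assume "t > 0"
      then have "harmonic (\<lambda>x. 1 * (\<Sum>j\<le>Suc d. (2 * t) ^ j * a j x) + (- (2 ^ Suc d)) * (\<Sum>j\<le>Suc d. t ^ j * a j x))"
        by (intro harmonic_lin Suc.prems) auto
      also have "(\<lambda>x. 1 * (\<Sum>j\<le>Suc d. (2 * t) ^ j * a j x) + (- (2 ^ Suc d)) * (\<Sum>j\<le>Suc d. t ^ j * a j x))
          = (\<lambda>x. \<Sum>j\<le>d. t ^ j * ((2 ^ j - 2 ^ Suc d) * a j x))"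
      proof
        fix x
        have "1 * (\<Sum>j\<le>Suc d. (2 * t) ^ j * a j x) + (- (2 ^ Suc d)) * (\<Sum>j\<le>Suc d. t ^ j * a j x)
            = (\<Sum>j\<le>Suc d. (2 * t) ^ j * a j x - 2 ^ Suc d * (t ^ j * a j x))"
          unfolding sum_subtractf sum_distrib_left[symmetric] by simp
        also have "\<dots> = (\<Sum>j\<le>Suc d. t ^ j * ((2 ^ j - 2 ^ Suc d) * a j x))"
          by (intro sum.cong) (auto simp: power_mult_distrib left_diff_distrib right_diff_distrib)
        finally show "1 * (\<Sum>j\<le>Suc d. (2 * t) ^ j * a j x) + (- (2 ^ Suc d)) * (\<Sum>j\<le>Suc d. t ^ j * a j x)
            = (\<Sum>j\<le>d. t ^ j * ((2 ^ j - 2 ^ Suc d) * a j x))" by simp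
      qed
      finally show "harmonic (\<lambda>x. \<Sum>j\<le>d. t ^ j * ((2 ^ j - 2 ^ Suc d) * a j x))" .
    qed
    then have "harmonic (\<lambda>x. (1 / (2 ^ i - 2 ^ Suc d)) * ((2 ^ i - 2 ^ Suc d) * a i x))"
      by (rule harmonic_cmult)
    moreover have "(2::real) ^ i < 2 ^ Suc d" using that by (intro power_strict_increasing) auto
    ultimately show ?thesis by simp
  qed
  show ?case
  proof (cases "j \<le> d")
    case False
    then have j: "j = Suc d" using Suc.prems by simp
    have "harmonic (\<lambda>x. 1 * (\<Sum>j\<le>Suc d. 1 ^ j * a j x) + (- 1) * (\<Sum>j\<le>d. 1 * a j x))"
      by (intro harmonic_lin Suc.prems harmonic_sum low) auto
    then show ?thesis by (simp add: j)
  qed (use low in auto)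
qed

text \<open>The partial derivatives have lower growth, so by induction the derivative of v(t x) in
  \<open>t\<close> is a polynomial in \<open>t\<close> whose coefficients are homogeneous in
  \<open>x\<close>. Integrating along the ray divides the term of degree \<open>j\<close> by j + 1.
  Harmonicity of the components is not visible here; it comes from the dilates of
  \<open>v\<close>.\<close>

lemma growth_homogeneous_decomposition:
  assumes "harmonic v" "growth d v"
  shows "\<exists>a. (\<forall>j. homogeneous j (a j)) \<and> (\<forall>x. v x = (\<Sum>j\<le>d. a j x))"
  using assms
proof (induction d arbitrary: v)
  case 0
  then have "\<forall>x. v x = v 0" using harmonic_bounded_const by blast
  then show ?case
    by (intro exI[of _ "\<lambda>j x. if j = 0 then v 0 else 0"]) (auto simp: homogeneous_def)
next
  case (Suc d)
  have "\<exists>a. (\<forall>j. homogeneous j (a j)) \<and> (\<forall>x. partial_deriv b v x = (\<Sum>j\<le>d. a j x))" if "b \<in> Basis" for b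
    by (intro Suc.IH harmonic_partial_deriv growth_partial_deriv Suc.prems that)
  then obtain p where p: "\<And>b j. b \<in> Basis \<Longrightarrow> homogeneous j (p b j)"
    "\<And>b x. b \<in> Basis \<Longrightarrow> partial_deriv b v x = (\<Sum>j\<le>d. p b j x)"
    by metis
  define q where "q j x = (\<Sum>b\<in>Basis. (x \<bullet> b) * p b j x) / real (Suc j)" for j x
  define a where "a j x = (case j of 0 \<Rightarrow> v 0 | Suc j \<Rightarrow> q j x)" for j x
  have qh: "q j (t *\<^sub>R x) = t ^ Suc j * q j x" for j t x
    using p(1) by (simp add: q_def homogeneous_def sum_distrib_left mult_ac)
  then have "homogeneous j (a j)" for j
    by (cases j) (auto simp: a_def homogeneous_def)
  moreover have "v x = (\<Sum>j\<le>Suc d. a j x)" for x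
  proof -
    define g where "g t = v (0 + t *\<^sub>R x) - (\<Sum>j\<le>d. t ^ Suc j * q j x)" for t
    have "(g has_real_derivative 0) (at t)" for t
    proof -
      have 1: "((\<lambda>t. v (0 + t *\<^sub>R x)) has_real_derivative grad v (0 + t *\<^sub>R x) \<bullet> x) (at t)"
        by (rule has_partialD[OF has_partial_GDERIV[OF harmonic_GDERIV[OF Suc.prems(1)]]])
      have 2: "((\<lambda>t. \<Sum>j\<le>d. t ^ Suc j * q j x) has_real_derivative (\<Sum>j\<le>d. real (Suc j) * t ^ j * q j x)) (at t)"
      proof (intro DERIV_sum)
        fix j
        show "((\<lambda>t. t ^ Suc j * q j x) has_real_derivative real (Suc j) * t ^ j * q j x) (at t)"
          using DERIV_cmult_right[OF DERIV_pow[of "Suc j" t UNIV], of "q j x"] by simp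
      qed
      have "grad v (0 + t *\<^sub>R x) \<bullet> x = (\<Sum>b\<in>Basis. (\<Sum>j\<le>d. p b j (t *\<^sub>R x)) * (x \<bullet> b))"
        using p(2) by (simp add: grad_def inner_sum_left) (simp add: inner_commute)
      also have "\<dots> = (\<Sum>b\<in>Basis. \<Sum>j\<le>d. t ^ j * p b j x * (x \<bullet> b))"
        using p(1) by (simp add: homogeneous_def sum_distrib_right)
      also have "\<dots> = (\<Sum>j\<le>d. \<Sum>b\<in>Basis. t ^ j * p b j x * (x \<bullet> b))"
        by (rule sum.swap)
      also have "\<dots> = (\<Sum>j\<le>d. real (Suc j) * t ^ j * q j x)"
      proof (intro sum.cong refl)
        fix j
        have "real (Suc j) * q j x = (\<Sum>b\<in>Basis. (x \<bullet> b) * p b j x)"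
          unfolding q_def by simp
        then have "real (Suc j) * t ^ j * q j x = t ^ j * (\<Sum>b\<in>Basis. (x \<bullet> b) * p b j x)"
          by (metis mult.commute mult.left_commute)
        then show "(\<Sum>b\<in>Basis. t ^ j * p b j x * (x \<bullet> b)) = real (Suc j) * t ^ j * q j x"
          by (simp add: sum_distrib_left mult_ac)
      qed
      finally show ?thesis using DERIV_diff[OF 1 2] by (simp add: g_def[abs_def])
    qed
    then have "g 1 = g 0" by (metis DERIV_isconst_all)
    then have "v x = a 0 x + (\<Sum>j\<le>d. a (Suc j) x)" by (simp add: g_def a_def)
    then show ?thesis by (simp only: sum.atMost_Suc_shift)
  qed
  ultimately show ?case by blast
qed

lemma harmonic_homogeneous_decomposition:
  fixes v :: "'a::euclidean_space \<Rightarrow> real"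
  assumes v: "harmonic v" and g: "growth d v"
  obtains a where "\<And>j. homogeneous j (a j)" "\<And>j. j \<le> d \<Longrightarrow> harmonic (a j)" "\<And>x. v x = (\<Sum>j\<le>d. a j x)"
proof -
  obtain a where a: "\<And>j. homogeneous j (a j)" "\<And>x. v x = (\<Sum>j\<le>d. a j x)"
    using growth_homogeneous_decomposition[OF assms] by blast
  have "harmonic (a j)" if "j \<le> d" for j
  proof (rule harmonic_homogeneous_components[OF _ that])
    fix t :: real
    show "harmonic (\<lambda>x. \<Sum>j\<le>d. t ^ j * a j x)"
      using harmonic_scale[OF v, of t] a by (simp add: homogeneous_def)
  qed
  with a that show ?thesis by blast
qed

subsection \<open>The sign of the product\<close>

text \<open>Nonnegativity is known only on the open ball, so the mean value property at
  \<open>x\<close> is used on a ball of radius \<rho> with |x - y| < \<rho> < r. A nonnegative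
  continuous integrand with integral zero vanishes.\<close>

lemma harmonic_strong_minimum:
  fixes v :: "'a::euclidean_space \<Rightarrow> real"
  assumes v: "harmonic v" and nonneg: "\<And>y. y \<in> ball x r \<Longrightarrow> v y \<ge> 0" and "v x = 0" and y: "y \<in> ball x r"
  shows "v y = 0"
proof -
  obtain \<rho> where \<rho>: "dist x y < \<rho>" "\<rho> < r" using y dense by auto
  then have "\<rho> > 0" by (meson le_less_trans zero_le_dist)
  define w where "w z = v (x + \<rho> *\<^sub>R z)" for z
  have w: "harmonic w" unfolding w_def by (rule harmonic_affine[OF v])
  have *: "w z \<ge> 0" if "norm z \<le> 1" for z
    unfolding w_def
  proof (rule nonneg)
    have "\<rho> * norm z \<le> \<rho> * 1" using that \<open>\<rho> > 0\<close> by (intro mult_left_mono) auto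
    then have "\<rho> * norm z < r" using \<rho> by linarith
    then show "x + \<rho> *\<^sub>R z \<in> ball x r" using \<rho> \<open>\<rho> > 0\<close> by (simp add: dist_norm)
  qed
  define z where "z = (1 / \<rho>) *\<^sub>R (y - x)"
  have z: "norm z < 1" "w z = v y"
    using \<rho> \<open>\<rho> > 0\<close> by (auto simp: z_def w_def dist_norm norm_minus_commute)
  have c: "continuous_on UNIV (\<lambda>z. w z * bump 1 2 z)"
    by (intro continuous_intros harmonic_continuous w continuous_bump)
  have "w z * bump 1 2 z = 0"
  proof (rule integral_eq_0_imp_eq_0_open[OF _ _ _ open_UNIV c])
    show "integrable lborel (\<lambda>z. w z * bump 1 2 z)"
      by (rule integrable_compact_support[OF c, where r=1]) (simp add: bump_support)
    show "0 \<le> w z * bump 1 2 z" for z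
      using * by (cases "norm z \<le> 1") (auto simp: bump_nonneg bump_support)
    show "(\<integral>z. w z * bump 1 2 z \<partial>lborel) \<le> 0"
      using harmonic_mean_value[OF w, of 0] \<open>v x = 0\<close> by (simp add: w_def)
  qed simp
  then show ?thesis using z bump_pos[of z 2] by simp
qed

lemma connected_same_sign:
  fixes v :: "'a::topological_space \<Rightarrow> real"
  assumes "connected S" "continuous_on S v" "\<And>s. s \<in> S \<Longrightarrow> v s \<noteq> 0" "y \<in> S" "z \<in> S"
  shows "v y * v z > 0"
proof (rule ccontr)
  assume neg: "\<not> v y * v z > 0"
  have con: "connected (v ` S)" by (rule connected_continuous_image[OF assms(2,1)])
  have "v y \<noteq> 0" "v z \<noteq> 0" using assms by auto
  with neg consider "v y \<le> 0" "0 \<le> v z" | "v z \<le> 0" "0 \<le> v y"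
    by (auto simp: zero_less_mult_iff not_less)
  then have "0 \<in> v ` S"
    using connectedD_interval[OF con imageI[OF assms(4)] imageI[OF assms(5)], of 0]
      connectedD_interval[OF con imageI[OF assms(5)] imageI[OF assms(4)], of 0]
    by cases
  then show False using assms(3) by force
qed

text \<open>Join \<open>y\<close> to \<open>z\<close> by a broken path: up by \<open>h\<close>,
  across, and down again. \<open>up\<close> keeps \<open>u\<close> positive on the vertical pieces
  and \<open>top\<close> on the horizontal one, so \<open>v\<close> has no zero on the path.\<close>

lemma same_sign_monotone_direction:
  fixes u v :: "'a::euclidean_space \<Rightarrow> real"
  assumes B: "convex B" and v: "continuous_on UNIV v"
    and Z: "\<And>x. u x > 0 \<Longrightarrow> v x \<noteq> 0"
    and up: "\<And>p t. p \<in> B \<Longrightarrow> 0 \<le> t \<Longrightarrow> t \<le> 1 \<Longrightarrow> u (p + t *\<^sub>R h) \<ge> u p"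
    and top: "\<And>p. p \<in> B \<Longrightarrow> u (p + h) > 0"
    and y: "y \<in> B" "u y > 0" and z: "z \<in> B" "u z > 0"
  shows "v y * v z > 0"
proof -
  define S where "S = closed_segment y (y + h) \<union> closed_segment (y + h) (z + h) \<union> closed_segment (z + h) z"
  have conn: "connected S" unfolding S_def
    by (intro connected_Un connected_segment) auto
  have vert: "u s > 0" if sp: "s \<in> closed_segment p (p + h)" "p \<in> B" "u p > 0" for s p
  proof -
    obtain t where "0 \<le> t" "t \<le> 1" "s = (1 - t) *\<^sub>R p + t *\<^sub>R (p + h)"
      using sp(1) unfolding closed_segment_def by blast
    moreover from this have "s = p + t *\<^sub>R h" by (simp add: algebra_simps)
    ultimately show ?thesis using up[of p t] sp by simp
  qed
  have "u s > 0" if "s \<in> S" for s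
  proof -
    consider "s \<in> closed_segment y (y + h)" | "s \<in> closed_segment (y + h) (z + h)" | "s \<in> closed_segment z (z + h)"
      using \<open>s \<in> S\<close> unfolding S_def by (auto simp: closed_segment_commute)
    then show ?thesis
    proof cases
      case 2
      then have "s - h \<in> closed_segment y z"
        using closed_segment_translation_eq[of h "s - h" y z] by (simp add: add.commute)
      then have "s - h \<in> B" using B y z by (meson convex_contains_segment subsetD)
      then show ?thesis using top[of "s - h"] by simp
    qed (use vert y z in auto)
  qed
  then show ?thesis
    by (intro connected_same_sign[OF conn continuous_on_subset[OF v]]) (auto simp: S_def Z)
qed

text \<open>On each of the parts u > 0 and u < 0 of a small ball, \<open>v\<close> keeps one sign.
  The two signs are opposite: otherwise \<open>v\<close> would have a local extremum with value 0 at
  \<open>x0\<close> and vanish near \<open>x0\<close>, together with \<open>u\<close>.\<close>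

lemma sign_near_regular_zero_pos:
  fixes u v :: "'a::euclidean_space \<Rightarrow> real"
  assumes u: "harmonic u" and v: "harmonic v" and Z: "\<And>x. u x = 0 \<longleftrightarrow> v x = 0"
    and dense: "\<And>x e. e > 0 \<Longrightarrow> \<exists>y\<in>ball x e. u y \<noteq> 0"
    and b: "b \<in> Basis" and x0: "u x0 = 0" "partial_deriv b u x0 > 0"
  shows "\<exists>e>0. (\<forall>y\<in>ball x0 e. u y * v y \<ge> 0) \<or> (\<forall>y\<in>ball x0 e. u y * v y \<le> 0)"
proof -
  define m where "m = partial_deriv b u x0 / 2"
  have m: "m > 0" using x0 by (simp add: m_def)
  have "continuous_on UNIV (partial_deriv b u)" by (rule harmonic_continuous_partial[OF u b])
  then obtain \<delta> where \<delta>: "\<delta> > 0" "\<And>z. dist z x0 < \<delta> \<Longrightarrow> dist (partial_deriv b u z) (partial_deriv b u x0) < m"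
    using m unfolding continuous_on_iff by (metis UNIV_I)
  have big: "partial_deriv b u z \<ge> m" if "dist z x0 < \<delta>" for z
    using \<delta>(2)[OF that] unfolding m_def dist_real_def by linarith
  \<comment> \<open>Moving by \<tau> along \<open>b\<close> from a point of \<open>B\<close> stays
    within \<delta> of \<open>x0\<close>, where \<open>u\<close> grows at rate at least
    \<open>m\<close>. As \<open>e\<close> is chosen so that |u| < m \<tau> on \<open>B\<close>, this
    move ends where \<open>u\<close> is positive, and the opposite move where it is
    negative.\<close>
  define \<tau> where "\<tau> = \<delta> / 2"
  have \<tau>: "\<tau> > 0" using \<delta> by (simp add: \<tau>_def)
  obtain \<delta>' where \<delta>': "\<delta>' > 0" "\<And>z. dist z x0 < \<delta>' \<Longrightarrow> dist (u z) (u x0) < m * \<tau>"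
    using m \<tau> harmonic_continuous[OF u] unfolding continuous_on_iff by (metis UNIV_I mult_pos_pos)
  define e where "e = min \<delta>' \<tau>"
  have e: "e > 0" "e \<le> \<delta>'" "e \<le> \<tau>" using \<delta>' \<tau> by (auto simp: e_def)
  define B where "B = ball x0 e"
  have small: "\<bar>u p\<bar> < m * \<tau>" if "p \<in> B" for p
    using \<delta>'(2)[of p] that e x0 by (auto simp: B_def dist_commute)
  have incr: "u (p + t *\<^sub>R b) \<ge> u (p + s *\<^sub>R b) + m * (t - s)" if "p \<in> B" "s \<le> t" "\<bar>s\<bar> \<le> \<tau>" "\<bar>t\<bar> \<le> \<tau>" for p s t
  proof (cases "s = t")
    case False
    then have "s < t" using that by simp
    have d: "((\<lambda>t. u (p + t *\<^sub>R b)) has_real_derivative partial_deriv b u (p + r *\<^sub>R b)) (at r)" for r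
      by (rule has_partialD[OF harmonic_has_partial[OF u b]])
    obtain r where r: "s < r" "r < t" "u (p + t *\<^sub>R b) - u (p + s *\<^sub>R b) = (t - s) * partial_deriv b u (p + r *\<^sub>R b)"
      using MVT2[OF \<open>s < t\<close>, of "\<lambda>t. u (p + t *\<^sub>R b)" "\<lambda>r. partial_deriv b u (p + r *\<^sub>R b)"] d by blast
    have "dist (p + r *\<^sub>R b) x0 \<le> dist (p + r *\<^sub>R b) p + dist p x0" by (rule dist_triangle)
    also have "\<dots> < \<delta>" using r that e b by (auto simp: dist_norm B_def \<tau>_def norm_minus_commute)
    finally have "(t - s) * m \<le> (t - s) * partial_deriv b u (p + r *\<^sub>R b)"
      using big \<open>s < t\<close> by (intro mult_left_mono) auto
    then show ?thesis using r(3) by (simp add: mult.commute)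
  qed simp
  have cv: "continuous_on UNIV v" by (rule harmonic_continuous[OF v])
  have pos: "v y * v z > 0" if "y \<in> B" "z \<in> B" "u y > 0" "u z > 0" for y z
  proof (rule same_sign_monotone_direction[of B v u "\<tau> *\<^sub>R b"])
    fix p and t :: real assume p: "p \<in> B" "0 \<le> t" "t \<le> 1"
    then have "m * (t * \<tau>) \<ge> 0" "t * \<tau> \<le> \<tau>" using m \<tau> by auto
    then show "u (p + t *\<^sub>R \<tau> *\<^sub>R b) \<ge> u p"
      using incr[of p 0 "t * \<tau>"] p \<tau> by simp
  next
    fix p assume "p \<in> B"
    then show "u (p + \<tau> *\<^sub>R b) > 0" using incr[of p 0 \<tau>] small[of p] \<tau> by simp
  next
    show "v x \<noteq> 0" if "u x > 0" for x using Z[of x] that by auto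
  qed (use that cv in \<open>auto simp: B_def\<close>)
  have neg: "v y * v z > 0" if "y \<in> B" "z \<in> B" "u y < 0" "u z < 0" for y z
  proof (rule same_sign_monotone_direction[of B v "\<lambda>x. - u x" "- \<tau> *\<^sub>R b"])
    fix p and t :: real assume p: "p \<in> B" "0 \<le> t" "t \<le> 1"
    then have "m * (t * \<tau>) \<ge> 0" "t * \<tau> \<le> \<tau>" using m \<tau> by auto
    then show "- u (p + t *\<^sub>R (- \<tau> *\<^sub>R b)) \<ge> - u p"
      using incr[of p "- (t * \<tau>)" 0] p \<tau> by simp
  next
    fix p assume "p \<in> B"
    then show "- u (p + - \<tau> *\<^sub>R b) > 0" using incr[of p "- \<tau>" 0] small[of p] \<tau> by simp
  next
    show "v x \<noteq> 0" if "- u x > 0" for x using Z[of x] that by auto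
  qed (use that cv in \<open>auto simp: B_def\<close>)
  have opp: "v y * v z < 0" if yz: "y \<in> B" "z \<in> B" "u y > 0" "u z < 0" for y z
  proof (rule ccontr)
    assume n: "\<not> v y * v z < 0"
    have nz: "v y \<noteq> 0" "v z \<noteq> 0" using Z[of y] Z[of z] yz by auto
    define \<sigma> where "\<sigma> = sgn (v y)"
    have \<sigma>: "\<sigma> * v y > 0" "\<sigma> * v z > 0" "\<sigma> \<noteq> 0"
      using n nz by (auto simp: \<sigma>_def sgn_if mult_less_0_iff not_less_iff_gr_or_eq zero_less_mult_iff)
    have "\<sigma> * v p \<ge> 0" if "p \<in> B" for p
    proof -
      consider "u p > 0" | "u p < 0" | "u p = 0" by linarith
      then show ?thesis
      proof cases
        case 1
        then have "v p * v y > 0" using pos yz that by simp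
        then show ?thesis using \<sigma> by (auto simp: zero_less_mult_iff zero_le_mult_iff)
      next
        case 2
        then have "v p * v z > 0" using neg yz that by simp
        then show ?thesis using \<sigma> by (auto simp: zero_less_mult_iff zero_le_mult_iff)
      qed (use Z in auto)
    qed
    then have "\<sigma> * v p = 0" if "p \<in> B" for p
      using harmonic_strong_minimum[OF harmonic_cmult[OF v, of \<sigma>], of x0 e p] that x0 Z by (auto simp: B_def)
    then show False using yz nz \<sigma> by auto
  qed
  obtain p where p: "p \<in> B" "u p \<noteq> 0" using dense[OF e(1), of x0] unfolding B_def by blast
  then have "v p \<noteq> 0" using Z by simp
  have "\<forall>q\<in>B. (u p * v p) * (u q * v q) \<ge> 0"
  proof
    fix q assume q: "q \<in> B"
    consider "u q > 0" | "u q < 0" | "u q = 0" by linarith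
    then have "(u p * u q) * (v p * v q) \<ge> 0"
    proof cases
      case 1
      show ?thesis
      proof (cases "u p > 0")
        case True
        then show ?thesis using 1 pos[OF p(1) q] by simp
      next
        case False
        then have "u p < 0" using p by simp
        then show ?thesis
          using 1 opp[OF q p(1)] by (simp add: mult_nonpos_nonpos mult_neg_pos mult.commute[of "v p"] less_imp_le)
      qed
    next
      case 2
      show ?thesis
      proof (cases "u p > 0")
        case True
        then show ?thesis
          using 2 opp[OF p(1) q] by (simp add: mult_nonpos_nonpos mult_pos_neg less_imp_le)
      next
        case False
        then have "u p < 0" using p by simp
        then show ?thesis using 2 neg[OF p(1) q] mult_neg_neg[of "u p" "u q"] by simp
      qed
    qed simp
    then show "(u p * v p) * (u q * v q) \<ge> 0" by (simp add: mult_ac)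
  qed
  moreover have "u p * v p \<noteq> 0" using p \<open>v p \<noteq> 0\<close> by simp
  ultimately have "(\<forall>y\<in>B. u y * v y \<ge> 0) \<or> (\<forall>y\<in>B. u y * v y \<le> 0)"
    by (metis mult_pos_neg mult_neg_pos linorder_neqE_linordered_idom not_le)
  then show ?thesis using e(1) unfolding B_def by blast
qed

lemma sign_near_regular_zero:
  fixes u v :: "'a::euclidean_space \<Rightarrow> real"
  assumes u: "harmonic u" and v: "harmonic v" and Z: "\<And>x. u x = 0 \<longleftrightarrow> v x = 0"
    and dense: "\<And>x e. e > 0 \<Longrightarrow> \<exists>y\<in>ball x e. u y \<noteq> 0"
    and b: "b \<in> Basis" and x0: "u x0 = 0" "partial_deriv b u x0 \<noteq> 0"
  shows "\<exists>e>0. (\<forall>y\<in>ball x0 e. u y * v y \<ge> 0) \<or> (\<forall>y\<in>ball x0 e. u y * v y \<le> 0)"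
proof (cases "partial_deriv b u x0 > 0")
  case True
  show ?thesis by (rule sign_near_regular_zero_pos[OF u v Z dense b x0(1) True])
next
  case False
  have "partial_deriv b (\<lambda>x. - u x) x0 = - partial_deriv b u x0"
    using has_partial_imp_eq[OF has_partial_lin[OF harmonic_has_partial[OF u b] harmonic_has_partial[OF u b], of "-1" 0]]
    by (simp add: fun_eq_iff)
  then have "\<exists>e>0. (\<forall>y\<in>ball x0 e. (- u y) * v y \<ge> 0) \<or> (\<forall>y\<in>ball x0 e. (- u y) * v y \<le> 0)"
    using False x0 Z dense harmonic_cmult[OF u, of "-1"]
    by (intro sign_near_regular_zero_pos[OF _ v _ _ b]) auto
  then show ?thesis by auto
qed

text \<open>If all these minors vanish, then H_ii H_jj = H_ij^2, so the sum of the squares of all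
  entries equals the square of the trace, which is 0.\<close>

lemma symmetric_traceless_minor:
  fixes H :: "'i \<Rightarrow> 'i \<Rightarrow> real"
  assumes I: "finite I" and sym: "\<And>i j. i \<in> I \<Longrightarrow> j \<in> I \<Longrightarrow> H i j = H j i"
    and tr: "(\<Sum>i\<in>I. H i i) = 0" and kl: "k \<in> I" "l \<in> I" "H k l \<noteq> 0"
  shows "\<exists>i\<in>I. \<exists>j\<in>I. H i i * H j j - H i j * H j i \<noteq> 0"
proof (rule ccontr)
  assume neg: "\<not> ?thesis"
  have "H i i * H j j = (H i j)\<^sup>2" if "i \<in> I" "j \<in> I" for i j
  proof -
    have "H i i * H j j - H i j * H j i = 0" using neg that by blast
    then show ?thesis using sym[OF that] by (simp add: power2_eq_square)
  qed
  then have "(\<Sum>i\<in>I. \<Sum>j\<in>I. (H i j)\<^sup>2) = (\<Sum>i\<in>I. \<Sum>j\<in>I. H i i * H j j)"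
    by (intro sum.cong) auto
  also have "\<dots> = 0" using tr by (simp flip: sum_product)
  finally have "\<forall>i\<in>I. (\<Sum>j\<in>I. (H i j)\<^sup>2) = 0"
    using I by (subst (asm) sum_nonneg_eq_0_iff) (auto intro: sum_nonneg)
  then have "(\<Sum>j\<in>I. (H k j)\<^sup>2) = 0" using kl by blast
  then have "\<forall>j\<in>I. (H k j)\<^sup>2 = 0"
    using I by (subst (asm) sum_nonneg_eq_0_iff) auto
  then show False using kl by auto
qed

text \<open>Excludes the exceptional case in the theorem that a convex set stays connected after the
  removal of countably many points.\<close>

lemma not_collinear_plane_section:
  fixes x :: "'a::euclidean_space"
  assumes i: "i \<in> Basis" and j: "j \<in> Basis" and "i \<noteq> j" and w: "w \<in> ball x \<delta>"
  shows "\<not> collinear (ball x \<delta> \<inter> {y. \<exists>s t. y = w + s *\<^sub>R i + t *\<^sub>R j})" (is "\<not> collinear ?L")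
proof
  assume "collinear ?L"
  then obtain d where d: "\<And>y z. y \<in> ?L \<Longrightarrow> z \<in> ?L \<Longrightarrow> \<exists>c. y - z = c *\<^sub>R d"
    unfolding collinear_def by blast
  obtain \<epsilon> where \<epsilon>: "\<epsilon> > 0" "cball w \<epsilon> \<subseteq> ball x \<delta>"
    using w by (metis open_ball open_contains_cball)
  have in_L: "w + s *\<^sub>R i + t *\<^sub>R j \<in> ?L" if "\<bar>s\<bar> + \<bar>t\<bar> \<le> \<epsilon>" for s t
  proof
    have "norm (s *\<^sub>R i + t *\<^sub>R j) \<le> \<bar>s\<bar> + \<bar>t\<bar>"
      using norm_triangle_ineq[of "s *\<^sub>R i" "t *\<^sub>R j"] i j by simp
    then have "w + (s *\<^sub>R i + t *\<^sub>R j) \<in> cball w \<epsilon>"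
      using that unfolding mem_cball dist_norm norm_minus_commute[of w] add_diff_cancel_left'
      by linarith
    then show "w + s *\<^sub>R i + t *\<^sub>R j \<in> ball x \<delta>" using \<epsilon> by (auto simp: add.assoc)
    show "w + s *\<^sub>R i + t *\<^sub>R j \<in> {y. \<exists>s t. y = w + s *\<^sub>R i + t *\<^sub>R j}" by force
  qed
  obtain c1 where c1: "\<epsilon> *\<^sub>R i = c1 *\<^sub>R d"
    using d[OF in_L[of \<epsilon> 0] in_L[of 0 0]] \<epsilon> by auto
  obtain c2 where c2: "\<epsilon> *\<^sub>R j = c2 *\<^sub>R d"
    using d[OF in_L[of 0 \<epsilon>] in_L[of 0 0]] \<epsilon> by auto
  have "c1 * (d \<bullet> i) = \<epsilon>" "c1 * (d \<bullet> j) = 0" "c2 * (d \<bullet> j) = \<epsilon>"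
    using arg_cong[OF c1, of "\<lambda>z. z \<bullet> i"] arg_cong[OF c1, of "\<lambda>z. z \<bullet> j"] arg_cong[OF c2, of "\<lambda>z. z \<bullet> j"] i j \<open>i \<noteq> j\<close>
    by (auto simp: inner_Basis)
  then show False using \<epsilon> by auto
qed

text \<open>By \<open>one\<close>, every plane section of the ball parallel to \<open>i\<close> and
  \<open>j\<close> meets \<open>T\<close> in at most one point. Such a section without
  \<open>T\<close> is connected, so it lies in \<open>P\<close> or in \<open>N\<close>; which of the
  two is locally constant in the section, and the ball is connected.\<close>

lemma connected_ball_diff_codim2:
  fixes x :: "'a::euclidean_space"
  assumes i: "i \<in> Basis" and j: "j \<in> Basis" and "i \<noteq> j"
    and P: "open P" and N: "open N" and disj: "P \<inter> N = {}" and T: "T = - (P \<union> N)"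
    and one: "\<And>y s t. y \<in> T \<Longrightarrow> y \<in> ball x \<delta> \<Longrightarrow> y + s *\<^sub>R i + t *\<^sub>R j \<in> T \<Longrightarrow>
      y + s *\<^sub>R i + t *\<^sub>R j \<in> ball x \<delta> \<Longrightarrow> s = 0 \<and> t = 0"
  shows "ball x \<delta> \<subseteq> P \<union> T \<or> ball x \<delta> \<subseteq> N \<union> T"
proof -
  define L where "L w = ball x \<delta> \<inter> {y. \<exists>s t. y = w + s *\<^sub>R i + t *\<^sub>R j}" for w
  have self: "w \<in> L w" if "w \<in> ball x \<delta>" for w
    unfolding L_def using that by (auto intro!: exI[of _ 0])
  have conv: "convex (L w)" for w
    unfolding L_def
  proof (intro convex_Int convex_ball)
    have "{y. \<exists>s t. y = w + s *\<^sub>R i + t *\<^sub>R j} = (\<lambda>z. w + z) ` range (\<lambda>z. fst z *\<^sub>R i + snd z *\<^sub>R j)"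
      by (auto simp: image_iff add.assoc) (metis fst_conv snd_conv)
    moreover have "convex (range (\<lambda>z :: real \<times> real. fst z *\<^sub>R i + snd z *\<^sub>R j))"
      by (intro convex_linear_image linearI convex_UNIV) (auto simp: algebra_simps)
    ultimately show "convex ({y. \<exists>s t. y = w + s *\<^sub>R i + t *\<^sub>R j})"
      by (simp add: convex_translation_eq)
  qed
  have single: "y = z" if yz: "y \<in> L w \<inter> T" "z \<in> L w \<inter> T" for w y z
  proof -
    obtain s t s' t' where y: "y = w + s *\<^sub>R i + t *\<^sub>R j" and z: "z = w + s' *\<^sub>R i + t' *\<^sub>R j"
      using yz unfolding L_def by blast
    have eq: "z = y + (s' - s) *\<^sub>R i + (t' - t) *\<^sub>R j" by (simp add: y z algebra_simps)
    have "s' - s = 0 \<and> t' - t = 0"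
      using yz eq by (intro one[of y]) (auto simp: L_def)
    then show ?thesis using eq by simp
  qed
  have cnt: "countable (L w \<inter> T)" and col: "collinear (L w \<inter> T)" for w
  proof -
    have "L w \<inter> T = {} \<or> (\<exists>y. L w \<inter> T = {y})" using single[of _ w] by blast
    then show "countable (L w \<inter> T)" "collinear (L w \<inter> T)" by auto
  qed
  have conn: "connected (L w - T)" if "w \<in> ball x \<delta>" for w
    using connected_convex_diff_countable[OF conv _ cnt, of w w]
      not_collinear_plane_section[OF i j \<open>i \<noteq> j\<close> that]
    by (simp add: L_def Diff_Int_distrib Diff_Int)
  have ne: "\<not> L w \<subseteq> T" if "w \<in> ball x \<delta>" for w
    using col[of w] not_collinear_plane_section[OF i j \<open>i \<noteq> j\<close> that]
    by (auto simp: L_def Int_absorb2)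
  define A where "A Q = {w \<in> ball x \<delta>. L w - T \<subseteq> Q}" for Q
  have cover: "w \<in> A P \<or> w \<in> A N" if w: "w \<in> ball x \<delta>" for w
  proof -
    have "P \<inter> (L w - T) = {} \<or> N \<inter> (L w - T) = {}"
      using connectedD[OF conn[OF w] P N] disj T by blast
    then show ?thesis using w T by (auto simp: A_def)
  qed
  have disjA: "A P \<inter> A N = {}"
    using ne disj by (fastforce simp: A_def)
  have openA: "open (A Q)" if Q: "Q = P \<and> Q' = N \<or> Q = N \<and> Q' = P" for Q Q'
    unfolding open_dist
  proof
    fix w assume w: "w \<in> A Q"
    then have "w \<in> ball x \<delta>" by (simp add: A_def)
    then obtain p where p: "p \<in> L w - T" using ne by blast
    then have "p \<in> Q \<inter> ball x \<delta>" using w unfolding A_def L_def by blast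
    then obtain e1 where e1: "e1 > 0" "ball p e1 \<subseteq> Q \<inter> ball x \<delta>"
      using open_contains_ball[of "Q \<inter> ball x \<delta>"] P N Q by (metis open_Int open_ball)
    obtain e2 where e2: "e2 > 0" "ball w e2 \<subseteq> ball x \<delta>"
      using \<open>w \<in> ball x \<delta>\<close> by (metis open_ball open_contains_ball)
    show "\<exists>e>0. \<forall>y. dist y w < e \<longrightarrow> y \<in> A Q"
    proof (intro exI conjI allI impI)
      show "min e1 e2 > 0" using e1 e2 by simp
      fix y assume y: "dist y w < min e1 e2"
      then have "y \<in> ball x \<delta>" using e2 by (auto simp: dist_commute)
      \<comment> \<open>The point \<open>p\<close> of \<open>Q\<close> is translated along with its
        section; as \<open>Q\<close> is open, the neighbouring section through \<open>y\<close>
        still meets \<open>Q\<close>.\<close>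
      have "p + (y - w) \<in> ball p e1" using y by (simp add: dist_norm norm_minus_commute)
      then have pQ: "p + (y - w) \<in> Q" and pb: "p + (y - w) \<in> ball x \<delta>" using e1 by auto
      obtain s t where "p = w + s *\<^sub>R i + t *\<^sub>R j" using p unfolding L_def by auto
      then have "p + (y - w) = y + s *\<^sub>R i + t *\<^sub>R j" by simp
      with pb have "p + (y - w) \<in> L y" unfolding L_def by blast
      then have "y \<notin> A Q'" using pQ T disj Q by (auto simp: A_def)
      then show "y \<in> A Q" using cover[OF \<open>y \<in> ball x \<delta>\<close>] Q by auto
    qed
  qed
  have "A P \<inter> ball x \<delta> = {} \<or> A N \<inter> ball x \<delta> = {}"
    using connectedD[OF connected_ball openA openA, of P N N P x \<delta>] disjA cover by blast
  then have "ball x \<delta> \<subseteq> A N \<or> ball x \<delta> \<subseteq> A P" using cover by blast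
  then show ?thesis using self unfolding A_def by blast
qed

text \<open>Let two zeros of grad q differ by s i + t j. The mean value theorem for the derivatives
  of \<open>q\<close> along \<open>i\<close> and \<open>j\<close> gives two homogeneous linear
  equations for \<open>s\<close> and \<open>t\<close>, whose determinant is close to a nonvanishing
  Hessian minor; hence s = t = 0.\<close>

lemma degenerate_zero_codim2:
  fixes q :: "'a::euclidean_space \<Rightarrow> real"
  assumes q: "harmonic q" and k: "k \<in> Basis" and l: "l \<in> Basis" and nz: "partial_deriv k (partial_deriv l q) x \<noteq> 0"
  shows "\<exists>i\<in>Basis. \<exists>j\<in>Basis. \<exists>\<delta>>0. i \<noteq> j \<and> (\<forall>y s t. y \<in> ball x \<delta> \<longrightarrow> y + s *\<^sub>R i + t *\<^sub>R j \<in> ball x \<delta> \<longrightarrow>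
      (\<forall>c\<in>Basis. partial_deriv c q y = 0 \<and> partial_deriv c q (y + s *\<^sub>R i + t *\<^sub>R j) = 0) \<longrightarrow> s = 0 \<and> t = 0)"
proof -
  define H where "H i j z = partial_deriv i (partial_deriv j q) z" for i j z
  have "\<exists>i\<in>Basis. \<exists>j\<in>Basis. H i i x * H j j x - H i j x * H j i x \<noteq> 0"
  proof (rule symmetric_traceless_minor)
    show "H i j x = H j i x" if "i \<in> Basis" "j \<in> Basis" for i j
      unfolding H_def partial_deriv_commute[OF q that] ..
    show "(\<Sum>i\<in>Basis. H i i x) = 0" unfolding H_def by (rule harmonicD(3)[OF q])
    show "H k l x \<noteq> 0" unfolding H_def by (rule nz)
  qed (use k l in auto)
  then obtain i j where i: "i \<in> Basis" and j: "j \<in> Basis" and minor: "H i i x * H j j x - H i j x * H j i x \<noteq> 0"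
    by blast
  have "i \<noteq> j" using minor by auto
  have cH: "continuous_on UNIV (H a b)" if "a \<in> Basis" "b \<in> Basis" for a b
    unfolding H_def using harmonic_continuous_partial2[OF q that(2,1)] by simp
  \<comment> \<open>The two rows are evaluated at separate points, because the two applications of
    the mean value theorem yield different intermediate points.\<close>
  define D where "D z = H i i (fst z) * H j j (snd z) - H j i (fst z) * H i j (snd z)" for z
  have "continuous_on UNIV D"
    unfolding D_def using i j
    by (intro continuous_intros continuous_on_compose2[OF cH]) auto
  then have "open {z. D z \<noteq> 0}"
    by (intro open_Collect_neq continuous_on_const)
  moreover have "(x, x) \<in> {z. D z \<noteq> 0}" using minor by (simp add: D_def mult.commute)
  ultimately obtain A B where AB: "open A" "open B" "(x, x) \<in> A \<times> B" "A \<times> B \<subseteq> {z. D z \<noteq> 0}"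
    by (rule open_prod_elim)
  then obtain \<delta> where \<delta>: "\<delta> > 0" "ball x \<delta> \<subseteq> A \<inter> B"
    using openE[OF open_Int[OF AB(1,2)], of x] by auto
  have mv: "\<exists>z\<in>ball x \<delta>. s * H i b z + t * H j b z = 0"
    if b: "b \<in> Basis" and y: "y \<in> ball x \<delta>" "y + s *\<^sub>R i + t *\<^sub>R j \<in> ball x \<delta>"
      and eq: "partial_deriv b q y = 0" "partial_deriv b q (y + s *\<^sub>R i + t *\<^sub>R j) = 0" for b y s t
  proof -
    let ?h = "s *\<^sub>R i + t *\<^sub>R j"
    have hb: "harmonic (partial_deriv b q)" by (rule harmonic_partial_deriv[OF q b])
    have d: "((\<lambda>t. partial_deriv b q (y + t *\<^sub>R ?h)) has_real_derivative grad (partial_deriv b q) (y + r *\<^sub>R ?h) \<bullet> ?h) (at r)" for r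
      by (rule has_partialD[OF has_partial_GDERIV[OF harmonic_GDERIV[OF hb]]])
    obtain r where r: "0 < r" "r < 1" "partial_deriv b q (y + 1 *\<^sub>R ?h) - partial_deriv b q (y + 0 *\<^sub>R ?h)
        = (1 - 0) * (grad (partial_deriv b q) (y + r *\<^sub>R ?h) \<bullet> ?h)"
      using MVT2[OF zero_less_one, of "\<lambda>t. partial_deriv b q (y + t *\<^sub>R ?h)"
          "\<lambda>r. grad (partial_deriv b q) (y + r *\<^sub>R ?h) \<bullet> ?h"] d by blast
    have "y + r *\<^sub>R ?h \<in> closed_segment y (y + ?h)"
      using r by (auto simp: closed_segment_def algebra_simps intro!: exI[of _ r])
    moreover have "closed_segment y (y + ?h) \<subseteq> ball x \<delta>"
      using y by (intro closed_segment_subset convex_ball) (auto simp: add.assoc)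
    ultimately have "y + r *\<^sub>R ?h \<in> ball x \<delta>" by blast
    moreover have "s * H i b (y + r *\<^sub>R ?h) + t * H j b (y + r *\<^sub>R ?h) = 0"
      using r(3) eq i j by (simp add: inner_add_right grad_inner_Basis H_def add.assoc)
    ultimately show ?thesis by blast
  qed
  show ?thesis
  proof (intro bexI[OF _ i] bexI[OF _ j] exI[of _ \<delta>] conjI \<delta>(1) \<open>i \<noteq> j\<close>, intro allI impI)
    fix y s t
    assume y: "y \<in> ball x \<delta>" "y + s *\<^sub>R i + t *\<^sub>R j \<in> ball x \<delta>"
      and eq: "\<forall>c\<in>Basis. partial_deriv c q y = 0 \<and> partial_deriv c q (y + s *\<^sub>R i + t *\<^sub>R j) = 0"
    obtain z1 where z1: "z1 \<in> ball x \<delta>" "s * H i i z1 + t * H j i z1 = 0"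
      using mv[OF i y] bspec[OF eq i] by blast
    obtain z2 where z2: "z2 \<in> ball x \<delta>" "s * H i j z2 + t * H j j z2 = 0"
      using mv[OF j y] bspec[OF eq j] by blast
    have "D (z1, z2) \<noteq> 0" using AB(4) \<delta>(2) z1(1) z2(1) by blast
    moreover have "s * D (z1, z2) = 0"
    proof -
      have "s * D (z1, z2) = (s * H i i z1 + t * H j i z1) * H j j z2 - H j i z1 * (s * H i j z2 + t * H j j z2)"
        by (simp add: D_def algebra_simps)
      then show ?thesis using z1 z2 by simp
    qed
    moreover have "t * D (z1, z2) = 0"
    proof -
      have "t * D (z1, z2) = (s * H i j z2 + t * H j j z2) * H i i z1 - H i j z2 * (s * H i i z1 + t * H j i z1)"
        by (simp add: D_def algebra_simps)
      then show ?thesis using z1 z2 by simp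
    qed
    ultimately show "s = 0 \<and> t = 0" by simp
  qed
qed

text \<open>The bad set \<open>T\<close> of zeros near which the sign of \<open>u v\<close> is not constant contains no regular
  zeros of \<open>u\<close>. At a point of \<open>T\<close> of minimal vanishing order \<open>m\<close>, some derivative \<open>q\<close> of \<open>u\<close> of
  order \<open>m - 2\<close> has nonzero Hessian, while \<open>\<nabla>q = 0\<close> on all of \<open>T\<close>. The Hessian of \<open>q\<close> is symmetric
  and traceless, hence has a nonzero principal minor of size two, so that \<open>T\<close> has codimension two
  there and cannot separate a ball.\<close>

lemma equal_zero_sets_imp_constant_sign:
  fixes u v :: "'a::euclidean_space \<Rightarrow> real"
  assumes u: "harmonic u" and v: "harmonic v" and Z: "\<And>x. u x = 0 \<longleftrightarrow> v x = 0"
    and g: "growth d u" and nz: "u x0 \<noteq> 0"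
  shows "(\<forall>x. u x * v x \<ge> 0) \<or> (\<forall>x. u x * v x \<le> 0)"
proof -
  have dense: "\<exists>y\<in>ball x e. u y \<noteq> 0" if "e > 0" for x e
  proof (rule ccontr)
    assume "\<not> ?thesis"
    then have "u y = 0" if "y \<in> ball x e" for y using that by blast
    moreover have "ball x e \<noteq> {}" using \<open>e > 0\<close> by simp
    ultimately have "u x0 = 0"
      by (rule harmonic_unique_continuation[OF u g open_ball[of x e], rotated])
    with nz show False by simp
  qed
  \<comment> \<open>\<open>P\<close> and \<open>N\<close> are the interiors of the sets where u v
    \<ge> 0 and u v \<le> 0. They are disjoint, so once they cover the space, connectedness leaves
    only one of them.\<close>
  define P where "P = {x. \<exists>e>0. \<forall>y\<in>ball x e. u y * v y \<ge> 0}"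
  define N where "N = {x. \<exists>e>0. \<forall>y\<in>ball x e. u y * v y \<le> 0}"
  have open_near: "open {x. \<exists>e>0. \<forall>y\<in>ball x e. Q y}" for Q :: "'a \<Rightarrow> bool"
  proof -
    have "{x. \<exists>e>0. \<forall>y\<in>ball x e. Q y} = interior {x. Q x}"
      by (auto simp: mem_interior subset_iff Ball_def)
    then show ?thesis by simp
  qed
  have P: "open P" and N: "open N" unfolding P_def N_def by (rule open_near)+
  have disj: "P \<inter> N = {}"
  proof (rule ccontr)
    assume "P \<inter> N \<noteq> {}"
    then obtain x where "x \<in> P \<inter> N" by blast
    then obtain e e' where e: "e > 0" "\<forall>y\<in>ball x e. u y * v y \<ge> 0" "e' > 0" "\<forall>y\<in>ball x e'. u y * v y \<le> 0"
      unfolding P_def N_def by blast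
    have "min e e' > 0" using e by simp
    from dense[OF this, of x] obtain y where "y \<in> ball x (min e e')" "u y \<noteq> 0" by blast
    then have "y \<in> ball x e" "y \<in> ball x e'" by auto
    then have "u y * v y \<ge> 0" "u y * v y \<le> 0" using e(2,4) by blast+
    then have "u y * v y = 0" by linarith
    then show False using Z[of y] \<open>u y \<noteq> 0\<close> by auto
  qed
  have posP: "u y * v y \<ge> 0" if "y \<in> P" for y
  proof -
    obtain e where "e > 0" "\<forall>z\<in>ball y e. u z * v z \<ge> 0" using \<open>y \<in> P\<close> unfolding P_def by blast
    then show ?thesis by (simp only: centre_in_ball)
  qed
  have negN: "u y * v y \<le> 0" if "y \<in> N" for y
  proof -
    obtain e where "e > 0" "\<forall>z\<in>ball y e. u z * v z \<le> 0" using \<open>y \<in> N\<close> unfolding N_def by blast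
    then show ?thesis by (simp only: centre_in_ball)
  qed
  define T where "T = - (P \<union> N)"
  have reg: "x \<notin> T" if b: "b \<in> Basis" and pd: "partial_deriv b u x \<noteq> 0" and "u x = 0" for b x
    using sign_near_regular_zero[OF u v Z dense b \<open>u x = 0\<close> pd] by (auto simp: T_def P_def N_def)
  have T0: "u x = 0" if "x \<in> T" for x
  proof (rule ccontr)
    assume "u x \<noteq> 0"
    then have "u x * v x \<noteq> 0" using Z[of x] by simp
    have c: "continuous_on UNIV (\<lambda>x. u x * v x)"
      by (intro continuous_intros harmonic_continuous u v)
    from \<open>u x * v x \<noteq> 0\<close> consider "u x * v x > 0" | "u x * v x < 0" by linarith
    then have "x \<in> P \<union> N"
    proof cases
      case 1
      obtain e where "e > 0" "ball x e \<subseteq> {x. u x * v x > 0}"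
        using openE[OF open_Collect_less[OF continuous_on_const c], of x] 1 by blast
      then have "x \<in> P" unfolding P_def by (auto intro!: exI[of _ e] less_imp_le)
      then show ?thesis ..
    next
      case 2
      obtain e where "e > 0" "ball x e \<subseteq> {x. u x * v x < 0}"
        using openE[OF open_Collect_less[OF c continuous_on_const], of x] 2 by blast
      then have "x \<in> N" unfolding N_def by (auto intro!: exI[of _ e] less_imp_le)
      then show ?thesis ..
    qed
    then show False using that by (simp add: T_def)
  qed
  have "T = {}"
  proof (rule ccontr)
    assume "T \<noteq> {}"
    \<comment> \<open>Directions of iterated derivatives of \<open>u\<close> that are nonzero
      somewhere on \<open>T\<close>. The length of a shortest such list is the minimal vanishing
      order of \<open>u\<close> on \<open>T\<close>.\<close>
    define R where "R bs \<longleftrightarrow> set bs \<subseteq> Basis \<and> (\<exists>x\<in>T. iter_partial bs u x \<noteq> 0)" for bs :: "'a list"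
    obtain x1 where "x1 \<in> T" using \<open>T \<noteq> {}\<close> by blast
    have "\<exists>bs. R bs"
    proof (rule ccontr)
      assume "\<not> ?thesis"
      then have "u x0 = 0"
        using \<open>x1 \<in> T\<close> by (intro harmonic_unique_continuation_point[OF u g, of x1]) (auto simp: R_def)
      with nz show False by simp
    qed
    then obtain bs where bs: "R bs" and min: "\<And>cs. R cs \<Longrightarrow> length bs \<le> length cs"
      using ex_has_least_nat[of R _ length] by blast
    obtain x where x: "x \<in> T" "iter_partial bs u x \<noteq> 0" and bsB: "set bs \<subseteq> Basis" using bs unfolding R_def by blast
    have "u x = 0" using T0 x by simp
    have "bs \<noteq> []" using x \<open>u x = 0\<close> by (auto simp: iter_partial_def)
    moreover have "tl bs \<noteq> []"
    proof
      assume "tl bs = []"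
      then obtain b where "bs = [b]" using \<open>bs \<noteq> []\<close> by (cases bs) auto
      then show False using reg[of b x] x bsB \<open>u x = 0\<close> by (auto simp: iter_partial_def)
    qed
    \<comment> \<open>At least two derivatives occur: \<open>u\<close> vanishes on \<open>T\<close>,
      and its zeros there are not regular.\<close>
    ultimately obtain k l cs where eq: "bs = k # l # cs"
      by (cases bs; cases "tl bs") auto
    define q where "q = iter_partial cs u"
    have q: "harmonic q" unfolding q_def using bsB eq by (intro harmonic_iter_partial u) auto
    have kl: "k \<in> Basis" "l \<in> Basis" using bsB eq by auto
    have Hkl: "partial_deriv k (partial_deriv l q) x \<noteq> 0" using x eq by (simp add: q_def iter_partial_def)
    obtain i j \<delta> where ij: "i \<in> Basis" "j \<in> Basis" "i \<noteq> j" and "\<delta> > 0"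
      and *: "\<forall>y s t. y \<in> ball x \<delta> \<longrightarrow> y + s *\<^sub>R i + t *\<^sub>R j \<in> ball x \<delta> \<longrightarrow>
      (\<forall>c\<in>Basis. partial_deriv c q y = 0 \<and> partial_deriv c q (y + s *\<^sub>R i + t *\<^sub>R j) = 0) \<longrightarrow> s = 0 \<and> t = 0"
      using degenerate_zero_codim2[OF q kl Hkl] by blast
    \<comment> \<open>\<open>c # cs\<close> is one shorter than the minimal list \<open>bs\<close>,
      so this derivative vanishes on all of \<open>T\<close>.\<close>
    have van: "partial_deriv c q y = 0" if "y \<in> T" "c \<in> Basis" for y c
    proof (rule ccontr)
      assume "partial_deriv c q y \<noteq> 0"
      then have "R (c # cs)" using that bsB eq by (auto simp: R_def q_def iter_partial_def)
      from min[OF this] show False by (simp add: eq)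
    qed
    have "ball x \<delta> \<subseteq> P \<union> T \<or> ball x \<delta> \<subseteq> N \<union> T"
    proof (rule connected_ball_diff_codim2[OF ij P N disj T_def])
      fix y s t
      assume "y \<in> T" "y \<in> ball x \<delta>" "y + s *\<^sub>R i + t *\<^sub>R j \<in> T" "y + s *\<^sub>R i + t *\<^sub>R j \<in> ball x \<delta>"
      then show "s = 0 \<and> t = 0" using van * by blast
    qed
    moreover have "u y * v y \<ge> 0" if "y \<in> P \<union> T" for y
      using that T0[of y] posP[of y] by auto
    moreover have "u y * v y \<le> 0" if "y \<in> N \<union> T" for y
      using that T0[of y] negN[of y] by auto
    ultimately have "(\<forall>y\<in>ball x \<delta>. u y * v y \<ge> 0) \<or> (\<forall>y\<in>ball x \<delta>. u y * v y \<le> 0)" by blast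
    then have "x \<in> P \<union> N" using \<open>\<delta> > 0\<close> by (auto simp: P_def N_def)
    with x show False by (simp add: T_def)
  qed
  then have "P \<union> N = UNIV" by (auto simp: T_def)
  then have "P = {} \<or> N = {}"
    using connectedD[OF connected_UNIV P N] disj by auto
  then have "N = UNIV \<or> P = UNIV" using \<open>P \<union> N = UNIV\<close> by auto
  then show ?thesis using posP negN by blast
qed

subsection \<open>Sublevel sets of polynomials\<close>

lemma norm_poly_prod_linear_ge:
  fixes x :: complex
  assumes "\<delta> \<ge> 0" "\<And>z. z \<in># A \<Longrightarrow> \<delta> \<le> norm (x - z)"
  shows "\<delta> ^ size A \<le> norm (poly (\<Prod>z\<in>#A. [:-z, 1:]) x)"
  using assms(2)
proof (induction A)
  case (add z A)
  have "\<delta> * \<delta> ^ size A \<le> norm (x - z) * norm (poly (\<Prod>z\<in>#A. [:-z, 1:]) x)"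
    using add assms(1) by (intro mult_mono) auto
  moreover have "poly (\<Prod>z\<in>#add_mset z A. [:-z, 1:]) x = (x - z) * poly (\<Prod>z\<in>#A. [:-z, 1:]) x"
    by (simp add: algebra_simps)
  ultimately show ?case by (simp only: norm_mult size_add_mset power_Suc)
qed simp

text \<open>Over the complex numbers the polynomial is \<open>a d\<close> times a product of factors
  t - z. If its modulus is below |a d| \<delta>^d, some root is closer than \<delta>, so
  \<open>t\<close> lies within \<delta> of the real part of one of at most \<open>d\<close>
  roots.\<close>

lemma emeasure_polynomial_sublevel:
  fixes a :: "nat \<Rightarrow> real"
  assumes "a d \<noteq> 0" and \<delta>: "\<delta> > 0"
  shows "emeasure lborel {t. \<bar>\<Sum>j\<le>d. a j * t ^ j\<bar> < \<bar>a d\<bar> * \<delta> ^ d} \<le> ennreal (2 * real d * \<delta>)"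
proof -
  define P where "P = (\<Sum>j\<le>d. monom (complex_of_real (a j)) j)"
  have P: "poly P (of_real t) = of_real (\<Sum>j\<le>d. a j * t ^ j)" for t
    by (simp add: P_def poly_sum poly_monom)
  have coeff: "coeff P i = (if i \<le> d then of_real (a i) else 0)" for i
    by (auto simp: P_def coeff_sum sum.delta)
  have deg: "degree P = d"
    using assms(1) by (intro antisym degree_le le_degree) (auto simp: coeff)
  then have "P \<noteq> 0" using assms(1) coeff[of d] by auto
  obtain A where A: "size A = degree P" "P = smult (lead_coeff P) (\<Prod>x\<in>#A. [:-x, 1:])"
    using alg_closed_imp_factorization[OF \<open>P \<noteq> 0\<close>] by blast
  have sub: "{t. \<bar>\<Sum>j\<le>d. a j * t ^ j\<bar> < \<bar>a d\<bar> * \<delta> ^ d} \<subseteq> (\<Union>z\<in>set_mset A. {Re z - \<delta><..<Re z + \<delta>})"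
  proof
    fix t assume "t \<in> {t. \<bar>\<Sum>j\<le>d. a j * t ^ j\<bar> < \<bar>a d\<bar> * \<delta> ^ d}"
    then have t: "\<bar>\<Sum>j\<le>d. a j * t ^ j\<bar> < \<bar>a d\<bar> * \<delta> ^ d" by simp
    show "t \<in> (\<Union>z\<in>set_mset A. {Re z - \<delta><..<Re z + \<delta>})"
    proof (rule ccontr)
      assume far: "\<not> ?thesis"
      have "\<delta> \<le> norm (of_real t - z)" if "z \<in># A" for z
      proof -
        have "\<delta> \<le> \<bar>t - Re z\<bar>" using far that by (force simp: abs_real_def)
        also have "\<dots> \<le> norm (of_real t - z)" using abs_Re_le_cmod[of "of_real t - z"] by simp
        finally show ?thesis .
      qed
      then have "\<delta> ^ d \<le> norm (poly (\<Prod>z\<in>#A. [:-z, 1:]) (of_real t))"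
        using norm_poly_prod_linear_ge[of \<delta> A "of_real t"] \<delta> A(1) deg by simp
      then have "\<bar>a d\<bar> * \<delta> ^ d \<le> \<bar>a d\<bar> * norm (poly (\<Prod>z\<in>#A. [:-z, 1:]) (of_real t))"
        by (intro mult_left_mono) auto
      also have "\<dots> = norm (poly P (of_real t))"
        by (subst A(2)) (simp add: deg coeff norm_mult)
      also have "\<dots> = \<bar>\<Sum>j\<le>d. a j * t ^ j\<bar>" unfolding P norm_of_real by simp
      finally show False using t by simp
    qed
  qed
  have "emeasure lborel {t. \<bar>\<Sum>j\<le>d. a j * t ^ j\<bar> < \<bar>a d\<bar> * \<delta> ^ d} \<le>
      emeasure lborel (\<Union>z\<in>set_mset A. {Re z - \<delta><..<Re z + \<delta>})"
    by (intro emeasure_mono sub) auto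
  also have "\<dots> \<le> (\<Sum>z\<in>set_mset A. emeasure lborel {Re z - \<delta><..<Re z + \<delta>})"
    by (intro emeasure_subadditive_finite) auto
  also have "\<dots> = ennreal (real (card (set_mset A)) * (2 * \<delta>))"
    using \<delta> by (simp add: ennreal_of_nat_eq_real_of_nat flip: ennreal_mult)
  also have "\<dots> \<le> ennreal (2 * real d * \<delta>)"
  proof (rule ennreal_leI)
    have "card (set_mset A) \<le> size A"
      by (induction A) (auto simp: card_insert_if)
    then have "real (card (set_mset A)) \<le> real d" using A(1) deg by simp
    then have "real (card (set_mset A)) * (2 * \<delta>) \<le> real d * (2 * \<delta>)" using \<delta> by (intro mult_right_mono) auto
    then show "real (card (set_mset A)) * (2 * \<delta>) \<le> 2 * real d * \<delta>" by (simp add: mult_ac)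
  qed
  finally show ?thesis .
qed

lemma growth_translation:
  assumes "growth d u"
  shows "growth d (\<lambda>y. u (x + y))"
proof -
  obtain C where C: "\<And>x. \<bar>u x\<bar> \<le> C * (1 + norm x) ^ d"
    using assms unfolding growth_def by blast
  have "C \<ge> 0" using C[of 0] by simp
  have "\<bar>u (x + y)\<bar> \<le> (C * (1 + norm x) ^ d) * (1 + norm y) ^ d" for y
  proof -
    have "1 + norm (x + y) \<le> (1 + norm x) * (1 + norm y)"
    proof -
      have "0 \<le> norm x * norm y" by simp
      then show ?thesis using norm_triangle_ineq[of x y] unfolding distrib_left distrib_right by linarith
    qed
    then have "C * (1 + norm (x + y)) ^ d \<le> C * ((1 + norm x) * (1 + norm y)) ^ d"
      using \<open>C \<ge> 0\<close> by (intro mult_left_mono power_mono) auto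
    then show ?thesis using C[of "x + y"] by (simp add: power_mult_distrib mult.assoc)
  qed
  then show ?thesis unfolding growth_def by blast
qed

lemma growth_homogeneous_sum:
  fixes a :: "nat \<Rightarrow> 'a::euclidean_space \<Rightarrow> real"
  assumes "\<And>j. j \<le> d \<Longrightarrow> continuous_on UNIV (a j)" "\<And>j. j \<le> d \<Longrightarrow> homogeneous j (a j)"
  shows "growth d (\<lambda>x. \<Sum>j\<le>d. a j x)"
proof -
  have "\<exists>C\<ge>0. \<forall>x. \<bar>a j x\<bar> \<le> C * (1 + norm x) ^ d" if j: "j \<le> d" for j
  proof -
    have "compact (a j ` cball 0 1)"
      using assms(1)[OF j] by (intro compact_continuous_image continuous_on_subset[OF assms(1)[OF j]]) auto
    then obtain C where C: "C > 0" "\<And>x. x \<in> cball 0 1 \<Longrightarrow> \<bar>a j x\<bar> \<le> C"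
      using compact_imp_bounded[of "a j ` cball 0 1"] bounded_pos by (auto simp: bounded_pos)
    have "\<bar>a j x\<bar> \<le> C * (1 + norm x) ^ d" for x
    proof -
      define r where "r = 1 + norm x"
      have r: "r \<ge> 1" "r > 0" by (auto simp: r_def add_pos_nonneg)
      have "x = r *\<^sub>R (x /\<^sub>R r)" using r by simp
      then have "a j x = r ^ j * a j (x /\<^sub>R r)" using assms(2)[OF j] unfolding homogeneous_def by metis
      moreover have "\<bar>a j (x /\<^sub>R r)\<bar> \<le> C" using r by (intro C) (auto simp: r_def field_simps)
      ultimately have "\<bar>a j x\<bar> \<le> r ^ j * C" using r by (simp add: abs_mult)
      also have "\<dots> \<le> r ^ d * C" using r j C by (intro mult_right_mono power_increasing) auto
      finally show ?thesis by (simp add: r_def mult.commute)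
    qed
    then show ?thesis using C(1) less_imp_le by blast
  qed
  then obtain C where C: "\<And>j x. j \<le> d \<Longrightarrow> \<bar>a j x\<bar> \<le> C j * (1 + norm x) ^ d" by metis
  have "\<bar>\<Sum>j\<le>d. a j x\<bar> \<le> (\<Sum>j\<le>d. C j) * (1 + norm x) ^ d" for x
    unfolding sum_distrib_right using C by (intro order_trans[OF sum_abs] sum_mono) auto
  then show ?thesis unfolding growth_def by blast
qed

lemma tendsto_homogeneous_sum:
  fixes a :: "nat \<Rightarrow> 'a::euclidean_space \<Rightarrow> real"
  assumes a: "\<And>j. j \<le> d \<Longrightarrow> continuous_on UNIV (a j)" and y: "(y \<longlongrightarrow> y0) (at_right 0)"
  shows "((\<lambda>s. \<Sum>j\<le>d. s ^ (d - j) * a j (y s)) \<longlongrightarrow> a d y0) (at_right 0)"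
proof -
  have "((\<lambda>s. \<Sum>j\<le>d. s ^ (d - j) * a j (y s)) \<longlongrightarrow> (\<Sum>j\<le>d. 0 ^ (d - j) * a j y0)) (at_right 0)"
  proof (intro tendsto_sum tendsto_mult tendsto_power tendsto_ident_at)
    fix j assume "j \<in> {..d}"
    then have "isCont (a j) y0" using a[of j] by (simp add: continuous_on_eq_continuous_at)
    then show "((\<lambda>s. a j (y s)) \<longlongrightarrow> a j y0) (at_right 0)"
      using isCont_tendsto_compose y by blast
  qed
  moreover have "(\<Sum>j\<le>d. 0 ^ (d - j) * a j y0) = (\<Sum>j\<in>{d}. a j y0)"
    by (rule sum.mono_neutral_cong_right) auto
  ultimately show ?thesis by simp
qed

text \<open>Each \<open>a j\<close> is known only as a homogeneous harmonic function. Decomposing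
  the translate of the sum by \<open>x\<close> into homogeneous parts makes it a polynomial in
  \<open>t\<close> along the line; its top coefficient is found by letting \<open>t\<close> tend to
  infinity, written as t = 1 / s.\<close>

lemma harmonic_line_expansion:
  fixes a :: "nat \<Rightarrow> 'a::euclidean_space \<Rightarrow> real"
  assumes a: "\<And>j. j \<le> d \<Longrightarrow> harmonic (a j)" "\<And>j. j \<le> d \<Longrightarrow> homogeneous j (a j)"
  shows "\<exists>c. c d = a d h \<and> (\<forall>t. (\<Sum>j\<le>d. a j (x + t *\<^sub>R h)) = (\<Sum>j\<le>d. c j * t ^ j))"
proof -
  define u where "u y = (\<Sum>j\<le>d. a j y)" for y
  have u: "harmonic u" unfolding u_def using harmonic_sum[of "{..d}" a "\<lambda>_. 1"] a(1) by simp
  have cont: "\<And>j. j \<le> d \<Longrightarrow> continuous_on UNIV (a j)" using a(1) harmonic_continuous by blast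
  have "growth d u" unfolding u_def by (rule growth_homogeneous_sum[OF cont a(2)])
  have "harmonic (\<lambda>y. u (x + y))" using harmonic_affine[OF u, of x 1] by simp
  then obtain b where b: "\<And>j. homogeneous j (b j)" "\<And>y. u (x + y) = (\<Sum>j\<le>d. b j y)"
    using growth_homogeneous_decomposition[OF _ growth_translation[OF \<open>growth d u\<close>], of x] by blast
  define c where "c j = b j h" for j
  have exp: "u (x + t *\<^sub>R h) = (\<Sum>j\<le>d. c j * t ^ j)" for t
    using b by (simp add: c_def homogeneous_def mult.commute)
  have lim1: "((\<lambda>s. \<Sum>j\<le>d. s ^ (d - j) * a j (s *\<^sub>R x + h)) \<longlongrightarrow> a d h) (at_right 0)"
  proof (rule tendsto_homogeneous_sum[OF cont])
    have "((\<lambda>s. s *\<^sub>R x + h) \<longlongrightarrow> 0 *\<^sub>R x + h) (at_right 0)"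
      by (intro tendsto_intros)
    then show "((\<lambda>s. s *\<^sub>R x + h) \<longlongrightarrow> h) (at_right 0)" by simp
  qed
  have lim2: "((\<lambda>s. \<Sum>j\<le>d. s ^ (d - j) * c j) \<longlongrightarrow> c d) (at_right 0)"
    using tendsto_homogeneous_sum[of d "\<lambda>j _. c j" "\<lambda>_. h" h] by simp
  \<comment> \<open>For s > 0 both sides are s^d times the value of \<open>u\<close> at x + h /
    s.\<close>
  have ev: "eventually (\<lambda>s. (\<Sum>j\<le>d. s ^ (d - j) * a j (s *\<^sub>R x + h)) = (\<Sum>j\<le>d. s ^ (d - j) * c j)) (at_right 0)"
    using eventually_at_right_less[of 0]
  proof eventually_elim
    fix s :: real assume s: "0 < s"
    have "(\<Sum>j\<le>d. s ^ (d - j) * a j (s *\<^sub>R x + h)) = (\<Sum>j\<le>d. s ^ d * a j (x + (1 / s) *\<^sub>R h))"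
    proof (intro sum.cong refl)
      fix j assume "j \<in> {..d}"
      then have j: "j \<le> d" by simp
      have "a j (s *\<^sub>R x + h) = a j (s *\<^sub>R (x + (1 / s) *\<^sub>R h))" using s by (simp add: algebra_simps)
      then have "a j (s *\<^sub>R x + h) = s ^ j * a j (x + (1 / s) *\<^sub>R h)" using a(2)[OF j] by (simp add: homogeneous_def)
      then show "s ^ (d - j) * a j (s *\<^sub>R x + h) = s ^ d * a j (x + (1 / s) *\<^sub>R h)"
        using j by (simp add: power_add[symmetric])
    qed
    also have "\<dots> = s ^ d * u (x + (1 / s) *\<^sub>R h)" by (simp add: u_def sum_distrib_left)
    also have "\<dots> = (\<Sum>j\<le>d. s ^ (d - j) * c j)"
      unfolding exp sum_distrib_left
    proof (intro sum.cong refl)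
      fix j assume "j \<in> {..d}"
      then have "s ^ d = s ^ (d - j) * s ^ j" by (simp add: power_add[symmetric])
      then show "s ^ d * (c j * (1 / s) ^ j) = s ^ (d - j) * c j" using s by (simp add: power_divide)
    qed
    finally show "(\<Sum>j\<le>d. s ^ (d - j) * a j (s *\<^sub>R x + h)) = (\<Sum>j\<le>d. s ^ (d - j) * c j)" .
  qed
  have "a d h = c d"
    by (rule tendsto_unique[OF trivial_limit_at_right_real Lim_transform_eventually[OF lim1 ev] lim2])
  then show ?thesis using exp unfolding u_def by (intro exI[of _ c]) simp
qed

text \<open>By translation invariance the measure is an average over shifts t h with
  \<open>t\<close> in [0, 1]. Fubini reduces it to sublevel sets on lines parallel to
  \<open>h\<close>, and on all of them the leading coefficient is \<open>a d h\<close>. Since |h|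
  \<le> 1, only base points in the ball of radius 3 contribute.\<close>

lemma emeasure_harmonic_sublevel:
  fixes a :: "nat \<Rightarrow> 'a::euclidean_space \<Rightarrow> real"
  assumes a: "\<And>j. j \<le> d \<Longrightarrow> harmonic (a j)" "\<And>j. j \<le> d \<Longrightarrow> homogeneous j (a j)"
    and h: "norm h \<le> 1" "a d h \<noteq> 0" and \<delta>: "\<delta> > 0"
  shows "emeasure lborel {y \<in> ball 0 2. \<bar>\<Sum>j\<le>d. a j y\<bar> < \<bar>a d h\<bar> * \<delta> ^ d}
    \<le> ennreal (2 * real d * \<delta>) * emeasure lborel (ball (0::'a) 3)"
proof -
  define u where "u y = (\<Sum>j\<le>d. a j y)" for y
  have cu: "continuous_on UNIV u"
    unfolding u_def using a(1) by (intro continuous_intros harmonic_continuous) auto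
  define E where "E = {y \<in> ball 0 2. \<bar>u y\<bar> < \<bar>a d h\<bar> * \<delta> ^ d}"
  have "open E"
  proof -
    have "E = ball 0 2 \<inter> {y. \<bar>u y\<bar> < \<bar>a d h\<bar> * \<delta> ^ d}" by (auto simp: E_def)
    then show ?thesis by (auto intro!: open_Int open_Collect_less continuous_intros cu)
  qed
  then have [measurable]: "E \<in> sets borel" by simp
  have trans: "(\<integral>\<^sup>+ x. indicator E (x + t *\<^sub>R h) \<partial>lborel) = emeasure lborel E" for t
  proof -
    have "(lborel :: 'a measure) = distr lborel borel (\<lambda>x. t *\<^sub>R h + x)"
      using lborel_affine[of 1 "t *\<^sub>R h"] by (simp add: density_1)
    then have "(\<integral>\<^sup>+ x. indicator E x \<partial>lborel) = (\<integral>\<^sup>+ x. indicator E x \<partial>distr lborel borel (\<lambda>x. t *\<^sub>R h + x))"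
      by simp
    also have "\<dots> = (\<integral>\<^sup>+ x. indicator E (x + t *\<^sub>R h) \<partial>lborel)"
      by (subst nn_integral_distr) (auto simp: add.commute)
    finally show ?thesis by simp
  qed
  have "emeasure lborel E = (\<integral>\<^sup>+ t. indicator {0..1::real} t * emeasure lborel E \<partial>lborel)"
    by (simp add: nn_integral_multc)
  also have "\<dots> = (\<integral>\<^sup>+ t. \<integral>\<^sup>+ x. indicator {0..1::real} t * indicator E (x + t *\<^sub>R h) \<partial>lborel \<partial>lborel)"
    by (simp add: nn_integral_cmult trans)
  also have "\<dots> = (\<integral>\<^sup>+ x. \<integral>\<^sup>+ t. indicator {0..1::real} t * indicator E (x + t *\<^sub>R h) \<partial>lborel \<partial>lborel)"
    by (rule lborel_pair.Fubini') measurable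
  also have "\<dots> \<le> (\<integral>\<^sup>+ x. ennreal (2 * real d * \<delta>) * indicator (ball (0::'a) 3) x \<partial>lborel)"
  proof (rule nn_integral_mono)
    fix x :: 'a
    obtain c where c: "c d = a d h" "\<forall>t. u (x + t *\<^sub>R h) = (\<Sum>j\<le>d. c j * t ^ j)"
      using harmonic_line_expansion[OF a, where h=h and x=x] unfolding u_def by blast
    show "(\<integral>\<^sup>+ t. indicator {0..1::real} t * indicator E (x + t *\<^sub>R h) \<partial>lborel) \<le> ennreal (2 * real d * \<delta>) * indicator (ball (0::'a) 3) x"
    proof (cases "x \<in> ball 0 3")
      case True
      have "(\<integral>\<^sup>+ t. indicator {0..1::real} t * indicator E (x + t *\<^sub>R h) \<partial>lborel)
          \<le> (\<integral>\<^sup>+ t. indicator {t. \<bar>\<Sum>j\<le>d. c j * t ^ j\<bar> < \<bar>c d\<bar> * \<delta> ^ d} t \<partial>lborel)"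
        by (intro nn_integral_mono) (auto simp: indicator_def E_def c)
      also have "\<dots> = emeasure lborel {t. \<bar>\<Sum>j\<le>d. c j * t ^ j\<bar> < \<bar>c d\<bar> * \<delta> ^ d}"
        by (intro nn_integral_indicator) measurable
      also have "\<dots> \<le> ennreal (2 * real d * \<delta>)"
        using c h \<delta> by (intro emeasure_polynomial_sublevel) auto
      finally show ?thesis using True by simp
    next
      case False
      have "x + t *\<^sub>R h \<notin> E" if "t \<in> {0..1}" for t
      proof
        assume "x + t *\<^sub>R h \<in> E"
        then have "norm (x + t *\<^sub>R h) < 2" by (simp add: E_def)
        moreover have "norm (t *\<^sub>R h) \<le> 1" using that h mult_mono[of t 1 "norm h" 1] by simp
        moreover have "norm x \<le> norm (x + t *\<^sub>R h) + norm (t *\<^sub>R h)"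
          by (metis add_diff_cancel_right' norm_triangle_ineq4)
        ultimately show False using False by simp
      qed
      then have "indicator {0..1::real} t * indicator E (x + t *\<^sub>R h) = (0::ennreal)" for t
        by (auto simp: indicator_def)
      then have "(\<integral>\<^sup>+ t. indicator {0..1::real} t * indicator E (x + t *\<^sub>R h) \<partial>lborel) = (\<integral>\<^sup>+ t. 0 \<partial>(lborel :: real measure))"
        by (intro nn_integral_cong)
      then show ?thesis by simp
    qed
  qed
  also have "\<dots> = ennreal (2 * real d * \<delta>) * emeasure lborel (ball (0::'a) 3)"
    by (rule nn_integral_cmult_indicator) simp
  finally show ?thesis unfolding E_def u_def .
qed

subsection \<open>Growth of a harmonic function of constant sign relative to a polynomial\<close>

lemma lborel_integral_affine:
  fixes f :: "'a::euclidean_space \<Rightarrow> real"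
  assumes [measurable]: "f \<in> borel_measurable borel" and "r > 0"
  shows "(\<integral>z. f (x + r *\<^sub>R z) \<partial>lborel) = (\<integral>z. f z \<partial>lborel) / r ^ DIM('a)"
proof -
  have "(lborel :: 'a measure) = density (distr lborel borel (\<lambda>z. x + r *\<^sub>R z)) (\<lambda>_. \<bar>r\<bar> ^ DIM('a))"
    using lborel_affine[of r x] \<open>r > 0\<close> by simp
  then have "(\<integral>z. f z \<partial>lborel) = (\<integral>z. f z \<partial>density (distr lborel borel (\<lambda>z. x + r *\<^sub>R z)) (\<lambda>_. \<bar>r\<bar> ^ DIM('a)))"
    by simp
  also have "\<dots> = (\<integral>z. r ^ DIM('a) * f (x + r *\<^sub>R z) \<partial>lborel)"
    using \<open>r > 0\<close> by (subst integral_density) (auto simp: integral_distr)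
  finally show ?thesis using \<open>r > 0\<close> by simp
qed

lemma lborel_integrable_affine:
  fixes f :: "'a::euclidean_space \<Rightarrow> real"
  assumes f: "integrable lborel f" and "r > 0"
  shows "integrable lborel (\<lambda>z. f (x + r *\<^sub>R z))"
proof -
  have [measurable]: "f \<in> borel_measurable borel" using f by auto
  have "(lborel :: 'a measure) = density (distr lborel borel (\<lambda>z. x + r *\<^sub>R z)) (\<lambda>_. \<bar>r\<bar> ^ DIM('a))"
    using lborel_affine[of r x] \<open>r > 0\<close> by simp
  then have "integrable (density (distr lborel borel (\<lambda>z. x + r *\<^sub>R z)) (\<lambda>_. \<bar>r\<bar> ^ DIM('a))) f"
    using f by metis
  then have "integrable lborel (\<lambda>z. r ^ DIM('a) * f (x + r *\<^sub>R z))"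
    using \<open>r > 0\<close> by (subst (asm) integrable_density) (auto simp: integrable_distr_eq)
  then show ?thesis using \<open>r > 0\<close> by simp
qed

lemma bump_le_1: "bump 1 k y \<le> 1"
  unfolding bump_def by (rule power_le_one) auto

text \<open>Weighted mean value on the ball of radius \<open>r\<close> about \<open>x0\<close>:
  where |f| < \<epsilon>, |g| is bounded by \<open>M\<close> on a set of measure at most
  \<open>e\<close>; elsewhere |g| \<le> |f g| / \<epsilon>, which the weighted integral
  controls.\<close>

lemma harmonic_bound_split:
  fixes g f :: "'a::euclidean_space \<Rightarrow> real"
  assumes g: "harmonic g" and f: "continuous_on UNIV f"
    and r: "r > 0" "\<And>y. norm (y - x0) < r \<Longrightarrow> norm y < 2"
    and M: "\<And>y. norm (y - x0) < r \<Longrightarrow> \<bar>g y\<bar> \<le> M" and "M \<ge> 0" and \<epsilon>: "\<epsilon> > 0"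
    and E: "emeasure lborel {y \<in> ball 0 2. \<bar>f y\<bar> < \<epsilon>} \<le> ennreal e" and "e \<ge> 0"
    and A: "(\<integral>y. \<bar>f y * g y\<bar> * bump 8 2 y \<partial>lborel) \<le> A"
  shows "bump_mass TYPE('a) * \<bar>g x0\<bar> \<le> (M * e + A / (16 * \<epsilon>)) / r ^ DIM('a)"
proof -
  define S where "S = {y \<in> ball 0 2. \<bar>f y\<bar> < \<epsilon>}"
  have "S = ball 0 2 \<inter> {y. \<bar>f y\<bar> < \<epsilon>}" by (auto simp: S_def)
  then have "open S" by (auto intro!: open_Int open_Collect_less continuous_intros f)
  then have Sm: "S \<in> sets lborel" by simp
  have Sfin: "emeasure lborel S < \<infinity>"
    using E unfolding S_def[symmetric] infinity_ennreal_def by (rule le_less_trans) simp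
  have mS: "measure lborel S \<le> e"
    using E \<open>e \<ge> 0\<close> unfolding S_def[symmetric] measure_def by (simp add: enn2real_leI)
  define F where "F y = M * indicator S y + \<bar>f y * g y\<bar> * bump 8 2 y / (16 * \<epsilon>)" for y
  have cfg: "continuous_on UNIV (\<lambda>y. \<bar>f y * g y\<bar> * bump 8 2 y)"
    by (intro continuous_intros f harmonic_continuous[OF g] continuous_bump)
  have ifg: "integrable lborel (\<lambda>y. \<bar>f y * g y\<bar> * bump 8 2 y)"
    by (rule integrable_compact_support[OF cfg, where r="max 1 8"]) (simp add: bump_support)
  have iS: "integrable lborel (indicator S :: 'a \<Rightarrow> real)"
    using Sm Sfin by (intro integrable_real_indicator)
  have iF: "integrable lborel F"
    unfolding F_def using ifg iS by (intro Bochner_Integration.integrable_add) auto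
  have "(\<integral>y. F y \<partial>lborel) = M * measure lborel S + (\<integral>y. \<bar>f y * g y\<bar> * bump 8 2 y \<partial>lborel) / (16 * \<epsilon>)"
    unfolding F_def using ifg iS by (subst Bochner_Integration.integral_add) auto
  also have "\<dots> \<le> M * e + A / (16 * \<epsilon>)"
    using mS A \<epsilon> \<open>M \<ge> 0\<close> by (intro add_mono mult_left_mono divide_right_mono) auto
  finally have intF: "(\<integral>y. F y \<partial>lborel) \<le> M * e + A / (16 * \<epsilon>)" .
  have Fnn: "F y \<ge> 0" for y
    unfolding F_def using \<open>M \<ge> 0\<close> \<epsilon> by (intro add_nonneg_nonneg) (auto simp: bump_nonneg)
  define w where "w z = g (x0 + r *\<^sub>R z)" for z
  have w: "harmonic w" unfolding w_def by (rule harmonic_affine[OF g])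
  have pt: "\<bar>w z * bump 1 2 z\<bar> \<le> F (x0 + r *\<^sub>R z)" for z
  proof (cases "norm z < 1")
    case True
    define y where "y = x0 + r *\<^sub>R z"
    have near: "norm (y - x0) < r" using True r(1) by (simp add: y_def)
    then have "norm y < 2" by (rule r(2))
    then have y: "y \<in> ball 0 2" by simp
    have "(norm y)\<^sup>2 \<le> 2\<^sup>2" using \<open>norm y < 2\<close> by (intro power_mono) auto
    \<comment> \<open>Since |y| < 2, the weight \<open>bump 8 2 y\<close> is at least (8 - 4)^2 =
      16, the constant in the conclusion.\<close>
    then have "4 ^ 2 \<le> bump 8 2 y" unfolding bump_def dot_square_norm by (intro power_mono) auto
    then have b8: "16 \<le> bump 8 2 y" by simp
    have "\<bar>w z * bump 1 2 z\<bar> \<le> \<bar>g y\<bar>"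
      using mult_left_mono[OF bump_le_1[of 2 z], of "\<bar>g y\<bar>"] bump_nonneg[of 1 2 z]
      by (simp add: w_def y_def abs_mult)
    also have "\<dots> \<le> F y"
    proof (cases "y \<in> S")
      case True
      have "\<bar>g y\<bar> \<le> M * indicator S y" using M[OF near] True by simp
      moreover have "0 \<le> \<bar>f y * g y\<bar> * bump 8 2 y / (16 * \<epsilon>)" using \<epsilon> by (simp add: bump_nonneg)
      ultimately show ?thesis unfolding F_def by linarith
    next
      case False
      then have fy: "\<epsilon> \<le> \<bar>f y\<bar>" using y by (simp add: S_def)
      have "\<bar>g y\<bar> * (16 * \<epsilon>) \<le> \<bar>g y\<bar> * (bump 8 2 y * \<bar>f y\<bar>)"
        using b8 fy \<epsilon> by (intro mult_left_mono mult_mono) auto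
      then have "\<bar>g y\<bar> \<le> \<bar>f y * g y\<bar> * bump 8 2 y / (16 * \<epsilon>)"
        using \<epsilon> by (simp add: pos_le_divide_eq abs_mult mult_ac)
      moreover have "0 \<le> M * indicator S y" using \<open>M \<ge> 0\<close> by simp
      ultimately show ?thesis unfolding F_def by linarith
    qed
    finally show ?thesis by (simp add: y_def)
  next
    case False
    then have "(norm z)\<^sup>2 \<ge> 1" by simp
    then have "bump 1 2 z = 0" unfolding bump_def dot_square_norm by simp
    then show ?thesis using Fnn by simp
  qed
  have "bump_mass TYPE('a) * \<bar>g x0\<bar> = \<bar>\<integral>z. w z * bump 1 2 z \<partial>lborel\<bar>"
    using harmonic_mean_value[OF w, of 0] bump_mass_pos[where 'a='a] by (simp add: w_def abs_mult)
  also have "\<dots> \<le> (\<integral>z. F (x0 + r *\<^sub>R z) \<partial>lborel)"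
  proof (rule order_trans[OF integral_abs_bound integral_mono])
    have c: "continuous_on UNIV (\<lambda>z. w z * bump 1 2 z)"
      by (intro continuous_intros harmonic_continuous w continuous_bump)
    show "integrable lborel (\<lambda>z. \<bar>w z * bump 1 2 z\<bar>)"
      using integrable_compact_support[OF c, where r=1] by (intro integrable_abs) (simp add: bump_support)
    show "integrable lborel (\<lambda>z. F (x0 + r *\<^sub>R z))"
      by (rule lborel_integrable_affine[OF iF r(1)])
  qed (rule pt)
  also have "\<dots> = (\<integral>z. F z \<partial>lborel) / r ^ DIM('a)"
    using iF by (intro lborel_integral_affine r(1)) auto
  also have "\<dots> \<le> (M * e + A / (16 * \<epsilon>)) / r ^ DIM('a)"
    using intF r(1) by (intro divide_right_mono) auto
  finally show ?thesis .
qed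

text \<open>Maximising \<open>\<bar>g x\<bar> (2 - \<bar>x\<bar>)\<^sup>N\<close> turns the a priori finite but uncontrolled supremum of
  \<open>\<bar>g\<bar>\<close> into a term that can be absorbed.\<close>

lemma harmonic_bound_from_weighted_integral:
  fixes L C1 :: real
  assumes L: "L > 0" and C1: "C1 > 0"
  shows "\<exists>C2\<ge>0. \<forall>(g :: 'a::euclidean_space \<Rightarrow> real) f A. harmonic g \<longrightarrow> continuous_on UNIV f \<longrightarrow>
    (\<forall>\<delta>>0. emeasure lborel {y \<in> ball 0 2. \<bar>f y\<bar> < L * \<delta> ^ d} \<le> ennreal (C1 * \<delta>)) \<longrightarrow>
    (\<integral>y. \<bar>f y * g y\<bar> * bump 8 2 y \<partial>lborel) \<le> A \<longrightarrow> (\<forall>x. norm x < 1 \<longrightarrow> \<bar>g x\<bar> \<le> C2 * A)"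
proof -
  define \<kappa> where "\<kappa> = bump_mass TYPE('a)"
  have \<kappa>: "\<kappa> > 0" unfolding \<kappa>_def by (rule bump_mass_pos)
  define n where "n = DIM('a)"
  \<comment> \<open>\<open>n\<close> powers of \<open>r\<close> come from the volume of the ball and
    n d from \<delta>^d with \<delta> = r^n q; with this exponent all powers of \<open>r\<close>
    cancel.\<close>
  define N where "N = n + n * d"
  \<comment> \<open>Chosen so that the contribution of the small set becomes exactly half of
    \<kappa> H(x0), which is absorbed.\<close>
  define q where "q = \<kappa> / (2 ^ Suc N * C1)"
  have q: "q > 0" using \<kappa> C1 by (simp add: q_def)
  define C2 where "C2 = 2 ^ Suc N / (\<kappa> * 16 * L * q ^ d)"
  have C2: "C2 > 0" using \<kappa> L q by (simp add: C2_def)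
  show ?thesis
  proof (intro exI[of _ C2] conjI allI impI)
    show "C2 \<ge> 0" using C2 by simp
    fix g f :: "'a \<Rightarrow> real" and A :: real and x :: 'a
    assume g: "harmonic g" and f: "continuous_on UNIV f"
      and E: "\<forall>\<delta>>0. emeasure lborel {y \<in> ball 0 2. \<bar>f y\<bar> < L * \<delta> ^ d} \<le> ennreal (C1 * \<delta>)"
      and A: "(\<integral>y. \<bar>f y * g y\<bar> * bump 8 2 y \<partial>lborel) \<le> A" and x: "norm x < 1"
    define H where "H y = \<bar>g y\<bar> * (2 - norm y) ^ N" for y
    have "continuous_on (cball 0 2) H"
      unfolding H_def by (intro continuous_intros continuous_on_subset[OF harmonic_continuous[OF g]]) auto
    then obtain x0 where x0: "x0 \<in> cball 0 2" and max: "\<And>y. y \<in> cball 0 2 \<Longrightarrow> H y \<le> H x0"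
      using continuous_attains_sup[of "cball (0::'a) 2" H] by auto
    have A0: "A \<ge> 0"
      using A by (meson order_trans Bochner_Integration.integral_nonneg mult_nonneg_nonneg abs_ge_zero bump_nonneg)
    have "H x0 \<le> C2 * A"
    proof (cases "norm x0 < 2")
      case False
      moreover have "N > 0" by (simp add: N_def n_def)
      ultimately have "H x0 = 0" using x0 by (simp add: H_def zero_power)
      then show ?thesis using C2 A0 by simp
    next
      case True
      define r where "r = (2 - norm x0) / 2"
      have r: "r > 0" "2 - norm x0 = 2 * r" using True by (auto simp: r_def)
      have near: "norm y < 2 - r" if "norm (y - x0) < r" for y
        using that r norm_triangle_ineq[of x0 "y - x0"] by simp
      define \<delta> where "\<delta> = r ^ n * q"
      have \<delta>: "\<delta> > 0" using r q by (simp add: \<delta>_def)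
      have Hnn: "H x0 \<ge> 0" using True by (simp add: H_def)
      have "\<kappa> * \<bar>g x0\<bar> \<le> (H x0 / r ^ N * (C1 * \<delta>) + A / (16 * (L * \<delta> ^ d))) / r ^ n"
        unfolding \<kappa>_def n_def
      proof (rule harmonic_bound_split[OF g f r(1)])
        fix y assume y: "norm (y - x0) < r"
        then show "norm y < 2" using near r by fastforce
        then have "H y \<le> H x0" by (intro max) simp
        have "\<bar>g y\<bar> * r ^ N \<le> \<bar>g y\<bar> * (2 - norm y) ^ N"
          using near[OF y] r by (intro mult_left_mono power_mono) auto
        also have "\<dots> \<le> H x0" using \<open>H y \<le> H x0\<close> by (simp add: H_def)
        finally show "\<bar>g y\<bar> \<le> H x0 / r ^ N" using r by (simp add: pos_le_divide_eq)
      next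
        show "emeasure lborel {y \<in> ball 0 2. \<bar>f y\<bar> < L * \<delta> ^ d} \<le> ennreal (C1 * \<delta>)" using E \<delta> by blast
      qed (use r L \<delta> C1 A Hnn in auto)
      then have "(2 * r) ^ N * (\<kappa> * \<bar>g x0\<bar>) \<le> (2 * r) ^ N * ((H x0 / r ^ N * (C1 * \<delta>) + A / (16 * (L * \<delta> ^ d))) / r ^ n)"
        using r by (intro mult_left_mono) auto
      then have "\<kappa> * H x0 \<le> (2 * r) ^ N * ((H x0 / r ^ N * (C1 * \<delta>) + A / (16 * (L * \<delta> ^ d))) / r ^ n)"
        by (simp add: H_def r(2) mult_ac)
      also have "\<dots> = \<kappa> * (H x0 / 2) + \<kappa> * (C2 * A / 2)"
      proof -
        have "(2 * r) ^ N * (H x0 / r ^ N * (C1 * \<delta>) / r ^ n) = \<kappa> * (H x0 / 2)"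
          using r C1 by (simp add: \<delta>_def q_def power_mult_distrib)
        moreover have "(2 * r) ^ N * (A / (16 * (L * \<delta> ^ d)) / r ^ n) = \<kappa> * (C2 * A / 2)"
        proof -
          have "\<delta> ^ d * r ^ n = r ^ N * q ^ d"
            by (simp add: \<delta>_def N_def power_mult_distrib power_add power_mult)
          then have "(2 * r) ^ N * (A / (16 * (L * \<delta> ^ d)) / r ^ n) = 2 ^ N * r ^ N * A / (16 * L * (r ^ N * q ^ d))"
            by (simp add: power_mult_distrib mult.assoc)
          also have "\<dots> = 2 ^ N * A / (16 * L * q ^ d)" using r by simp
          also have "\<dots> = \<kappa> * (C2 * A / 2)" using \<kappa> by (simp add: C2_def)
          finally show ?thesis .
        qed
        ultimately show ?thesis by (simp only: add_divide_distrib distrib_left)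
      qed
      finally have "\<kappa> * H x0 \<le> \<kappa> * (H x0 / 2 + C2 * A / 2)" by (simp add: distrib_left)
      then have "H x0 \<le> H x0 / 2 + C2 * A / 2" using \<kappa> by simp
      then show ?thesis by simp
    qed
    moreover have "\<bar>g x\<bar> \<le> H x"
    proof -
      have "1 \<le> (2 - norm x) ^ N" using x by (intro one_le_power) simp
      then show ?thesis unfolding H_def using mult_left_mono[of 1 "(2 - norm x) ^ N" "\<bar>g x\<bar>"] by simp
    qed
    moreover have "H x \<le> H x0" using x by (intro max) simp
    ultimately show "\<bar>g x\<bar> \<le> C2 * A" by simp
  qed
qed

text \<open>Apply the bound to u(R y) / R^d and v(R y). Of the components R^(j - d)
  \<open>a j\<close> the top one is independent of \<open>R\<close>, so the sublevel estimate is
  uniform in R \<ge> 1. By the sign condition the integral of |u v| is that of u v, a sum of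
  pairings in which the term of degree \<open>j\<close> scales like R^(2 j - d), at most
  R^d.\<close>

lemma growth_of_constant_sign:
  fixes v :: "'a::euclidean_space \<Rightarrow> real"
  assumes v: "harmonic v"
    and a: "\<And>j. j \<le> d \<Longrightarrow> harmonic (a j)" "\<And>j. j \<le> d \<Longrightarrow> homogeneous j (a j)"
    and nz: "a d h0 \<noteq> 0" and sign: "\<And>x. (\<Sum>j\<le>d. a j x) * v x \<ge> 0"
  shows "growth d v"
proof -
  define h where "h = h0 /\<^sub>R (1 + norm h0)"
  have pos: "1 + norm h0 > 0" by (simp add: add_pos_nonneg)
  have h: "norm h \<le> 1" using pos by (simp add: h_def field_simps)
  have nzh: "a d h \<noteq> 0"
    using a(2)[of d] nz pos by (simp add: h_def homogeneous_def)
  define L where "L = \<bar>a d h\<bar>"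
  have L: "L > 0" using nzh by (simp add: L_def)
  have fin: "emeasure lborel (ball (0::'a) 3) < \<infinity>" by (rule emeasure_lborel_ball_finite)
  define V where "V = measure lborel (ball (0::'a) 3)"
  have V: "emeasure lborel (ball (0::'a) 3) = ennreal V" "V \<ge> 0"
    using fin by (auto simp: V_def emeasure_eq_ennreal_measure)
  \<comment> \<open>The summand 1 keeps \<open>C1\<close> positive when d = 0.\<close>
  define C1 where "C1 = 2 * real d * V + 1"
  have C1: "C1 > 0" using V by (simp add: C1_def add_nonneg_pos)
  obtain C2 where C2: "C2 \<ge> 0" "\<forall>(g :: 'a \<Rightarrow> real) f A. harmonic g \<longrightarrow> continuous_on UNIV f \<longrightarrow>
    (\<forall>\<delta>>0. emeasure lborel {y \<in> ball 0 2. \<bar>f y\<bar> < L * \<delta> ^ d} \<le> ennreal (C1 * \<delta>)) \<longrightarrow>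
    (\<integral>y. \<bar>f y * g y\<bar> * bump 8 2 y \<partial>lborel) \<le> A \<longrightarrow> (\<forall>x. norm x < 1 \<longrightarrow> \<bar>g x\<bar> \<le> C2 * A)"
    using harmonic_bound_from_weighted_integral[OF L C1, of d, where 'a='a] by blast
  define S where "S = (\<Sum>j\<le>d. \<bar>pairing (a j) v 8 1\<bar>)"
  have key: "\<bar>v (R *\<^sub>R x)\<bar> \<le> C2 * (S * R ^ d)" if R: "R \<ge> 1" and x: "norm x < 1" for R x
  proof -
    define c where "c j y = (R ^ j / R ^ d) * a j y" for j y
    have ch: "harmonic (c j)" "homogeneous j (c j)" if "j \<le> d" for j
    proof -
      show "harmonic (c j)" unfolding c_def by (rule harmonic_cmult[OF a(1)[OF that]])
      show "homogeneous j (c j)" using a(2)[OF that] by (simp add: c_def homogeneous_def)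
    qed
    define f where "f y = (\<Sum>j\<le>d. c j y)" for y
    define g where "g y = v (R *\<^sub>R y)" for y
    have g: "harmonic g" unfolding g_def by (rule harmonic_scale[OF v])
    have cf: "continuous_on UNIV f"
      unfolding f_def using ch(1) by (intro continuous_intros harmonic_continuous) auto
    have feq: "f y = (\<Sum>j\<le>d. a j (R *\<^sub>R y)) / R ^ d" for y
      unfolding f_def c_def sum_divide_distrib using a(2)
      by (intro sum.cong refl) (simp add: homogeneous_def)
    have fg: "\<bar>f y * g y\<bar> = f y * g y" for y
      using sign[of "R *\<^sub>R y"] R by (simp add: feq g_def)
    have meas: "emeasure lborel {y \<in> ball 0 2. \<bar>f y\<bar> < L * \<delta> ^ d} \<le> ennreal (C1 * \<delta>)" if \<delta>: "\<delta> > 0" for \<delta>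
    proof -
      have "c d h = a d h" using R by (simp add: c_def)
      then have "emeasure lborel {y \<in> ball 0 2. \<bar>f y\<bar> < L * \<delta> ^ d} \<le> ennreal (2 * real d * \<delta>) * emeasure lborel (ball (0::'a) 3)"
        using emeasure_harmonic_sublevel[of d c h \<delta>, OF ch h _ \<delta>] nzh unfolding f_def L_def by simp
      also have "\<dots> = ennreal (2 * real d * \<delta> * V)"
        using \<delta> V by (simp add: ennreal_mult)
      also have "\<dots> \<le> ennreal (C1 * \<delta>)"
        using \<delta> by (intro ennreal_leI) (simp add: C1_def algebra_simps)
      finally show ?thesis .
    qed
    have int: "integrable lborel (\<lambda>y. a j y * v (R *\<^sub>R y) * bump 8 2 y)" if "j \<le> d" for j
      by (rule integrable_compact_support[where r="max 1 8"],
          intro continuous_intros continuous_bump harmonic_continuous[OF a(1)[OF that]]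
          continuous_on_compose2[OF harmonic_continuous[OF v]])
        (auto simp: bump_support)
    have "(\<integral>y. \<bar>f y * g y\<bar> * bump 8 2 y \<partial>lborel) = (\<integral>y. (\<Sum>j\<le>d. (R ^ j / R ^ d) * (a j y * v (R *\<^sub>R y) * bump 8 2 y)) \<partial>lborel)"
      unfolding fg
      by (intro Bochner_Integration.integral_cong refl) (simp add: f_def c_def g_def sum_distrib_right mult.assoc)
    also have "\<dots> = (\<Sum>j\<le>d. (R ^ j / R ^ d) * pairing (a j) v 8 R)"
      using int by (subst Bochner_Integration.integral_sum) (auto simp: pairing_def)
    also have "\<dots> \<le> (\<Sum>j\<le>d. R ^ d * \<bar>pairing (a j) v 8 1\<bar>)"
    proof (rule sum_mono)
      fix j assume "j \<in> {..d}"
      then have j: "j \<le> d" by simp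
      have "(R ^ j / R ^ d) * pairing (a j) v 8 R = R ^ j / R ^ d * (R ^ j * pairing (a j) v 8 1)"
        using R by (subst pairing_scale[OF v a(1)[OF j] a(2)[OF j]]) auto
      also have "\<dots> \<le> R ^ j / R ^ d * (R ^ j * \<bar>pairing (a j) v 8 1\<bar>)"
        using R by (intro mult_left_mono) auto
      also have "\<dots> \<le> 1 * (R ^ d * \<bar>pairing (a j) v 8 1\<bar>)"
        using R j by (intro mult_mono mult_right_mono power_increasing) (auto simp: power_increasing)
      finally show "(R ^ j / R ^ d) * pairing (a j) v 8 R \<le> R ^ d * \<bar>pairing (a j) v 8 1\<bar>" by simp
    qed
    also have "\<dots> = S * R ^ d" by (simp add: S_def sum_distrib_left mult.commute)
    finally have "(\<integral>y. \<bar>f y * g y\<bar> * bump 8 2 y \<partial>lborel) \<le> S * R ^ d" .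
    then have "\<bar>g x\<bar> \<le> C2 * (S * R ^ d)"
      using C2(2)[rule_format, OF g cf meas] x by blast
    then show ?thesis by (simp add: g_def)
  qed
  have "\<bar>v x\<bar> \<le> (C2 * S) * (1 + norm x) ^ d" for x
  proof -
    define R where "R = 1 + norm x"
    have R: "R \<ge> 1" "R > 0" by (auto simp: R_def add_pos_nonneg)
    have "norm (x /\<^sub>R R) < 1" using R by (simp add: R_def field_simps)
    from key[OF R(1) this] show ?thesis using R by (simp add: R_def[symmetric] mult.assoc)
  qed
  then show ?thesis unfolding growth_def by blast
qed

subsection \<open>An energy identity for the quotient\<close>

text \<open>\<open>A\<close> and \<open>B\<close> stand for the inner products of the field u grad w
  - w grad u with grad u and grad w, and q = s^2 + e. The left side is the derivative of w s / q
  along that field; as \<open>e\<close> tends to 0 where s \<noteq> 0, only the term with \<alpha>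
  survives.\<close>

lemma energy_integrand_eq:
  fixes s q :: real
  assumes s: "s = \<alpha> * u + \<beta> * w" and q: "q = s * s + e" "q \<noteq> 0"
  shows "(w * s) * (- (inverse q)\<^sup>2 * (2 * s * (\<alpha> * A + \<beta> * B))) + inverse q * (w * (\<alpha> * A + \<beta> * B) + s * B)
    = (\<alpha> * s\<^sup>2 * (u * B - w * A) + e * (s * B + w * (\<alpha> * A + \<beta> * B))) / q\<^sup>2"
proof -
  define g where "g = \<alpha> * A + \<beta> * B"
  have "(w * s) * (- (inverse q)\<^sup>2 * (2 * s * g)) + inverse q * (w * g + s * B)
      = (- (2 * w * s\<^sup>2 * g) + q * (w * g + s * B)) / q\<^sup>2"
    using q(2) by (simp add: field_simps power2_eq_square)
  also have "- (2 * w * s\<^sup>2 * g) + q * (w * g + s * B) = s\<^sup>2 * (s * B - w * g) + e * (s * B + w * g)"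
    by (simp add: q power2_eq_square algebra_simps)
  also have "s * B - w * g = \<alpha> * (u * B - w * A)"
    by (simp add: s g_def algebra_simps)
  finally show ?thesis by (simp add: g_def algebra_simps)
qed

text \<open>The bound does not contain \<open>e\<close>. As \<open>u\<close> and \<open>w\<close>
  are O(|s|), so is \<open>G\<close>, and each summand carries enough factors \<open>s\<close> to be
  controlled by s^2 \<le> q and e s^2 \<le> q^2.\<close>

lemma energy_integrand_bound:
  fixes G gu gw gs \<eta>' :: "'a::euclidean_space"
  assumes M: "\<bar>u\<bar> \<le> M * \<bar>s\<bar>" "\<bar>w\<bar> \<le> M * \<bar>s\<bar>" "M \<ge> 0" and G: "G = u *\<^sub>R gw - w *\<^sub>R gu"
    and D: "D = M * (norm gu + norm gw)" and e: "e > 0" and q: "q = s * s + e"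
  shows "\<bar>w * s / q * (G \<bullet> \<eta>') + \<eta> * ((\<alpha> * s\<^sup>2 * (G \<bullet> G) + e * (G \<bullet> (s *\<^sub>R gw + w *\<^sub>R gs))) / q\<^sup>2)\<bar>
    \<le> M * (norm G * norm \<eta>') + \<bar>\<eta>\<bar> * (\<bar>\<alpha>\<bar> * D\<^sup>2 + D * (norm gw + M * norm gs))"
proof -
  have q0: "q > 0" "s\<^sup>2 \<le> q" using e by (auto simp: q power2_eq_square add_nonneg_pos)
  have D0: "D \<ge> 0" using M by (simp add: D)
  have "norm G \<le> \<bar>u\<bar> * norm gw + \<bar>w\<bar> * norm gu"
    unfolding G using norm_triangle_ineq4[of "u *\<^sub>R gw" "w *\<^sub>R gu"] by simp
  also have "\<dots> \<le> (M * \<bar>s\<bar>) * norm gw + (M * \<bar>s\<bar>) * norm gu"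
    using M by (intro add_mono mult_right_mono) auto
  finally have GD: "norm G \<le> \<bar>s\<bar> * D" by (simp add: D algebra_simps)
  have "\<bar>w * s\<bar> \<le> M * s\<^sup>2"
    using mult_right_mono[OF M(2), of "\<bar>s\<bar>"] by (simp add: abs_mult power2_eq_square mult.assoc flip: abs_mult)
  also have "\<dots> \<le> M * q" using q0 M by (intro mult_left_mono) auto
  finally have ws: "\<bar>w * s / q\<bar> \<le> M" using q0 by (simp add: pos_divide_le_eq)
  have 1: "\<bar>w * s / q * (G \<bullet> \<eta>')\<bar> \<le> M * (norm G * norm \<eta>')"
    unfolding abs_mult[of "w * s / q"] using ws M by (intro mult_mono Cauchy_Schwarz_ineq2) auto
  have q2: "q\<^sup>2 > 0" using q0 by simp
  have "G \<bullet> G \<le> (\<bar>s\<bar> * D)\<^sup>2"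
    unfolding power2_norm_eq_inner[symmetric] using GD by (intro power_mono) auto
  then have "s\<^sup>2 * (G \<bullet> G) \<le> s\<^sup>2 * (s\<^sup>2 * D\<^sup>2)"
    by (intro mult_left_mono) (auto simp: power_mult_distrib)
  also have "\<dots> = (s\<^sup>2)\<^sup>2 * D\<^sup>2" by (simp add: power2_eq_square)
  also have "\<dots> \<le> q\<^sup>2 * D\<^sup>2" using q0 by (intro mult_right_mono power_mono) auto
  finally have 2: "\<bar>\<alpha> * s\<^sup>2 * (G \<bullet> G)\<bar> \<le> q\<^sup>2 * (\<bar>\<alpha>\<bar> * D\<^sup>2)"
    by (simp add: abs_mult mult.assoc mult.left_commute[of "q\<^sup>2"] mult_left_mono)
  have "e * s\<^sup>2 \<le> q\<^sup>2"
  proof -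
    have "q\<^sup>2 = (s\<^sup>2)\<^sup>2 + 2 * (e * s\<^sup>2) + e\<^sup>2" by (simp add: q power2_eq_square algebra_simps)
    moreover have "e * s\<^sup>2 \<ge> 0" "(s\<^sup>2)\<^sup>2 \<ge> 0" "e\<^sup>2 \<ge> 0" using e by auto
    ultimately show ?thesis by linarith
  qed
  have "\<bar>G \<bullet> (s *\<^sub>R gw + w *\<^sub>R gs)\<bar> \<le> norm G * norm (s *\<^sub>R gw + w *\<^sub>R gs)"
    by (rule Cauchy_Schwarz_ineq2)
  also have "\<dots> \<le> (\<bar>s\<bar> * D) * (\<bar>s\<bar> * (norm gw + M * norm gs))"
  proof (rule mult_mono[OF GD])
    have "norm (s *\<^sub>R gw + w *\<^sub>R gs) \<le> \<bar>s\<bar> * norm gw + \<bar>w\<bar> * norm gs"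
      using norm_triangle_ineq[of "s *\<^sub>R gw" "w *\<^sub>R gs"] by simp
    also have "\<dots> \<le> \<bar>s\<bar> * norm gw + (M * \<bar>s\<bar>) * norm gs"
      using M by (intro add_mono mult_right_mono) auto
    finally show "norm (s *\<^sub>R gw + w *\<^sub>R gs) \<le> \<bar>s\<bar> * (norm gw + M * norm gs)" by (simp add: algebra_simps)
  qed (use D0 in auto)
  also have "\<dots> = s\<^sup>2 * (D * (norm gw + M * norm gs))"
    by (simp add: power2_eq_square mult_ac flip: abs_mult)
  finally have "e * \<bar>G \<bullet> (s *\<^sub>R gw + w *\<^sub>R gs)\<bar> \<le> (e * s\<^sup>2) * (D * (norm gw + M * norm gs))"
    using e by (simp add: mult.assoc mult_left_mono)
  also have "\<dots> \<le> q\<^sup>2 * (D * (norm gw + M * norm gs))"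
    using \<open>e * s\<^sup>2 \<le> q\<^sup>2\<close> D0 M by (intro mult_right_mono) auto
  finally have 3: "\<bar>e * (G \<bullet> (s *\<^sub>R gw + w *\<^sub>R gs))\<bar> \<le> q\<^sup>2 * (D * (norm gw + M * norm gs))"
    using e by (simp add: abs_mult)
  have "\<bar>(\<alpha> * s\<^sup>2 * (G \<bullet> G) + e * (G \<bullet> (s *\<^sub>R gw + w *\<^sub>R gs))) / q\<^sup>2\<bar> \<le> \<bar>\<alpha>\<bar> * D\<^sup>2 + D * (norm gw + M * norm gs)"
  proof -
    have "\<bar>\<alpha> * s\<^sup>2 * (G \<bullet> G) + e * (G \<bullet> (s *\<^sub>R gw + w *\<^sub>R gs))\<bar> \<le> q\<^sup>2 * (\<bar>\<alpha>\<bar> * D\<^sup>2) + q\<^sup>2 * (D * (norm gw + M * norm gs))"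
      using 2 3 by linarith
    then show ?thesis using q2 unfolding abs_divide by (simp add: pos_divide_le_eq algebra_simps)
  qed
  then have 4: "\<bar>\<eta> * ((\<alpha> * s\<^sup>2 * (G \<bullet> G) + e * (G \<bullet> (s *\<^sub>R gw + w *\<^sub>R gs))) / q\<^sup>2)\<bar> \<le> \<bar>\<eta>\<bar> * (\<bar>\<alpha>\<bar> * D\<^sup>2 + D * (norm gw + M * norm gs))"
    unfolding abs_mult[of \<eta>] by (intro mult_left_mono) auto
  show ?thesis using 1 4 by linarith
qed

text \<open>Where \<open>u\<close> is nonzero this is u^2 times the gradient of w / u; unlike that
  quotient it extends continuously across the zeros of \<open>u\<close>.\<close>

definition wronskian :: "('a::euclidean_space \<Rightarrow> real) \<Rightarrow> ('a \<Rightarrow> real) \<Rightarrow> 'a \<Rightarrow> 'a"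
  where "wronskian u w x = u x *\<^sub>R grad w x - w x *\<^sub>R grad u x"

lemma continuous_wronskian:
  "harmonic u \<Longrightarrow> harmonic w \<Longrightarrow> continuous_on UNIV (wronskian u w)"
  unfolding wronskian_def[abs_def]
  by (intro continuous_intros harmonic_continuous harmonic_continuous_grad)

text \<open>The field \<open>u \<nabla>w - w \<nabla>u\<close> is divergence free and vanishes with \<open>s\<close>, so it can be tested
  against the bounded but discontinuous quotient \<open>w / s\<close>; the test function \<open>w s / (s\<^sup>2 + e)\<close>
  makes this rigorous. On \<open>s = 0\<close> both sides vanish thanks to \<open>x / 0 = 0\<close>.\<close>

lemma energy_identity:
  fixes u w :: "'a::euclidean_space \<Rightarrow> real"
  assumes u: "harmonic u" and w: "harmonic w" and s: "\<And>x. s x = \<alpha> * u x + \<beta> * w x"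
    and M: "\<And>x. \<bar>u x\<bar> \<le> M * \<bar>s x\<bar>" "\<And>x. \<bar>w x\<bar> \<le> M * \<bar>s x\<bar>" "M \<ge> 0"
    and \<eta>: "\<And>x. GDERIV \<eta> x :> \<eta>' x" and c\<eta>': "continuous_on UNIV \<eta>'"
    and supp: "\<And>x. norm x > r \<Longrightarrow> \<eta> x = 0"
  defines "I \<equiv> \<lambda>x. \<alpha> * \<eta> x * (wronskian u w x \<bullet> wronskian u w x) / (s x)\<^sup>2 + w x / s x * (wronskian u w x \<bullet> \<eta>' x)"
  shows "integrable lborel I" "(\<integral>x. I x \<partial>lborel) = 0"
proof -
  define G where "G = wronskian u w"
  have c\<eta>: "continuous_on UNIV \<eta>"
    using \<eta> unfolding gderiv_def by (meson has_derivative_continuous continuous_at_imp_continuous_on)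
  note supp' = GDERIV_compact_support[OF \<eta> supp]
  have sfun: "s = (\<lambda>x. \<alpha> * u x + \<beta> * w x)" using s by auto
  have hs: "harmonic s" unfolding sfun by (rule harmonic_lin[OF u w])
  have gs: "grad s x = \<alpha> *\<^sub>R grad u x + \<beta> *\<^sub>R grad w x" for x
  proof (rule grad_eqI[OF _ harmonicD(1)[OF hs]])
    have "GDERIV (\<lambda>x. \<alpha> * u x + \<beta> * w x) x :> (\<alpha> *\<^sub>R grad u x + u x *\<^sub>R 0) + (\<beta> *\<^sub>R grad w x + w x *\<^sub>R 0)"
      by (intro GDERIV_add GDERIV_mult GDERIV_const harmonic_GDERIV u w)
    then show "GDERIV s x :> \<alpha> *\<^sub>R grad u x + \<beta> *\<^sub>R grad w x" unfolding sfun by simp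
  qed
  note conts = harmonic_continuous[OF u] harmonic_continuous[OF w] harmonic_continuous[OF hs]
    harmonic_continuous_grad[OF u] harmonic_continuous_grad[OF w] harmonic_continuous_grad[OF hs]
  have cG: "continuous_on UNIV G" unfolding G_def by (rule continuous_wronskian[OF u w])
  define e where "e k = inverse (real (Suc k))" for k
  have e: "e k > 0" for k by (simp add: e_def)
  define q where "q k x = s x * s x + e k" for k x
  have q: "q k x > 0" for k x using e[of k] by (simp add: q_def add_nonneg_pos)
  define \<phi> where "\<phi> k x = (w x * s x) * inverse (q k x)" for k x
  define \<phi>' where "\<phi>' k x = (w x * s x) *\<^sub>R (- (inverse (q k x))\<^sup>2 *\<^sub>R ((s x *\<^sub>R grad s x + s x *\<^sub>R grad s x) + 0))
    + inverse (q k x) *\<^sub>R (w x *\<^sub>R grad s x + s x *\<^sub>R grad w x)" for k x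
  have d\<phi>: "GDERIV (\<phi> k) x :> \<phi>' k x" for k x
    unfolding \<phi>_def[abs_def] \<phi>'_def
    using q[of k x] unfolding q_def[abs_def] q_def
    by (intro GDERIV_mult GDERIV_inverse GDERIV_add GDERIV_const harmonic_GDERIV w hs) auto
  have cq: "continuous_on UNIV (\<lambda>x. inverse (q k x))" for k
    using q[of k] unfolding q_def by (intro continuous_intros conts) (auto simp: less_imp_neq[symmetric])
  have c\<phi>: "continuous_on UNIV (\<phi> k)" "continuous_on UNIV (\<phi>' k)" for k
    unfolding \<phi>_def[abs_def] \<phi>'_def[abs_def] by (intro continuous_intros conts cq)+
  define X where "X k x = G x \<bullet> (\<phi> k x *\<^sub>R \<eta>' x + \<eta> x *\<^sub>R \<phi>' k x)" for k x
  have cX: "continuous_on UNIV (X k)" for k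
    unfolding X_def[abs_def] by (intro continuous_intros cG c\<phi> c\<eta> c\<eta>')
  have iX: "(\<integral>x. X k x \<partial>lborel) = 0" for k
    unfolding X_def G_def wronskian_def
  proof (rule harmonic_Green[OF u w, where r=r])
    show "GDERIV (\<lambda>x. \<phi> k x * \<eta> x) x :> \<phi> k x *\<^sub>R \<eta>' x + \<eta> x *\<^sub>R \<phi>' k x" for x
      by (intro GDERIV_mult d\<phi> \<eta>)
    show "continuous_on UNIV (\<lambda>x. \<phi> k x *\<^sub>R \<eta>' x + \<eta> x *\<^sub>R \<phi>' k x)"
      by (intro continuous_intros c\<phi> c\<eta> c\<eta>')
  qed (simp add: supp)
  have Xeq: "X k x = w x * s x / q k x * (G x \<bullet> \<eta>' x) + \<eta> x * ((\<alpha> * (s x)\<^sup>2 * (G x \<bullet> G x) + e k * (G x \<bullet> (s x *\<^sub>R grad w x + w x *\<^sub>R grad s x))) / (q k x)\<^sup>2)" for k x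
  proof -
    have "G x \<bullet> \<phi>' k x = (w x * s x) * (- (inverse (q k x))\<^sup>2 * (2 * s x * (\<alpha> * (G x \<bullet> grad u x) + \<beta> * (G x \<bullet> grad w x))))
        + inverse (q k x) * (w x * (\<alpha> * (G x \<bullet> grad u x) + \<beta> * (G x \<bullet> grad w x)) + s x * (G x \<bullet> grad w x))"
      by (simp add: \<phi>'_def gs inner_add_right algebra_simps)
    also have "\<dots> = (\<alpha> * (s x)\<^sup>2 * (u x * (G x \<bullet> grad w x) - w x * (G x \<bullet> grad u x))
        + e k * (s x * (G x \<bullet> grad w x) + w x * (\<alpha> * (G x \<bullet> grad u x) + \<beta> * (G x \<bullet> grad w x)))) / (q k x)\<^sup>2"
      by (rule energy_integrand_eq[OF s q_def]) (use q[of k x] in simp)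
    also have "u x * (G x \<bullet> grad w x) - w x * (G x \<bullet> grad u x) = G x \<bullet> G x"
      by (simp add: G_def wronskian_def inner_diff_right)
    also have "s x * (G x \<bullet> grad w x) + w x * (\<alpha> * (G x \<bullet> grad u x) + \<beta> * (G x \<bullet> grad w x)) = G x \<bullet> (s x *\<^sub>R grad w x + w x *\<^sub>R grad s x)"
      by (simp add: gs inner_add_right)
    finally show ?thesis by (simp add: X_def inner_add_right \<phi>_def divide_inverse)
  qed
  define D where "D x = M * (norm (grad u x) + norm (grad w x))" for x
  \<comment> \<open>Continuous, of compact support and independent of \<open>k\<close>: the
    dominating function for the limit of the regularisation.\<close>
  define B where "B x = M * (norm (G x) * norm (\<eta>' x)) + \<bar>\<eta> x\<bar> * (\<bar>\<alpha>\<bar> * (D x)\<^sup>2 + D x * (norm (grad w x) + M * norm (grad s x)))" for x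
  have cB: "continuous_on UNIV B"
    unfolding B_def[abs_def] D_def by (intro continuous_intros conts cG c\<eta> c\<eta>')
  have iB: "integrable lborel B"
    by (rule integrable_compact_support[OF cB, where r=r]) (simp add: B_def supp supp')
  have lim: "(\<lambda>k. X k x) \<longlonglongrightarrow> I x" for x
  proof (cases "s x = 0")
    case True
    then have "u x = 0" "w x = 0" using M(1)[of x] M(2)[of x] by auto
    then have "G x = 0" by (simp add: G_def wronskian_def)
    then show ?thesis by (simp add: X_def I_def G_def)
  next
    case False
    have e0: "e \<longlonglongrightarrow> 0" unfolding e_def[abs_def] by (rule LIMSEQ_inverse_real_of_nat)
    have q0: "(\<lambda>k. q k x) \<longlonglongrightarrow> s x * s x + 0" unfolding q_def by (intro tendsto_intros e0)
    have nz: "s x * s x + 0 \<noteq> 0" "(s x * s x + 0)\<^sup>2 \<noteq> 0" using False by auto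
    have "(\<lambda>k. X k x) \<longlonglongrightarrow> w x * s x / (s x * s x + 0) * (G x \<bullet> \<eta>' x) + \<eta> x * ((\<alpha> * (s x)\<^sup>2 * (G x \<bullet> G x) + 0 * (G x \<bullet> (s x *\<^sub>R grad w x + w x *\<^sub>R grad s x))) / (s x * s x + 0)\<^sup>2)"
      unfolding Xeq by (intro tendsto_intros q0 e0 nz)
    also have "w x * s x / (s x * s x + 0) * (G x \<bullet> \<eta>' x) + \<eta> x * ((\<alpha> * (s x)\<^sup>2 * (G x \<bullet> G x) + 0 * (G x \<bullet> (s x *\<^sub>R grad w x + w x *\<^sub>R grad s x))) / (s x * s x + 0)\<^sup>2) = I x"
      using False by (simp add: I_def G_def power2_eq_square)
    finally show ?thesis .
  qed
  have mI: "I \<in> borel_measurable lborel"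
    by (rule borel_measurable_LIMSEQ_real[OF lim]) (use cX in \<open>auto intro: borel_measurable_continuous_onI\<close>)
  have mX: "X k \<in> borel_measurable lborel" for k
    using cX[of k] by (simp add: borel_measurable_continuous_onI)
  have bd: "AE x in lborel. norm (X k x) \<le> B x" for k
  proof (rule AE_I2)
    fix x
    show "norm (X k x) \<le> B x"
      unfolding Xeq B_def real_norm_def
      by (rule energy_integrand_bound[OF M(1) M(2) M(3) _ D_def e q_def]) (simp add: G_def wronskian_def)
  qed
  show "integrable lborel I"
    by (rule integrable_dominated_convergence[OF mI mX iB AE_I2[OF lim] bd])
  have "(\<lambda>k. \<integral>x. X k x \<partial>lborel) \<longlonglongrightarrow> (\<integral>x. I x \<partial>lborel)"
    by (rule integral_dominated_convergence[OF mI mX iB AE_I2[OF lim] bd])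
  then show "(\<integral>x. I x \<partial>lborel) = 0"
    by (simp add: iX LIMSEQ_const_iff)
qed

subsection \<open>Proportionality\<close>

lemma homogeneous_nonzero_in_ball:
  assumes "homogeneous d u" "u x1 \<noteq> (0::real)"
  shows "\<exists>p. norm p < 1 \<and> u p \<noteq> 0"
proof (intro exI conjI)
  have pos: "1 + norm x1 > 0" by (simp add: add_pos_nonneg)
  show "norm (x1 /\<^sub>R (1 + norm x1)) < 1" using pos by (simp add: field_simps)
  show "u (x1 /\<^sub>R (1 + norm x1)) \<noteq> 0" using assms pos by (simp add: homogeneous_def)
qed

lemma growth_homogeneous:
  fixes u :: "'a::euclidean_space \<Rightarrow> real"
  assumes "continuous_on UNIV u" "homogeneous d u"
  shows "growth d u"
proof -
  have "growth d (\<lambda>x. \<Sum>j\<le>d. (if j = d then u else (\<lambda>_. 0)) x)"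
    by (rule growth_homogeneous_sum) (use assms in \<open>auto simp: homogeneous_def\<close>)
  moreover have "(\<lambda>x. \<Sum>j\<le>d. (if j = d then u else (\<lambda>_. 0)) x) = u"
    by (rule ext) (simp add: if_distribR sum.delta cong: if_cong)
  ultimately show ?thesis by simp
qed

text \<open>Green's identity with a radial weight and Euler's relation show that k - d times the
  weighted integral of u v is 0. If the degrees differ, u v = 0 on the unit ball, so
  \<open>v\<close> vanishes on an open set where \<open>u\<close> does not.\<close>

lemma homogeneous_harmonic_same_sign_imp_same_degree:
  fixes u v :: "'a::euclidean_space \<Rightarrow> real"
  assumes u: "harmonic u" "homogeneous d u" "u x1 \<noteq> 0" and v: "harmonic v" "homogeneous k v" "v x2 \<noteq> 0"
    and sign: "\<And>x. u x * v x \<ge> 0"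
  shows "d = k"
proof (rule ccontr)
  assume "d \<noteq> k"
  define F where "F x = u x * v x * bump 1 1 x" for x
  have cF: "continuous_on UNIV F"
    unfolding F_def by (intro continuous_intros harmonic_continuous u v continuous_bump)
  have iF: "integrable lborel F"
    by (rule integrable_compact_support[OF cF, where r=1]) (simp add: F_def bump_support)
  have "0 = (\<integral>x. (u x *\<^sub>R grad v x - v x *\<^sub>R grad u x) \<bullet> ((- (2 * real (0 + 2) * bump 1 (Suc 0) x)) *\<^sub>R x) \<partial>lborel)"
    by (rule harmonic_Green[OF u(1) v(1) GDERIV_bump, symmetric, where r=1])
      (intro continuous_intros continuous_bump, simp add: bump_support)
  also have "\<dots> = (\<integral>x. (- 4 * (real k - real d)) * F x \<partial>lborel)"
  proof (rule Bochner_Integration.integral_cong[OF refl])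
    fix x
    have "x \<bullet> grad v x = k * v x" "x \<bullet> grad u x = d * u x"
      using homogeneous_Euler u v harmonic_GDERIV by blast+
    then show "(u x *\<^sub>R grad v x - v x *\<^sub>R grad u x) \<bullet> ((- (2 * real (0 + 2) * bump 1 (Suc 0) x)) *\<^sub>R x) = (- 4 * (real k - real d)) * F x"
      by (simp add: F_def inner_diff_left inner_commute[of _ x] algebra_simps)
  qed
  finally have "(\<integral>x. F x \<partial>lborel) = 0" using \<open>d \<noteq> k\<close> by simp
  then have F0: "F x = 0" for x
    by (intro integral_eq_0_imp_eq_0_open[OF iF _ _ open_UNIV cF]) (auto simp: F_def sign bump_nonneg)
  define U where "U = ball 0 1 \<inter> u -` (- {0})"
  have "open U"
    unfolding U_def using continuous_on_subset[OF harmonic_continuous[OF u(1)] subset_UNIV]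
    by (intro continuous_open_preimage) auto
  moreover have "U \<noteq> {}" using homogeneous_nonzero_in_ball[OF u(2,3)] by (auto simp: U_def)
  moreover have "v x = 0" if "x \<in> U" for x
    using F0[of x] that bump_pos[of x 1] by (auto simp: U_def F_def)
  ultimately have "v x2 = 0"
    by (rule harmonic_unique_continuation[OF v(1) growth_homogeneous[OF harmonic_continuous[OF v(1)] v(2)]])
  with v(3) show False by simp
qed

text \<open>For equal degrees Euler's relation makes the wronskian orthogonal to \<open>x\<close>.
  With a radial cutoff the second term of the energy identity disappears, and the weighted integral
  of |wronskian|^2 / s^2 is 0. Hence v / u is locally constant where \<open>u\<close> is
  nonzero.\<close>

lemma homogeneous_harmonic_same_sign_imp_proportional:
  fixes u v :: "'a::euclidean_space \<Rightarrow> real"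
  assumes u: "harmonic u" "homogeneous d u" "u x1 \<noteq> 0" and v: "harmonic v" "homogeneous d v"
    and sign: "\<And>x. u x * v x \<ge> 0"
  shows "\<exists>c\<ge>0. \<forall>x. v x = c * u x"
proof -
  \<comment> \<open>With u v \<ge> 0 the absolute values add up, |s| = |u| + |v|, so M = 1 is
    admissible.\<close>
  define s where "s x = 1 * u x + 1 * v x" for x
  have s: "\<bar>u x\<bar> \<le> 1 * \<bar>s x\<bar>" "\<bar>v x\<bar> \<le> 1 * \<bar>s x\<bar>" for x
    using sign[of x] by (auto simp: s_def zero_le_mult_iff)
  define G where "G = wronskian u v"
  define I where "I x = 1 * bump 1 (Suc (Suc 0)) x * (G x \<bullet> G x) / (s x)\<^sup>2
    + v x / s x * (G x \<bullet> ((- (2 * real (0 + 2) * bump 1 (Suc 0) x)) *\<^sub>R x))" for x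
  have Gx: "G x \<bullet> x = 0" for x
  proof -
    have "x \<bullet> grad v x = d * v x" "x \<bullet> grad u x = d * u x"
      using homogeneous_Euler u v harmonic_GDERIV by blast+
    then show ?thesis by (simp add: G_def wronskian_def inner_commute[of _ x] inner_diff_right)
  qed
  have cont: "continuous_on UNIV (\<lambda>x::'a. (- (2 * real (0 + 2) * bump 1 (Suc 0) x)) *\<^sub>R x)"
    by (intro continuous_intros continuous_bump)
  note E = energy_identity[OF u(1) v(1) s_def s zero_le_one GDERIV_bump[of 1 0] cont, where r=1, folded G_def, folded I_def]
  have I: "integrable lborel I" "(\<integral>x. I x \<partial>lborel) = 0"
    using E by (simp_all add: bump_support)
  have Ieq: "I x = bump 1 2 x * (G x \<bullet> G x) / (s x)\<^sup>2" for x
    by (simp add: I_def Gx numeral_2_eq_2)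
  define U where "U = ball 0 1 \<inter> u -` (- {0})"
  have cu: "continuous_on UNIV u" and cv: "continuous_on UNIV v" using u v by (auto intro: harmonic_continuous)
  have "open U"
    unfolding U_def using continuous_on_subset[OF cu subset_UNIV]
    by (intro continuous_open_preimage) auto
  have s0: "s x \<noteq> 0" if "x \<in> U" for x using that s(1)[of x] by (auto simp: U_def)
  have G0: "G x = 0" if "x \<in> U" for x
  proof -
    have cs: "continuous_on U s" unfolding s_def
      by (intro continuous_intros continuous_on_subset[OF cu subset_UNIV] continuous_on_subset[OF cv subset_UNIV])
    have "I x = 0"
    proof (rule integral_eq_0_imp_eq_0_open[OF I(1) _ _ \<open>open U\<close> _ that])
      show "I x \<ge> 0" for x by (simp add: Ieq bump_nonneg)
      show "continuous_on U I"
        unfolding Ieq[abs_def] G_def using s0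
        by (intro continuous_intros continuous_bump cs continuous_on_subset[OF continuous_wronskian[OF u(1) v(1)] subset_UNIV]) auto
    qed (simp add: I)
    then show ?thesis using s0[OF that] that bump_pos[of x 2] by (auto simp: Ieq U_def)
  qed
  obtain p where "p \<in> U" using homogeneous_nonzero_in_ball[OF u(2,3)] by (auto simp: U_def)
  then obtain e where e: "e > 0" "ball p e \<subseteq> U" using \<open>open U\<close> by (meson openE)
  define c where "c = v p * inverse (u p)"
  \<comment> \<open>Constancy is proved on one ball only, since \<open>U\<close> may be
    disconnected; unique continuation for v - c u does the rest.\<close>
  have const: "v x * inverse (u x) = c" if "x \<in> ball p e" for x
  proof -
    have "\<exists>c. \<forall>x\<in>ball p e. v x * inverse (u x) = c"
    proof (rule has_derivative_zero_constant)
      fix y assume "y \<in> ball p e"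
      then have "y \<in> U" using e by auto
      then have uy: "u y \<noteq> 0" by (simp add: U_def)
      have "GDERIV (\<lambda>x. v x * inverse (u x)) y :> v y *\<^sub>R (- (inverse (u y))\<^sup>2 *\<^sub>R grad u y) + inverse (u y) *\<^sub>R grad v y"
        by (intro GDERIV_mult GDERIV_inverse harmonic_GDERIV u v uy)
      moreover have "v y *\<^sub>R (- (inverse (u y))\<^sup>2 *\<^sub>R grad u y) + inverse (u y) *\<^sub>R grad v y = (inverse (u y))\<^sup>2 *\<^sub>R G y"
        using uy by (simp add: G_def wronskian_def algebra_simps power2_eq_square)
      ultimately have "GDERIV (\<lambda>x. v x * inverse (u x)) y :> 0" using G0[OF \<open>y \<in> U\<close>] by simp
      then show "((\<lambda>x. v x * inverse (u x)) has_derivative (\<lambda>h. 0)) (at y within ball p e)"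
        by (simp add: gderiv_def has_derivative_at_withinI)
    qed simp
    then show ?thesis using that e(1) by (auto simp: c_def)
  qed
  have "1 * v x + (- c) * u x = 0" for x
  proof (rule harmonic_unique_continuation[OF harmonic_lin[OF v(1) u(1)], of d 1 "- c"])
    show "growth d (\<lambda>x. 1 * v x + - c * u x)"
    proof (rule growth_homogeneous)
      show "continuous_on UNIV (\<lambda>x. 1 * v x + - c * u x)"
        by (rule harmonic_continuous[OF harmonic_lin[OF v(1) u(1)]])
      show "homogeneous d (\<lambda>x. 1 * v x + - c * u x)"
        using u(2) v(2) by (simp add: homogeneous_def algebra_simps)
    qed
    show "ball p e \<noteq> {}" using e by simp
    fix x assume x: "x \<in> ball p e"
    then have "u x \<noteq> 0" using e by (auto simp: U_def)
    then show "1 * v x + - c * u x = 0" using const[OF x] by (simp add: field_simps)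
  qed simp
  then have eq: "v x = c * u x" for x by (simp add: add_eq_0_iff2)
  have "u p \<noteq> 0" using \<open>p \<in> U\<close> by (simp add: U_def)
  moreover have "c * (u p)\<^sup>2 \<ge> 0" using sign[of p] by (simp add: eq power2_eq_square mult_ac)
  ultimately have "c \<ge> 0" by (simp add: zero_le_mult_iff)
  with eq show ?thesis by blast
qed

text \<open>The zeros in the unit ball lie in every sublevel set, whose measure is at most a
  constant times \<delta>, for all \<delta> > 0. The unit ball suffices, as the cutoff used later
  vanishes outside it.\<close>

lemma homogeneous_harmonic_zero_set_null:
  fixes u :: "'a::euclidean_space \<Rightarrow> real"
  assumes u: "harmonic u" "homogeneous d u" "u x1 \<noteq> 0"
  shows "AE x in lborel. norm x < 1 \<longrightarrow> u x \<noteq> 0"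
proof -
  define a where "a j = (if j = d then u else (\<lambda>_. 0))" for j
  have a: "harmonic (a j)" "homogeneous j (a j)" for j
    using u by (auto simp: a_def harmonic_const homogeneous_def)
  have sum: "(\<Sum>j\<le>d. a j x) = u x" for x
    by (simp add: a_def if_distribR sum.delta cong: if_cong)
  obtain h where h: "norm h < 1" "u h \<noteq> 0" using homogeneous_nonzero_in_ball[OF u(2,3)] by blast
  define N where "N = ball 0 1 \<inter> u -` {0}"
  have [measurable]: "u \<in> borel_measurable borel"
    by (rule borel_measurable_continuous_onI[OF harmonic_continuous[OF u(1)]])
  have N: "N \<in> sets lborel" unfolding N_def using measurable_sets_borel[of u borel "{0}"] by auto
  define V where "V = measure lborel (ball (0::'a) 3)"
  have V: "emeasure lborel (ball (0::'a) 3) = ennreal V" "V \<ge> 0"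
    using emeasure_lborel_ball_finite[of "0::'a" 3] by (auto simp: V_def emeasure_eq_ennreal_measure)
  have le: "emeasure lborel N \<le> ennreal (2 * real d * V * \<delta>)" if \<delta>: "\<delta> > 0" for \<delta>
  proof -
    have "open {y \<in> ball 0 2. \<bar>u y\<bar> < \<bar>u h\<bar> * \<delta> ^ d}"
    proof -
      have "{y \<in> ball 0 2. \<bar>u y\<bar> < \<bar>u h\<bar> * \<delta> ^ d} = ball 0 2 \<inter> {y. \<bar>u y\<bar> < \<bar>u h\<bar> * \<delta> ^ d}" by auto
      then show ?thesis
        by (auto intro!: open_Int open_Collect_less continuous_intros harmonic_continuous[OF u(1)])
    qed
    then have "emeasure lborel N \<le> emeasure lborel {y \<in> ball 0 2. \<bar>u y\<bar> < \<bar>u h\<bar> * \<delta> ^ d}"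
      using h \<delta> by (intro emeasure_mono) (auto simp: N_def)
    also have "\<dots> \<le> ennreal (2 * real d * \<delta>) * emeasure lborel (ball (0::'a) 3)"
      using emeasure_harmonic_sublevel[of d a h \<delta>, OF a _ _ \<delta>] h unfolding sum by (simp add: a_def)
    also have "\<dots> = ennreal (2 * real d * V * \<delta>)"
      using \<delta> V by (simp add: ennreal_mult'[symmetric] mult_ac)
    finally show ?thesis .
  qed
  have "emeasure lborel N \<le> 0"
  proof (rule ennreal_le_epsilon)
    fix e :: real assume e: "0 < e"
    define K where "K = 2 * real d * V"
    have "K \<ge> 0" using V by (simp add: K_def)
    then have "K * (e / (K + 1)) \<le> e" using e by (simp add: field_simps)
    moreover have "e / (K + 1) > 0" using e \<open>K \<ge> 0\<close> by simp
    then have "emeasure lborel N \<le> ennreal (K * (e / (K + 1)))"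
      using le unfolding K_def[symmetric] by blast
    ultimately show "emeasure lborel N \<le> 0 + ennreal e"
      using ennreal_leI order_trans by fastforce
  qed
  then have "N \<in> null_sets lborel" using N by (simp add: null_sets_def)
  then have "AE x in lborel. x \<notin> N" by (rule AE_not_in)
  then show ?thesis by (rule AE_mp) (auto simp: N_def)
qed

lemma GDERIV_sum:
  assumes "\<And>j. j \<in> J \<Longrightarrow> GDERIV (f j) x :> g j"
  shows "GDERIV (\<lambda>x. \<Sum>j\<in>J. c j * f j x) x :> (\<Sum>j\<in>J. c j *\<^sub>R g j)"
proof -
  have "((\<lambda>x. \<Sum>j\<in>J. c j * f j x) has_derivative (\<lambda>h. \<Sum>j\<in>J. c j * (h \<bullet> g j))) (at x)"
    using assms unfolding gderiv_def by (intro has_derivative_sum has_derivative_mult_right)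
  then show ?thesis by (simp add: gderiv_def inner_sum_right)
qed

lemma tendsto_top_term:
  fixes g :: "nat \<Rightarrow> 'b::real_normed_vector"
  assumes "(\<tau> \<longlongrightarrow> (0::real)) F"
  shows "((\<lambda>i. \<Sum>j\<le>d. \<tau> i ^ (d - j) *\<^sub>R g j) \<longlongrightarrow> g d) F"
proof -
  have "((\<lambda>i. \<Sum>j\<le>d. \<tau> i ^ (d - j) *\<^sub>R g j) \<longlongrightarrow> (\<Sum>j\<le>d. 0 ^ (d - j) *\<^sub>R g j)) F"
    by (intro tendsto_intros assms)
  moreover have "(\<Sum>j\<le>d. 0 ^ (d - j) *\<^sub>R g j) = (\<Sum>j\<in>{d}. g j)"
    by (rule sum.mono_neutral_cong_right) auto
  ultimately show ?thesis by simp
qed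

lemma scaled_homogeneous_sum:
  assumes "\<And>j. j \<le> d \<Longrightarrow> homogeneous j (a j)" "t \<noteq> 0"
  shows "(\<Sum>j\<le>d. t ^ (d - j) * a j x) = t ^ d * (\<Sum>j\<le>d. a j (x /\<^sub>R t))"
  unfolding sum_distrib_left
proof (intro sum.cong refl)
  fix j assume "j \<in> {..d}"
  then have j: "j \<le> d" by simp
  have "t ^ d = t ^ (d - j) * t ^ j" using j by (simp add: power_add[symmetric])
  then show "t ^ (d - j) * a j x = t ^ d * a j (x /\<^sub>R t)"
    using assms(1)[OF j] assms(2) by (simp add: homogeneous_def power_inverse field_simps)
qed

text \<open>Blow-down at infinity: if the degree \<open>k\<close> of \<open>w\<close> is smaller than that of \<open>u\<close>, Euler's identity
  makes the boundary term of the energy identity for the leading parts a positive multiple of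
  \<open>(d - k) b\<^sub>k\<^sup>2\<close>, so that both terms have the same sign and must vanish. Truncating the integrand
  from above gives the dominated convergence needed to pass to the leading parts.\<close>

lemma no_lower_degree_remainder:
  fixes a b :: "nat \<Rightarrow> 'a::euclidean_space \<Rightarrow> real"
  assumes a: "\<And>j. j \<le> d \<Longrightarrow> harmonic (a j)" "\<And>j. j \<le> d \<Longrightarrow> homogeneous j (a j)"
    and b: "\<And>j. j \<le> k \<Longrightarrow> harmonic (b j)" "\<And>j. j \<le> k \<Longrightarrow> homogeneous j (b j)"
    and nz: "a d x1 \<noteq> 0" "b k x2 \<noteq> 0" and "k < d" and c: "c \<ge> 0"
    and sign: "\<And>x. (\<Sum>j\<le>d. a j x) * (c * (\<Sum>j\<le>d. a j x) + (\<Sum>j\<le>k. b j x)) \<ge> 0"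
  shows False
proof -
  \<comment> \<open>With this choice s = u + (c u + \<beta> w), a sum of two functions of the same
    sign, so |s| bounds both.\<close>
  define \<alpha> where "\<alpha> = 1 + c"
  have \<alpha>: "\<alpha> > 0" using c by (simp add: \<alpha>_def)
  define \<tau> where "\<tau> i = inverse (real (Suc i))" for i
  have \<tau>: "\<tau> i > 0" "\<tau> i \<le> 1" "\<tau> i \<noteq> 0" for i by (auto simp: \<tau>_def field_simps)
  have \<tau>0: "\<tau> \<longlonglongrightarrow> 0" unfolding \<tau>_def[abs_def] by (rule LIMSEQ_inverse_real_of_nat)
  \<comment> \<open>\<open>u i x\<close> is t^d times the original sum at x / t with t =
    \<open>\<tau> i\<close>, and \<open>w i\<close> is rescaled with its own degree
    \<open>k\<close>. The mismatch is the factor \<open>\<beta> i\<close>, which tends to 0.\<close>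
  define u where "u i x = (\<Sum>j\<le>d. \<tau> i ^ (d - j) * a j x)" for i x
  define w where "w i x = (\<Sum>j\<le>k. \<tau> i ^ (k - j) * b j x)" for i x
  define \<beta> where "\<beta> i = \<tau> i ^ (d - k)" for i
  have \<beta>: "\<beta> i > 0" for i using \<tau>(1) by (simp add: \<beta>_def)
  have \<beta>0: "\<beta> \<longlonglongrightarrow> 0"
  proof -
    have "\<beta> \<longlonglongrightarrow> 0 ^ (d - k)" unfolding \<beta>_def[abs_def] by (intro tendsto_intros \<tau>0)
    then show ?thesis using \<open>k < d\<close> by (simp add: zero_power)
  qed
  define s where "s i x = \<alpha> * u i x + \<beta> i * w i x" for i x
  have hu: "harmonic (u i)" for i unfolding u_def[abs_def] using a(1) by (intro harmonic_sum) auto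
  have hw: "harmonic (w i)" for i unfolding w_def[abs_def] using b(1) by (intro harmonic_sum) auto
  have ueq: "u i x = \<tau> i ^ d * (\<Sum>j\<le>d. a j (x /\<^sub>R \<tau> i))" for i x
    unfolding u_def by (rule scaled_homogeneous_sum[OF a(2) \<tau>(3)])
  have weq: "\<beta> i * w i x = \<tau> i ^ d * (\<Sum>j\<le>k. b j (x /\<^sub>R \<tau> i))" for i x
  proof -
    have "\<beta> i * w i x = \<beta> i * (\<tau> i ^ k * (\<Sum>j\<le>k. b j (x /\<^sub>R \<tau> i)))"
      unfolding w_def by (subst scaled_homogeneous_sum[OF b(2) \<tau>(3)]) auto
    moreover have "\<tau> i ^ d = \<beta> i * \<tau> i ^ k" using \<open>k < d\<close> by (simp add: \<beta>_def power_add[symmetric])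
    ultimately show ?thesis by (simp only: mult.assoc)
  qed
  have sg: "u i x * (c * u i x + \<beta> i * w i x) \<ge> 0" for i x
  proof -
    have "u i x * (c * u i x + \<beta> i * w i x) = (\<tau> i ^ d)\<^sup>2 * ((\<Sum>j\<le>d. a j (x /\<^sub>R \<tau> i)) * (c * (\<Sum>j\<le>d. a j (x /\<^sub>R \<tau> i)) + (\<Sum>j\<le>k. b j (x /\<^sub>R \<tau> i))))"
      unfolding ueq weq by (simp add: power2_eq_square algebra_simps)
    then show ?thesis using sign by simp
  qed
  \<comment> \<open>\<open>M i\<close> blows up as \<open>\<beta> i\<close> tends to 0; it serves
    only to license the energy identity for each fixed \<open>i\<close>.\<close>
  define M where "M i = 1 + \<alpha> / \<beta> i" for i
  have M0: "M i \<ge> 0" for i using \<alpha> \<beta>[of i] by (simp add: M_def add_nonneg_nonneg)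
  have su: "\<bar>u i x\<bar> \<le> \<bar>s i x\<bar>" and sv: "\<bar>c * u i x + \<beta> i * w i x\<bar> \<le> \<bar>s i x\<bar>" for i x
  proof -
    have "s i x = u i x + (c * u i x + \<beta> i * w i x)" by (simp add: s_def \<alpha>_def algebra_simps)
    then show "\<bar>u i x\<bar> \<le> \<bar>s i x\<bar>" "\<bar>c * u i x + \<beta> i * w i x\<bar> \<le> \<bar>s i x\<bar>"
      using sg[of i x] by (auto simp: zero_le_mult_iff)
  qed
  have Mu: "\<bar>u i x\<bar> \<le> M i * \<bar>s i x\<bar>" for i x
  proof -
    have "1 * \<bar>s i x\<bar> \<le> M i * \<bar>s i x\<bar>" using \<alpha> \<beta>[of i] by (intro mult_right_mono) (auto simp: M_def)
    then show ?thesis using su[of i x] by simp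
  qed
  have Mw: "\<bar>w i x\<bar> \<le> M i * \<bar>s i x\<bar>" for i x
  proof -
    have "\<beta> i * \<bar>w i x\<bar> = \<bar>(c * u i x + \<beta> i * w i x) - c * u i x\<bar>" using \<beta>[of i] by (simp add: abs_mult)
    also have "\<dots> \<le> \<bar>c * u i x + \<beta> i * w i x\<bar> + c * \<bar>u i x\<bar>"
      using abs_triangle_ineq4[of "c * u i x + \<beta> i * w i x" "c * u i x"] c by (simp add: abs_mult)
    also have "\<dots> \<le> \<bar>s i x\<bar> + c * \<bar>s i x\<bar>"
      using sv[of i x] su[of i x] c by (intro add_mono mult_left_mono) auto
    finally have "\<bar>w i x\<bar> \<le> \<alpha> / \<beta> i * \<bar>s i x\<bar>" using \<beta>[of i] by (simp add: \<alpha>_def field_simps)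
    also have "\<dots> \<le> M i * \<bar>s i x\<bar>" by (intro mult_right_mono) (auto simp: M_def)
    finally show ?thesis .
  qed
  define G where "G i = wronskian (u i) (w i)" for i
  define \<eta>' :: "'a \<Rightarrow> 'a" where "\<eta>' x = (- (2 * real (2 + 2) * bump 1 (Suc 2) x)) *\<^sub>R x" for x
  define I where "I i x = \<alpha> * bump 1 (Suc (Suc 2)) x * (G i x \<bullet> G i x) / (s i x)\<^sup>2 + w i x / s i x * (G i x \<bullet> \<eta>' x)" for i x
  have c\<eta>': "continuous_on UNIV \<eta>'"
    unfolding \<eta>'_def by (intro continuous_intros continuous_bump)
  have d\<eta>: "GDERIV (bump 1 (Suc (Suc 2))) x :> \<eta>' x" for x :: 'a
    unfolding \<eta>'_def by (rule GDERIV_bump)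
  have I: "integrable lborel (I i)" "(\<integral>x. I i x \<partial>lborel) = 0" for i
    unfolding I_def[abs_def] G_def
    using energy_identity[OF hu hw s_def Mu Mw M0 d\<eta> c\<eta>', where r=1]
    by (simp_all add: bump_support)
  have Iout: "I i x = 0" if "\<not> norm x < 1" for i x
  proof -
    have "1 - x \<bullet> x \<le> 0" using that by (simp add: dot_square_norm)
    then show ?thesis by (simp add: I_def \<eta>'_def bump_def)
  qed
  define W where "W x = (\<Sum>j\<le>k. \<bar>b j x\<bar>)" for x
  \<comment> \<open>This bound comes from completing the square in \<alpha> T^2 - 8 W T, with
    \<open>T\<close> as introduced below; it does not depend on \<open>i\<close>.\<close>
  define B where "B x = 16 * bump 1 2 x * (W x)\<^sup>2 / \<alpha>" for x
  have wW: "\<bar>w i x\<bar> \<le> W x" for i x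
    unfolding w_def W_def using \<tau>[of i]
    by (intro order_trans[OF sum_abs] sum_mono) (auto simp: abs_mult intro!: mult_left_le_one_le power_le_one)
  have lower: "- B x \<le> I i x" for i x
  proof (cases "norm x < 1")
    case False
    then show ?thesis using \<alpha> by (simp add: Iout B_def bump_nonneg)
  next
    case True
    define p where "p = max 0 (1 - x \<bullet> x)"
    define T where "T = p * norm (G i x) / \<bar>s i x\<bar>"
    have p: "p \<ge> 0" by (simp add: p_def)
    have eq: "I i x = p\<^sup>2 * (\<alpha> * T\<^sup>2) - 8 * p\<^sup>2 * (w i x * (p * (G i x \<bullet> x) / s i x))"
    proof -
      have "bump 1 j x = p ^ j" for j by (simp add: bump_def p_def)
      then show ?thesis
        by (simp add: I_def \<eta>'_def T_def power2_norm_eq_inner[symmetric] eval_nat_numeral algebra_simps)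
    qed
    have "\<bar>w i x * (p * (G i x \<bullet> x) / s i x)\<bar> \<le> W x * T"
    proof -
      have "\<bar>G i x \<bullet> x\<bar> \<le> norm (G i x) * 1"
        using Cauchy_Schwarz_ineq2[of "G i x" x] True mult_left_mono[of "norm x" 1 "norm (G i x)"] by simp
      then have "\<bar>p * (G i x \<bullet> x) / s i x\<bar> \<le> T"
        using p unfolding T_def by (auto simp: abs_mult intro!: divide_right_mono mult_left_mono)
      then show ?thesis
        unfolding abs_mult[of "w i x"] using wW[of i x] by (intro mult_mono) auto
    qed
    then have "8 * (w i x * (p * (G i x \<bullet> x) / s i x)) \<le> 8 * (W x * T)" by linarith
    also have "\<dots> \<le> \<alpha> * T\<^sup>2 + 16 * (W x)\<^sup>2 / \<alpha>"
    proof -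
      have "0 \<le> (\<alpha> * T - 4 * W x)\<^sup>2 / \<alpha>" using \<alpha> by simp
      also have "\<dots> = \<alpha> * T\<^sup>2 + 16 * (W x)\<^sup>2 / \<alpha> - 8 * (W x * T)"
        using \<alpha> by (simp add: power2_eq_square field_simps)
      finally show ?thesis by simp
    qed
    finally have "p\<^sup>2 * (8 * (w i x * (p * (G i x \<bullet> x) / s i x))) \<le> p\<^sup>2 * (\<alpha> * T\<^sup>2 + 16 * (W x)\<^sup>2 / \<alpha>)"
      by (intro mult_left_mono) auto
    moreover have "B x = p\<^sup>2 * (16 * (W x)\<^sup>2 / \<alpha>)" by (simp add: B_def bump_def p_def)
    ultimately show ?thesis unfolding eq by (simp add: algebra_simps)
  qed
  \<comment> \<open>The cap is integrable and positive on the open unit ball, so that vanishing of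
    the capped limit there forces vanishing of the limit itself.\<close>
  define J where "J i x = min (I i x) (bump 1 1 x)" for i x
  have cB: "continuous_on UNIV (\<lambda>x. B x + bump 1 1 x)"
    unfolding B_def W_def using b(1) \<alpha>
    by (intro continuous_intros continuous_bump harmonic_continuous) auto
  have iB: "integrable lborel (\<lambda>x. B x + bump 1 1 x)"
    by (rule integrable_compact_support[OF cB, where r=1]) (simp add: B_def bump_support)
  have Bnn: "B x \<ge> 0" for x using \<alpha> by (simp add: B_def bump_nonneg)
  have Jbd: "norm (J i x) \<le> B x + bump 1 1 x" for i x
    using lower[of x i] Bnn[of x] bump_nonneg[of 1 1 x] by (simp add: J_def abs_le_iff min_def)
  have mJ: "J i \<in> borel_measurable lborel" for i
    unfolding J_def[abs_def] using I(1)[of i]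
    by (intro borel_measurable_min) (auto intro: borel_measurable_continuous_onI continuous_bump)
  have iJ: "integrable lborel (J i)" for i
    by (rule Bochner_Integration.integrable_bound[OF iB mJ]) (use Jbd Bnn in \<open>auto simp: bump_nonneg intro: order_trans[OF _ abs_ge_self]\<close>)
  have J0: "(\<integral>x. J i x \<partial>lborel) \<le> 0" for i
  proof -
    have "(\<integral>x. J i x \<partial>lborel) \<le> (\<integral>x. I i x \<partial>lborel)"
      by (rule integral_mono[OF iJ I(1)]) (simp add: J_def)
    then show ?thesis unfolding I(2) .
  qed
  have ad: "harmonic (a d)" "homogeneous d (a d)" and bk: "harmonic (b k)" "homogeneous k (b k)" using a b by auto
  define Gtop where "Gtop = wronskian (a d) (b k)"
  define Itop where "Itop x = \<alpha> * bump 1 (Suc (Suc 2)) x * (Gtop x \<bullet> Gtop x) / (\<alpha> * a d x)\<^sup>2 + b k x / (\<alpha> * a d x) * (Gtop x \<bullet> \<eta>' x)" for x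
  define Jtop where "Jtop x = min (Itop x) (bump 1 1 x)" for x
  have gradu: "grad (u i) x = (\<Sum>j\<le>d. \<tau> i ^ (d - j) *\<^sub>R grad (a j) x)" for i x
    unfolding u_def[abs_def] using a(1) hu[of i]
    by (intro grad_eqI GDERIV_sum harmonic_GDERIV) (auto simp: u_def[abs_def] harmonicD(1))
  have gradw: "grad (w i) x = (\<Sum>j\<le>k. \<tau> i ^ (k - j) *\<^sub>R grad (b j) x)" for i x
    unfolding w_def[abs_def] using b(1) hw[of i]
    by (intro grad_eqI GDERIV_sum harmonic_GDERIV) (auto simp: w_def[abs_def] harmonicD(1))
  have limu: "(\<lambda>i. u i x) \<longlonglongrightarrow> a d x" for x
    unfolding u_def using tendsto_top_term[OF \<tau>0, of d "\<lambda>j. a j x"] by simp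
  have limw: "(\<lambda>i. w i x) \<longlonglongrightarrow> b k x" for x
    unfolding w_def using tendsto_top_term[OF \<tau>0, of k "\<lambda>j. b j x"] by simp
  have limG: "(\<lambda>i. G i x) \<longlonglongrightarrow> Gtop x" for x
    unfolding G_def Gtop_def wronskian_def gradu gradw
    by (intro tendsto_intros limu limw tendsto_top_term \<tau>0)
  have lims: "(\<lambda>i. s i x) \<longlonglongrightarrow> \<alpha> * a d x" for x
  proof -
    have "(\<lambda>i. s i x) \<longlonglongrightarrow> \<alpha> * a d x + 0 * b k x"
      unfolding s_def by (intro tendsto_intros limu limw \<beta>0)
    then show ?thesis by simp
  qed
  have limJ: "(\<lambda>i. J i x) \<longlonglongrightarrow> Jtop x" if "norm x < 1 \<longrightarrow> a d x \<noteq> 0" for x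
  proof (cases "norm x < 1")
    case True
    then have nz: "\<alpha> * a d x \<noteq> 0" "(\<alpha> * a d x)\<^sup>2 \<noteq> 0" using that \<alpha> by auto
    show ?thesis
      unfolding J_def Jtop_def I_def Itop_def
      by (intro tendsto_intros limw limG lims nz)
  next
    case False
    have "1 - x \<bullet> x \<le> 0" using False by (simp add: dot_square_norm)
    then have "Itop x = 0" by (simp add: Itop_def \<eta>'_def bump_def)
    then show ?thesis using False by (simp add: J_def Jtop_def Iout)
  qed
  have mJtop: "Jtop \<in> borel_measurable lborel"
  proof -
    have [measurable]: "a d \<in> borel_measurable borel" "b k \<in> borel_measurable borel"
      "Gtop \<in> borel_measurable borel" "\<eta>' \<in> borel_measurable borel" "bump 1 j \<in> borel_measurable (borel :: 'a measure)" for j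
      unfolding Gtop_def using ad bk
      by (auto intro!: borel_measurable_continuous_onI harmonic_continuous continuous_wronskian c\<eta>' continuous_bump)
    show ?thesis unfolding Jtop_def[abs_def] Itop_def[abs_def] by measurable
  qed
  have AElim: "AE x in lborel. (\<lambda>i. J i x) \<longlonglongrightarrow> Jtop x"
    using homogeneous_harmonic_zero_set_null[OF ad nz(1)] by (rule AE_mp) (use limJ in auto)
  have "integrable lborel Jtop"
    by (rule integrable_dominated_convergence[OF mJtop mJ iB AElim]) (use Jbd in auto)
  moreover have "(\<integral>x. Jtop x \<partial>lborel) \<le> 0"
  proof (rule LIMSEQ_le_const2)
    show "(\<lambda>i. \<integral>x. J i x \<partial>lborel) \<longlonglongrightarrow> (\<integral>x. Jtop x \<partial>lborel)"
      by (rule integral_dominated_convergence[OF mJtop mJ iB AElim]) (use Jbd in auto)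
    show "\<exists>N. \<forall>n\<ge>N. (\<integral>x. J n x \<partial>lborel) \<le> 0" using J0 by blast
  qed
  moreover have Itopeq: "Itop x = bump 1 4 x * (Gtop x \<bullet> Gtop x) / (\<alpha> * (a d x)\<^sup>2) + 8 * bump 1 3 x * (real d - real k) * (b k x)\<^sup>2 / \<alpha>"
    if "a d x \<noteq> 0" for x
  proof -
    have "x \<bullet> grad (a d) x = d * a d x" "x \<bullet> grad (b k) x = k * b k x"
      using homogeneous_Euler ad bk harmonic_GDERIV by blast+
    then have Gx: "Gtop x \<bullet> x = (real k - real d) * (a d x * b k x)"
      by (simp add: Gtop_def wronskian_def inner_diff_left inner_commute[of _ x] algebra_simps)
    have "b k x / (\<alpha> * a d x) * (Gtop x \<bullet> \<eta>' x) = - 8 * bump 1 3 x * (b k x / (\<alpha> * a d x) * (Gtop x \<bullet> x))"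
      by (simp add: \<eta>'_def numeral_3_eq_3 numeral_2_eq_2)
    also have "\<dots> = 8 * bump 1 3 x * (real d - real k) * (b k x)\<^sup>2 / \<alpha>"
      unfolding Gx using that \<alpha> by (simp add: field_simps power2_eq_square)
    finally show ?thesis
      unfolding Itop_def using \<alpha> by (simp add: power2_eq_square eval_nat_numeral)
  qed
  moreover have dk: "real d - real k > 0" using \<open>k < d\<close> by simp
  have Itopnn: "Itop x \<ge> 0" for x
  proof (cases "a d x = 0")
    case False
    then show ?thesis using \<alpha> dk by (simp add: Itopeq bump_nonneg add_nonneg_nonneg)
  qed (simp add: Itop_def)
  define U where "U = ball 0 1 \<inter> a d -` (- {0})"
  have cad: "continuous_on S (a d)" "continuous_on S (b k)" "continuous_on S Gtop" for S
    unfolding Gtop_def using ad bk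
    by (auto intro: continuous_on_subset[OF harmonic_continuous subset_UNIV] continuous_on_subset[OF continuous_wronskian subset_UNIV])
  have "open U" unfolding U_def by (intro continuous_open_preimage cad) auto
  have "continuous_on U Jtop"
    unfolding Jtop_def[abs_def] Itop_def[abs_def] using \<alpha>
    by (intro continuous_intros continuous_bump cad continuous_on_subset[OF c\<eta>' subset_UNIV]) (auto simp: U_def)
  ultimately have JU: "Jtop x = 0" if "x \<in> U" for x
    using integral_eq_0_imp_eq_0_open[OF _ _ _ \<open>open U\<close> _ that, of Jtop] Itopnn by (simp add: Jtop_def bump_nonneg)
  have bU: "b k x = 0" if x: "x \<in> U" for x
  proof (rule ccontr)
    assume "b k x \<noteq> 0"
    have nx: "norm x < 1" and ax: "a d x \<noteq> 0" using x by (auto simp: U_def)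
    have "8 * bump 1 3 x * (real d - real k) * (b k x)\<^sup>2 / \<alpha> > 0"
      using bump_pos[OF nx, of 3] dk \<alpha> \<open>b k x \<noteq> 0\<close> by simp
    moreover have "bump 1 4 x * (Gtop x \<bullet> Gtop x) / (\<alpha> * (a d x)\<^sup>2) \<ge> 0" using \<alpha> by (simp add: bump_nonneg)
    ultimately have "Itop x > 0" using Itopeq[OF ax] by simp
    then show False using JU[OF x] bump_pos[OF nx, of 1] by (simp add: Jtop_def min_def split: if_splits)
  qed
  have "U \<noteq> {}" using homogeneous_nonzero_in_ball[OF ad(2) nz(1)] by (auto simp: U_def)
  then have "b k x2 = 0"
    by (rule harmonic_unique_continuation[OF bk(1) growth_homogeneous[OF harmonic_continuous[OF bk(1)] bk(2)] \<open>open U\<close> _ bU])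
  with nz(2) show False by simp
qed

lemma top_component:
  fixes a :: "nat \<Rightarrow> 'a \<Rightarrow> real"
  assumes "(\<Sum>j\<le>D. a j x0) \<noteq> 0"
  shows "\<exists>k\<le>D. (\<exists>x. a k x \<noteq> 0) \<and> (\<forall>x. (\<Sum>j\<le>D. a j x) = (\<Sum>j\<le>k. a j x))"
  using assms
proof (induction D)
  case (Suc D)
  show ?case
  proof (cases "\<exists>x. a (Suc D) x \<noteq> 0")
    case False
    then have "(\<Sum>j\<le>Suc D. a j x) = (\<Sum>j\<le>D. a j x)" for x by simp
    then show ?thesis using Suc le_SucI by metis
  qed auto
qed auto

lemma harmonic_same_sign_imp_proportional:
  fixes u v :: "'a::euclidean_space \<Rightarrow> real"
  assumes u: "harmonic u" "growth D u" "u x1 \<noteq> 0" and v: "harmonic v" "v x2 \<noteq> 0"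
    and sign: "\<And>x. u x * v x \<ge> 0"
  shows "\<exists>c. c \<noteq> 0 \<and> (\<forall>x. v x = c * u x)"
proof -
  obtain a where a': "\<And>j. homogeneous j (a j)" "\<And>j. j \<le> D \<Longrightarrow> harmonic (a j)" "\<And>x. u x = (\<Sum>j\<le>D. a j x)"
    using harmonic_homogeneous_decomposition[OF u(1,2)] by blast
  then obtain d xa where d: "d \<le> D" "a d xa \<noteq> 0" "\<And>x. u x = (\<Sum>j\<le>d. a j x)"
    using top_component[where a=a and D=D and ?x0.0=x1] u(3) by auto
  have a: "harmonic (a j)" "homogeneous j (a j)" if "j \<le> d" for j using a' d(1) that by auto
  have gv: "growth d v"
    by (rule growth_of_constant_sign[OF v(1) a d(2)]) (use sign d(3) in auto)
  obtain b where b': "\<And>j. homogeneous j (b j)" "\<And>j. j \<le> d \<Longrightarrow> harmonic (b j)" "\<And>x. v x = (\<Sum>j\<le>d. b j x)"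
    using harmonic_homogeneous_decomposition[OF v(1) gv] by blast
  then obtain k xb where k: "k \<le> d" "b k xb \<noteq> 0" "\<And>x. v x = (\<Sum>j\<le>k. b j x)"
    using top_component[where a=b and D=d and ?x0.0=x2] v(2) by auto
  \<comment> \<open>The nonnegative quantity t^(d + k) u(x / t) v(x / t) tends to the product of the
    leading parts as \<open>t\<close> decreases to 0.\<close>
  have top: "a d x * b k x \<ge> 0" for x
  proof (rule tendsto_lowerbound)
    have \<tau>0: "(\<lambda>i. inverse (real (Suc i))) \<longlonglongrightarrow> 0" by (rule LIMSEQ_inverse_real_of_nat)
    show "(\<lambda>i. (\<Sum>j\<le>d. inverse (real (Suc i)) ^ (d - j) *\<^sub>R a j x) * (\<Sum>j\<le>k. inverse (real (Suc i)) ^ (k - j) *\<^sub>R b j x)) \<longlonglongrightarrow> a d x * b k x"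
      by (intro tendsto_mult tendsto_top_term[OF \<tau>0])
    show "\<forall>\<^sub>F i in sequentially. 0 \<le> (\<Sum>j\<le>d. inverse (real (Suc i)) ^ (d - j) *\<^sub>R a j x) * (\<Sum>j\<le>k. inverse (real (Suc i)) ^ (k - j) *\<^sub>R b j x)"
    proof (intro always_eventually allI)
      fix i
      define t where "t = inverse (real (Suc i))"
      have t: "t > 0" "t \<noteq> 0" by (auto simp: t_def)
      have "(\<Sum>j\<le>d. t ^ (d - j) * a j x) * (\<Sum>j\<le>k. t ^ (k - j) * b j x) = (t ^ d * t ^ k) * (u (x /\<^sub>R t) * v (x /\<^sub>R t))"
        by (simp add: scaled_homogeneous_sum[OF a'(1) t(2)] scaled_homogeneous_sum[OF b'(1) t(2)] d(3) k(3))
      also have "\<dots> \<ge> 0" using t sign by simp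
      finally show "0 \<le> (\<Sum>j\<le>d. inverse (real (Suc i)) ^ (d - j) *\<^sub>R a j x) * (\<Sum>j\<le>k. inverse (real (Suc i)) ^ (k - j) *\<^sub>R b j x)"
        by (simp add: t_def)
    qed
  qed simp
  have bk: "harmonic (b k)" using b'(2) k(1) by blast
  have "d = k"
    by (rule homogeneous_harmonic_same_sign_imp_same_degree[OF a(1)[OF order_refl] a'(1) d(2) bk b'(1) k(2) top])
  then obtain c where c: "c \<ge> 0" "\<And>x. b d x = c * a d x"
    using homogeneous_harmonic_same_sign_imp_proportional[OF a(1)[OF order_refl] a'(1) d(2) bk, of] b'(1) top by blast
  have c0: "c \<noteq> 0" using c(2)[of xb] k(2) \<open>d = k\<close> by auto
  define r where "r j x = 1 * b j x + (- c) * a j x" for j x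
  have r: "harmonic (r j)" "homogeneous j (r j)" if "j \<le> d" for j
  proof -
    show "harmonic (r j)" unfolding r_def by (rule harmonic_lin[OF b'(2)[OF that] a(1)[OF that]])
    show "homogeneous j (r j)" using a'(1)[of j] b'(1)[of j] by (simp add: r_def homogeneous_def algebra_simps)
  qed
  have veq: "v x = c * u x + (\<Sum>j\<le>d. r j x)" for x
    by (simp add: b'(3) d(3) r_def sum_subtractf sum_distrib_left)
  have "(\<Sum>j\<le>d. r j x) = 0" for x
  proof (rule ccontr)
    assume "(\<Sum>j\<le>d. r j x) \<noteq> 0"
    from top_component[where a=r and D=d, OF this] obtain m y where m: "m \<le> d" "r m y \<noteq> 0" "\<And>x. (\<Sum>j\<le>d. r j x) = (\<Sum>j\<le>m. r j x)"
      by blast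
    \<comment> \<open>The components of degree \<open>d\<close> cancel in \<open>r\<close> because
      \<open>b d\<close> is \<open>c\<close> times \<open>a d\<close>, so a nonzero remainder has
      degree below \<open>d\<close>.\<close>
    have "m \<noteq> d" using m(2) c(2) by (auto simp: r_def)
    then have "m < d" using m(1) by simp
    have sgn: "(\<Sum>j\<le>d. a j x) * (c * (\<Sum>j\<le>d. a j x) + (\<Sum>j\<le>m. r j x)) \<ge> 0" for x
      using sign[of x] by (simp add: veq m(3) d(3))
    show False
      by (rule no_lower_degree_remainder[OF a r d(2) m(2) \<open>m < d\<close> c(1) sgn]) (use m in auto)
  qed
  then show ?thesis using veq c0 by auto
qed

section \<open>Growth of polynomials and conclusion\<close>

lemma growth_mono:
  assumes "growth d u" "d \<le> e"
  shows "growth e u"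
proof -
  obtain C where C: "\<And>x. \<bar>u x\<bar> \<le> C * (1 + norm x) ^ d" using assms(1) unfolding growth_def by blast
  have "C \<ge> 0" using C[of 0] by simp
  have "\<bar>u x\<bar> \<le> C * (1 + norm x) ^ e" for x
    using C[of x] mult_left_mono[OF power_increasing[OF assms(2), of "1 + norm x"] \<open>C \<ge> 0\<close>] by simp
  then show ?thesis unfolding growth_def by blast
qed

text \<open>The polynomial hypothesis on \<open>u\<close> enters the proof through this growth bound
  alone.\<close>

lemma growth_real_polynomial_function:
  "real_polynomial_function u \<Longrightarrow> \<exists>d. growth d u"
proof (induction u rule: real_polynomial_function.induct)
  case (linear f)
  then obtain K where K: "\<And>x. norm (f x) \<le> norm x * K" using bounded_linear.bounded by blast
  have "\<bar>f x\<bar> \<le> \<bar>K\<bar> * (1 + norm x) ^ 1" for x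
  proof -
    have "norm x * K \<le> norm x * \<bar>K\<bar>" by (intro mult_left_mono) auto
    also have "\<dots> \<le> (1 + norm x) * \<bar>K\<bar>" by (intro mult_right_mono) auto
    finally have "norm x * K \<le> (1 + norm x) * \<bar>K\<bar>" .
    then show ?thesis using K[of x] by (simp add: mult.commute)
  qed
  then show ?case unfolding growth_def by blast
next
  case (const c)
  have "growth 0 (\<lambda>x. c)" unfolding growth_def by auto
  then show ?case by blast
next
  case (add f g)
  then obtain d e where "growth d f" "growth e g" by blast
  then have "growth (max d e) f" "growth (max d e) g" by (auto intro: growth_mono)
  then obtain C C' where C: "\<And>x. \<bar>f x\<bar> \<le> C * (1 + norm x) ^ max d e" "\<And>x. \<bar>g x\<bar> \<le> C' * (1 + norm x) ^ max d e"
    unfolding growth_def by blast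
  have "\<bar>f x + g x\<bar> \<le> (C + C') * (1 + norm x) ^ max d e" for x
    using C(1)[of x] C(2)[of x] unfolding distrib_right by linarith
  then show ?case unfolding growth_def by blast
next
  case (mult f g)
  then obtain d e C C' where C: "\<And>x. \<bar>f x\<bar> \<le> C * (1 + norm x) ^ d" "\<And>x. \<bar>g x\<bar> \<le> C' * (1 + norm x) ^ e"
    unfolding growth_def by blast
  have "\<bar>f x * g x\<bar> \<le> (C * C') * (1 + norm x) ^ (d + e)" for x
    using mult_mono'[OF C(1)[of x] C(2)[of x]] by (simp add: abs_mult power_add mult_ac)
  then show ?case unfolding growth_def by blast
qed

theorem theorem1p3:
  fixes u v :: "real ^ 'n \<Rightarrow> real"
  assumes "harmonic u" and "harmonic v"
    and "real_polynomial_function u"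
    and "zero_set u = zero_set v"
  shows "\<exists>c::real. c \<noteq> 0 \<and> (\<forall>x. v x = c * u x)"
proof (cases "\<exists>x. u x \<noteq> 0")
  case False
  \<comment> \<open>If \<open>u\<close> is identically 0, so is \<open>v\<close>, and c = 1 will
    do.\<close>
  then have "\<forall>x. v x = 1 * u x"
    using assms(4) by (auto simp: zero_set_def)
  then show ?thesis using zero_neq_one by metis
next
  case True
  then obtain x0 where x0: "u x0 \<noteq> 0" by blast
  have Z: "u x = 0 \<longleftrightarrow> v x = 0" for x
    using assms(4) by (auto simp: zero_set_def)
  have v0: "v x0 \<noteq> 0" using Z x0 by simp
  obtain d where d: "growth d u" using growth_real_polynomial_function[OF assms(3)] by blast
  consider "\<forall>x. u x * v x \<ge> 0" | "\<forall>x. u x * v x \<le> 0"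
    using equal_zero_sets_imp_constant_sign[OF assms(1,2) Z d x0] by blast
  then show ?thesis
  proof cases
    case 1
    then show ?thesis
      using harmonic_same_sign_imp_proportional[OF assms(1) d x0 assms(2) v0] by blast
  next
    case 2
    then obtain c where c: "c \<noteq> 0" "\<forall>x. (-1) * v x = c * u x"
      using harmonic_same_sign_imp_proportional[OF assms(1) d x0 harmonic_cmult[OF assms(2), of "-1"], of x0] v0 by auto
    then have "\<forall>x. v x = (- c) * u x" by (metis minus_mult_left minus_minus mult_1)
    then show ?thesis using c(1) neg_equal_0_iff_equal by blast
  qed
qed

end
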